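(* For any $\mu\in\mathcal M$ and $\bar\sigma=\bar\sigma_\mu$, for all $p\ge1$ and $t>0$, and for all $q\ge1$ and all finite sets $C_1,\dots,C_q\subset\{1,2,\dots\}$, $$\mathbb E\prod_{l\le q}\mathbb E'\prod_{i\in C_l}\bar\sigma_i=\mathbb E\,\frac{\prod_{l\le q}\mathbb E'\prod_{i\in C_l}\bar\sigma_i\,\exp tG_p(\bar\sigma(w,u,\cdot))}{\big(\mathbb E'\exp tG_p(\bar\sigma(w,u,\cdot))\big)^q}.$$
   Context: Model. Let $(\beta_p)$ be indexed by $p=1$ and even $p\ge2$ with $\sum_p2^p\beta_p^2<\infty$. For $\boldsymbol\sigma\in\Sigma_N=\{-1,+1\}^N$ let $-H_{N,p}(\boldsymbol\sigma)=N^{-(p-1)/2}\sum_{1\le i_1,\dots,i_p\le N}g_{i_1,\dots,i_p}\sigma_{i_1}\cdots\sigma_{i_p}$ with independent standard Gaussian coefficients, $H_N=\sum_p\beta_pH_{N,p}$, let $H'_{N,p}$ be independent copies of $H_{N,p}$, and $$-H_N'(\boldsymbol\sigma)=-H_N(\boldsymbol\sigma)-H_N^\delta(\boldsymbol\sigma),\qquad H_N^\delta(\boldsymbol\sigma)=\delta_N\sum_{p\ge1}\beta_{N,p}H'_{N,p}(\boldsymbol\sigma),$$ where $\delta_N\to0$ and $|\beta_{N,p}|\le2^{-p}$. Let $\langle\cdot\rangle$ be the Gibbs average (over replicas $\boldsymbol\sigma^1,\boldsymbol\sigma^2,\dots$) for $H_N'$, i.e. with weights proportional to $\exp(-H_N'(\boldsymbol\sigma))$;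 and for $p\ge1,t>0$ let $\langle\cdot\rangle_t$ be the Gibbs average for $-H_N'(\boldsymbol\sigma)-tG_p(\boldsymbol\sigma)$, where $G_p(\boldsymbol\sigma)$ is an independent centered Gaussian process on $\Sigma_N$ with covariance $R_{1,2}^p$, $R_{1,2}=N^{-1}\sum_{i\le N}\sigma_i^1\sigma_i^2$. Standing assumption. The sequences $\delta_N$ (e.g. $\delta_N=N^{-1/16}$) and $(\beta_{N,p})$ are chosen (this is possible by a known theorem of Talagrand) so that for every continuous function $F$ of finitely many multi-overlaps $R^N_{l_1,\dots,l_k}=N^{-1}\sum_{i\le N}\sigma_i^{l_1}\cdots\sigma_i^{l_k}$ on replicas $\boldsymbol\sigma^1,\dots,\boldsymbol\sigma^n$, the following hold: (i) Ghirlanda–Guerra identities: for all $p\ge1$, $\lim_{N\to\infty}\big|\mathbb E\langle FR_{1,n+1}^p\rangle-\frac1n\mathbb E\langle F\rangle\mathbb E\langle R_{1,2}^p\rangle-\frac1n\sum_{l=2}^n\mathbb E\langle FR_{1,l}^p\rangle\big|=0$; (ii) stochastic stability: for all $p\ge1$, $t>0$, $\lim_{N\to\infty}|\mathbb E\langle F\rangle_t-\mathbb E\langle F\rangle|=0$. Limiting distributions. Let $\mu_N$ be the joint distribution of the spins $(\sigma_i^l)_{1\le i\le N,\,l\ge1}$ of i.i.d. replicas under the annealed product Gibbs measure $\mathbb E\langle\cdot\rangle$ for $H_N'$ (set $\sigma_i^l=0$ for $i>N$), and $\mathcal M$ the set of all limits (of finite-dimensional distributions) of $(\mu_N)$ over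 subsequences. Every $\mu\in\mathcal M$ is invariant under permutations of rows and of columns, so by Aldous–Hoover it is the law of $s_i^l=\sigma_\mu(w,u_l,v_i,x_{i,l})$ for a measurable $\sigma_\mu:[0,1]^4\to\{-1,+1\}$, with $w,(u_l),(v_i),(x_{i,l})$ i.i.d. uniform on $[0,1]$. Put $\bar\sigma_\mu(w,u,v)=\int_0^1\sigma_\mu(w,u,v,x)\,dx$. Gaussian process. For $w\in[0,1]$ let $g_p(\bar\sigma(w,u,\cdot))$ be a centered Gaussian process indexed by $u\in[0,1]$ with covariance $(\mathbb E_v\bar\sigma(w,u,v)\bar\sigma(w,u',v))^p$, where $\mathbb E_v$ is expectation in $v$ uniform on $[0,1]$, and $G_p(\bar\sigma(w,u,\cdot))=g_p(\bar\sigma(w,u,\cdot))+z\big(1-(\mathbb E_v\bar\sigma(w,u,v)^2)^p\big)^{1/2}$ with $z$ an independent standard Gaussian. Let $w,u,(v_i)$ be independent uniform on $[0,1]$, independent of these, and $\bar\sigma_i=\bar\sigma(w,u,v_i)$. $\mathbb E'$ is the expectation in $u$ and $z$ only; $\mathbb E$ is expectation over all randomness. *)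

theory Defs
  imports "HOL-Probability.Probability"
begin

text \<open>
  Joint Gaussianity is expressed by all finite linear combinations; their variance may vanish, so
  the centred normal law of variance \<open>v\<close> is written as the law of \<open>sqrt v * Z\<close>, \<open>Z\<close> standard normal.
\<close>

definition centered_gaussian_process ::
  "'a measure \<Rightarrow> 'i set \<Rightarrow> ('i \<Rightarrow> 'a \<Rightarrow> real) \<Rightarrow> ('i \<Rightarrow> 'i \<Rightarrow> real) \<Rightarrow> bool" where
  "centered_gaussian_process M T X K \<longleftrightarrow>
     (\<forall>s\<in>T. X s \<in> borel_measurable M) \<and>
     (\<forall>S c. finite S \<longrightarrow> S \<subseteq> T \<longrightarrow>
        (let v = (\<Sum>s\<in>S. \<Sum>s'\<in>S. c s * c s' * K s s') in
           0 \<le> v \<and>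
           distr M borel (\<lambda>\<omega>. \<Sum>s\<in>S. c s * X s \<omega>) =
           distr std_normal_distribution borel (\<lambda>x. sqrt v * x)))"

type_synonym config = "nat \<Rightarrow> real"

definition configs :: "nat \<Rightarrow> config set" where
  "configs N = ({1..N} \<rightarrow>\<^sub>E {-1, 1})"

definition overlap :: "nat \<Rightarrow> config \<Rightarrow> config \<Rightarrow> real" where
  "overlap N \<sigma> \<tau> = (\<Sum>i=1..N. \<sigma> i * \<tau> i) / real N"

text \<open>A family of replicas is a function \<open>s\<close> with \<open>s l\<close> the \<open>l\<close>-th replica, \<open>l \<ge> 1\<close>.\<close>

definition multi_overlap :: "nat \<Rightarrow> nat list \<Rightarrow> (nat \<Rightarrow> config) \<Rightarrow> real" where
  "multi_overlap N L s = (\<Sum>i=1..N. \<Prod>l\<leftarrow>L. s l i) / real N"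

definition gibbs_measure :: "nat \<Rightarrow> (config \<Rightarrow> real) \<Rightarrow> config measure" where
  "gibbs_measure N H =
     point_measure (configs N)
       (\<lambda>\<sigma>. ennreal (exp (- H \<sigma>) / (\<Sum>\<tau>\<in>configs N. exp (- H \<tau>))))"

definition replica_measure :: "nat \<Rightarrow> (config \<Rightarrow> real) \<Rightarrow> (nat \<Rightarrow> config) measure" where
  "replica_measure N H = (\<Pi>\<^sub>M l\<in>{1..}. gibbs_measure N H)"

definition gibbs_average ::
  "nat \<Rightarrow> (config \<Rightarrow> real) \<Rightarrow> ((nat \<Rightarrow> config) \<Rightarrow> real) \<Rightarrow> real" where
  "gibbs_average N H f = (\<integral>s. f s \<partial>replica_measure N H)"

definition annealed_average ::
  "'a measure \<Rightarrow> nat \<Rightarrow> ('a \<Rightarrow> config \<Rightarrow> real) \<Rightarrow> ((nat \<Rightarrow> config) \<Rightarrow> real) \<Rightarrow> real" where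
  "annealed_average M N H f = (\<integral>\<omega>. gibbs_average N (H \<omega>) f \<partial>M)"

text \<open>The coefficient with indices \<open>i\<^sub>1, \<dots>, i\<^sub>p\<close> is indexed by the list of length \<open>p\<close>.\<close>

definition coeff_indices :: "nat list set" where
  "coeff_indices = {L. L \<noteq> [] \<and> set L \<subseteq> {1..}}"

definition pspin_hamiltonian ::
  "(nat list \<Rightarrow> 'a \<Rightarrow> real) \<Rightarrow> nat \<Rightarrow> nat \<Rightarrow> 'a \<Rightarrow> config \<Rightarrow> real" where
  "pspin_hamiltonian g N p \<omega> \<sigma> =
     - (real N powr (- (real p - 1) / 2) *
        (\<Sum>L | length L = p \<and> set L \<subseteq> {1..N}. g L \<omega> * (\<Prod>i\<leftarrow>L. \<sigma> i)))"

definition mixed_hamiltonian ::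
  "nat set \<Rightarrow> (nat \<Rightarrow> real) \<Rightarrow> (nat list \<Rightarrow> 'a \<Rightarrow> real) \<Rightarrow> nat \<Rightarrow> 'a \<Rightarrow> config \<Rightarrow> real" where
  "mixed_hamiltonian P b g N \<omega> \<sigma> =
     (\<Sum>p. if p \<in> P then b p * pspin_hamiltonian g N p \<omega> \<sigma> else 0)"

definition model_degrees :: "nat set" where
  "model_degrees = {p. p = 1 \<or> (even p \<and> 2 \<le> p)}"

definition perturbed_hamiltonian ::
  "(nat \<Rightarrow> real) \<Rightarrow> (nat \<Rightarrow> real) \<Rightarrow> (nat \<Rightarrow> nat \<Rightarrow> real) \<Rightarrow>
   (nat list \<Rightarrow> 'a \<Rightarrow> real) \<Rightarrow> (nat list \<Rightarrow> 'a \<Rightarrow> real) \<Rightarrow> nat \<Rightarrow> 'a \<Rightarrow> config \<Rightarrow> real" where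
  "perturbed_hamiltonian \<beta> \<delta> \<beta>' g g' N \<omega> \<sigma> =
     mixed_hamiltonian model_degrees \<beta> g N \<omega> \<sigma> +
     \<delta> N * mixed_hamiltonian {1..} (\<beta>' N) g' N \<omega> \<sigma>"

text \<open>
  \<open>g\<close> and \<open>g'\<close> are the coefficients of \<open>H\<^sub>N\<close> and of the perturbation; \<open>G N p\<close> is the process on
  \<open>configs N\<close> defining the Gibbs average with parameter \<open>t\<close>. The joint law of the \<open>G N p\<close> for
  different \<open>(N, p)\<close> never matters and is left free.
\<close>

locale perturbed_spin_glass = prob_space M for M :: "'a measure" +
  fixes \<beta> :: "nat \<Rightarrow> real"
    and \<delta> :: "nat \<Rightarrow> real"
    and \<beta>' :: "nat \<Rightarrow> nat \<Rightarrow> real"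
    and g g' :: "nat list \<Rightarrow> 'a \<Rightarrow> real"
    and G :: "nat \<Rightarrow> nat \<Rightarrow> config \<Rightarrow> 'a \<Rightarrow> real"
  assumes beta_summable: "(\<lambda>p. 2 ^ p * (\<beta> p)\<^sup>2) summable_on model_degrees"
    and delta_tendsto: "\<delta> \<longlonglongrightarrow> 0"
    and beta'_bound: "\<And>N p. 1 \<le> p \<Longrightarrow> \<bar>\<beta>' N p\<bar> \<le> 1 / 2 ^ p"
    and coeffs_gaussian: "\<And>L. L \<in> coeff_indices \<Longrightarrow> distributed M lborel (g L) std_normal_density"
      "\<And>L. L \<in> coeff_indices \<Longrightarrow> distributed M lborel (g' L) std_normal_density"
    and coeffs_indep: "indep_vars (\<lambda>_. borel) (case_sum g g') (coeff_indices <+> coeff_indices)"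
    and G_gaussian: "\<And>N p. 1 \<le> N \<Longrightarrow> 1 \<le> p \<Longrightarrow>
      centered_gaussian_process M (configs N) (G N p) (\<lambda>\<sigma> \<tau>. overlap N \<sigma> \<tau> ^ p)"
    and G_indep: "\<And>N p. 1 \<le> N \<Longrightarrow> 1 \<le> p \<Longrightarrow>
      indep_set
        (sets (vimage_algebra (space M) (\<lambda>\<omega>. \<lambda>\<sigma>\<in>configs N. G N p \<sigma> \<omega>) (\<Pi>\<^sub>M \<sigma>\<in>configs N. borel)))
        (sets (vimage_algebra (space M) (\<lambda>\<omega>. \<lambda>j\<in>coeff_indices <+> coeff_indices. case_sum g g' j \<omega>)
          (\<Pi>\<^sub>M j\<in>coeff_indices <+> coeff_indices. borel)))"

text \<open>
  A continuous function of the finitely many multi-overlaps \<open>R\<^sub>L\<close>, \<open>L \<in> LL\<close>, is a continuous \<open>\<phi>\<close> on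
  the product space of all functions \<open>nat list \<Rightarrow> real\<close>, evaluated with the other coordinates set
  to \<open>0\<close>.
\<close>

definition overlap_function ::
  "((nat list \<Rightarrow> real) \<Rightarrow> real) \<Rightarrow> nat list set \<Rightarrow> nat \<Rightarrow> (nat \<Rightarrow> config) \<Rightarrow> real" where
  "overlap_function \<phi> LL N s = \<phi> (\<lambda>L. if L \<in> LL then multi_overlap N L s else 0)"

definition ghirlanda_guerra :: "'a measure \<Rightarrow> (nat \<Rightarrow> 'a \<Rightarrow> config \<Rightarrow> real) \<Rightarrow> bool" where
  "ghirlanda_guerra M H \<longleftrightarrow>
     (\<forall>n\<ge>1. \<forall>LL \<phi>. finite LL \<longrightarrow> LL \<subseteq> lists {1..n} \<longrightarrow> continuous_on UNIV \<phi> \<longrightarrow>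
       (\<forall>p\<ge>1.
         (\<lambda>N. \<bar>annealed_average M N (H N)
                 (\<lambda>s. overlap_function \<phi> LL N s * multi_overlap N [1, n + 1] s ^ p)
               - 1 / real n * annealed_average M N (H N) (overlap_function \<phi> LL N)
                   * annealed_average M N (H N) (\<lambda>s. multi_overlap N [1, 2] s ^ p)
               - 1 / real n * (\<Sum>l=2..n. annealed_average M N (H N)
                   (\<lambda>s. overlap_function \<phi> LL N s * multi_overlap N [1, l] s ^ p))\<bar>)
         \<longlonglongrightarrow> 0))"

definition stochastically_stable ::
  "'a measure \<Rightarrow> (nat \<Rightarrow> 'a \<Rightarrow> config \<Rightarrow> real) \<Rightarrow> (nat \<Rightarrow> nat \<Rightarrow> config \<Rightarrow> 'a \<Rightarrow> real) \<Rightarrow> bool" where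
  "stochastically_stable M H G \<longleftrightarrow>
     (\<forall>n\<ge>1. \<forall>LL \<phi>. finite LL \<longrightarrow> LL \<subseteq> lists {1..n} \<longrightarrow> continuous_on UNIV \<phi> \<longrightarrow>
       (\<forall>p\<ge>1. \<forall>t>0.
         (\<lambda>N. \<bar>annealed_average M N (\<lambda>\<omega> \<sigma>. H N \<omega> \<sigma> + t * G N p \<sigma> \<omega>) (overlap_function \<phi> LL N)
               - annealed_average M N (H N) (overlap_function \<phi> LL N)\<bar>)
         \<longlonglongrightarrow> 0))"

text \<open>The entry at \<open>(i, l)\<close> of an array is the spin at site \<open>i\<close> of replica \<open>l\<close>.\<close>

abbreviation array_indices :: "(nat \<times> nat) set" where
  "array_indices \<equiv> {1..} \<times> {1..}"

definition array_space :: "(nat \<times> nat \<Rightarrow> real) measure" where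
  "array_space = (\<Pi>\<^sub>M j\<in>array_indices. count_space {-1, 0, 1})"

definition spin_array :: "nat \<Rightarrow> (nat \<Rightarrow> config) \<Rightarrow> nat \<times> nat \<Rightarrow> real" where
  "spin_array N s = (\<lambda>(i, l)\<in>array_indices. if i \<le> N then s l i else 0)"

definition spin_law ::
  "'a measure \<Rightarrow> (nat \<Rightarrow> 'a \<Rightarrow> config \<Rightarrow> real) \<Rightarrow> nat \<Rightarrow> (nat \<times> nat \<Rightarrow> real) measure" where
  "spin_law M H N =
     M \<bind> (\<lambda>\<omega>. distr (replica_measure N (H N \<omega>)) array_space (spin_array N))"

text \<open>
  The entries take finitely many values, so convergence of the finite-dimensional distributions is
  convergence of the probabilities of all finite cylinders.
\<close>

definition limit_laws ::
  "'a measure \<Rightarrow> (nat \<Rightarrow> 'a \<Rightarrow> config \<Rightarrow> real) \<Rightarrow> (nat \<times> nat \<Rightarrow> real) measure set" where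
  "limit_laws M H =
     {\<mu>. prob_space \<mu> \<and> sets \<mu> = sets array_space \<and>
        (\<exists>r. strict_mono (r :: nat \<Rightarrow> nat) \<and>
          (\<forall>J a. finite J \<longrightarrow> J \<subseteq> array_indices \<longrightarrow>
            (\<lambda>k. measure (spin_law M H (r k)) {x \<in> space array_space. \<forall>j\<in>J. x j = a j})
            \<longlonglongrightarrow> measure \<mu> {x \<in> space array_space. \<forall>j\<in>J. x j = a j}))}"

definition unit_uniform :: "real measure" where
  "unit_uniform = restrict_space lborel {0..1}"

definition aldous_hoover_representation ::
  "(nat \<times> nat \<Rightarrow> real) measure \<Rightarrow> (real \<Rightarrow> real \<Rightarrow> real \<Rightarrow> real \<Rightarrow> real) \<Rightarrow> bool" where
  "aldous_hoover_representation \<mu> \<sigma> \<longleftrightarrow>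
     (\<lambda>(w, u, v, x). \<sigma> w u v x)
       \<in> unit_uniform \<Otimes>\<^sub>M unit_uniform \<Otimes>\<^sub>M unit_uniform \<Otimes>\<^sub>M unit_uniform \<rightarrow>\<^sub>M count_space {-1, 1} \<and>
     \<mu> = distr
       (unit_uniform \<Otimes>\<^sub>M (\<Pi>\<^sub>M l\<in>{1::nat..}. unit_uniform) \<Otimes>\<^sub>M (\<Pi>\<^sub>M i\<in>{1::nat..}. unit_uniform)
         \<Otimes>\<^sub>M (\<Pi>\<^sub>M j\<in>array_indices. unit_uniform))
       array_space
       (\<lambda>(w, u, v, x). \<lambda>(i, l)\<in>array_indices. \<sigma> w (u l) (v i) (x (i, l)))"

definition spin_mean :: "(real \<Rightarrow> real \<Rightarrow> real \<Rightarrow> real \<Rightarrow> real) \<Rightarrow> real \<Rightarrow> real \<Rightarrow> real \<Rightarrow> real" where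
  "spin_mean \<sigma> w u v = (\<integral>x. \<sigma> w u v x \<partial>unit_uniform)"

definition mean_overlap :: "(real \<Rightarrow> real \<Rightarrow> real \<Rightarrow> real) \<Rightarrow> real \<Rightarrow> real \<Rightarrow> real \<Rightarrow> real" where
  "mean_overlap sb w u u' = (\<integral>v. sb w u v * sb w u' v \<partial>unit_uniform)"

text \<open>
  The joint measurability in \<open>(w, u, \<omega>)\<close> is what makes the expectations in \<open>u\<close> and \<open>w\<close> of functions
  of the process meaningful. The joint law for different \<open>w\<close> is left free.
\<close>

definition limit_gaussian_process ::
  "'b measure \<Rightarrow> nat \<Rightarrow> (real \<Rightarrow> real \<Rightarrow> real \<Rightarrow> real) \<Rightarrow> (real \<Rightarrow> real \<Rightarrow> 'b \<Rightarrow> real) \<Rightarrow> bool" where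
  "limit_gaussian_process M p sb \<gamma> \<longleftrightarrow>
     (\<lambda>(w, u, \<omega>). \<gamma> w u \<omega>) \<in> borel_measurable (unit_uniform \<Otimes>\<^sub>M unit_uniform \<Otimes>\<^sub>M M) \<and>
     (\<forall>w\<in>{0..1}. centered_gaussian_process M {0..1} (\<gamma> w) (\<lambda>u u'. mean_overlap sb w u u' ^ p))"

definition augmented_process ::
  "nat \<Rightarrow> (real \<Rightarrow> real \<Rightarrow> real \<Rightarrow> real) \<Rightarrow> (real \<Rightarrow> real \<Rightarrow> 'b \<Rightarrow> real) \<Rightarrow>
   real \<Rightarrow> real \<Rightarrow> 'b \<Rightarrow> real \<Rightarrow> real" where
  "augmented_process p sb \<gamma> w u \<omega> z = \<gamma> w u \<omega> + z * sqrt (1 - mean_overlap sb w u u ^ p)"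

definition expectation_uz :: "(real \<Rightarrow> real \<Rightarrow> real) \<Rightarrow> real" where
  "expectation_uz f = (\<integral>(u, z). f u z \<partial>(unit_uniform \<Otimes>\<^sub>M std_normal_distribution))"

text \<open>Expectation over the remaining randomness: \<open>w\<close>, the sequence \<open>(v\<^sub>i)\<close> and the process.\<close>

definition expectation_wv ::
  "'b measure \<Rightarrow> (real \<Rightarrow> (nat \<Rightarrow> real) \<Rightarrow> 'b \<Rightarrow> real) \<Rightarrow> real" where
  "expectation_wv M f =
     (\<integral>(w, v, \<omega>). f w v \<omega> \<partial>(unit_uniform \<Otimes>\<^sub>M (\<Pi>\<^sub>M i\<in>{1::nat..}. unit_uniform) \<Otimes>\<^sub>M M))"

end

theory Submission
  imports Defs "HOL-Combinatorics.Permutations"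
begin

text \<open>
  Write \<open>I\<close> for the union of the \<open>C\<^sub>l\<close>, \<open>L\<^sub>i = {l. i \<in> C\<^sub>l}\<close> and \<open>F = \<Prod>\<^sub>i R\<^bsub>L\<^sub>i\<^esub>\<close>. Stochastic
  stability gives \<open>E\<langle>F\<rangle>\<^sub>t - E\<langle>F\<rangle> \<rightarrow> 0\<close>, so it suffices to identify the limits of both terms.
  The Hamiltonian is exchangeable in the sites, so
  the joint moments of the multi-overlaps converge to those of the limiting model.
  This settles \<open>E\<langle>F\<rangle>\<close>. For \<open>E\<langle>F\<rangle>\<^sub>t\<close>, write \<open>F\<close> as the average over uniform sites
  \<open>\<kappa>\<^sub>i\<close> of \<open>\<Prod>\<^sub>l \<Prod>\<^bsub>i\<in>C\<^sub>l\<^esub> \<sigma>\<^sup>l\<^bsub>\<kappa>\<^sub>i\<^esub>\<close>; then both \<open>E\<langle>F\<rangle>\<^sub>t\<close> and the right-hand side have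
  the form \<open>E \<Prod>\<^sub>l \<langle>a\<^sub>l e\<^bsup>tX\<^esup>\<rangle> / \<langle>e\<^bsup>tX\<^esup>\<rangle>\<^sup>q\<close> with a field \<open>X\<close> of standard Gaussian marginals. The
  moments of \<open>\<langle>e\<^bsup>tX\<^esup>\<rangle>\<close> do not determine its law, so \<open>e\<^bsup>tx\<^esup>\<close> is first replaced by a trigonometric
  polynomial \<open>h > 0\<close> close to it in \<open>L\<^sup>2\<close> of the Gaussian law, with an error controlled uniformly in
  \<open>N\<close>. As \<open>\<langle>h(X)\<rangle>\<close> lies in a compact subset of \<open>(0, \<infinity>)\<close>, \<open>z\<^bsup>-q\<^esup>\<close> may be replaced by a polynomial, and what
  remains are the quantities \<open>E \<Prod>\<^sub>l \<langle>a\<^sub>l e\<^bsup>i\<theta>\<^sub>lX\<^esup>\<rangle>\<close>. Integrating the Gaussian field out turns them into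
  expectations of continuous functions of the overlaps, which converge.
\<close>

section \<open>Approximation\<close>

text \<open>The finite systems and the limit disagree on the diagonal: a configuration has
  self-overlap \<open>1\<close>, whereas \<open>mean_overlap sb w u u\<close> may be smaller. The
  variable \<open>z\<close> repairs this. It is averaged inside each expectation over
  \<open>(u, z)\<close>, so distinct replicas carry independent copies of it; it leaves the
  covariance of distinct replicas alone and raises the variance to \<open>1\<close>. Hence both
  fields have standard Gaussian marginals. The error of replacing \<open>exp (t * x)\<close> by
  \<open>h\<close> must not involve a lower bound of \<open>h\<close>, which may degrade as the
  approximation improves. The comparison is therefore arranged so that only the mass of the
  exponential stands in a denominator. Its inverse is controlled by negative exponential moments of
  the Gaussian marginal, which are the same for all sizes and all choices of sites. Only when
  \<open>h\<close> and its bounds are fixed is the inverse power of the mass replaced by a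
  polynomial.\<close>

lemma continuous_poly_approx:
  fixes f :: "real \<Rightarrow> real"
  assumes "continuous_on {a..b} f" "0 < e"
  obtains c :: "nat \<Rightarrow> real" and m where
    "\<And>x. x \<in> {a..b} \<Longrightarrow> \<bar>(\<Sum>i\<le>m. c i * x ^ i) - f x\<bar> < e"
proof -
  obtain g where g: "real_polynomial_function g" "\<And>x. x \<in> {a..b} \<Longrightarrow> \<bar>f x - g x\<bar> < e"
    using Stone_Weierstrass_real_polynomial_function[OF compact_Icc assms] by blast
  obtain c m where "g = (\<lambda>x. \<Sum>i\<le>m. c i * x ^ i)"
    using g(1) real_polynomial_function_iff_sum by blast
  then show thesis
    using g(2) that[of c m] by (metis abs_minus_commute)
qed

text \<open>Split the difference as \<open>(A - B) / G + A / F * ((G - F) / G)\<close> and use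
  \<open>\<bar>A / F\<bar> \<le> 1\<close>, so that the mass of \<open>f\<close> leaves the
  denominators. Below, \<open>f\<close> is the approximation, whose lower bound may be tiny, and
  \<open>g\<close> is the exponential.\<close>

lemma (in prob_space) ratio_diff_bound:
  fixes a f g :: "'a \<Rightarrow> real"
  assumes a[measurable]: "a \<in> borel_measurable M" and a1: "\<And>x. x \<in> space M \<Longrightarrow> \<bar>a x\<bar> \<le> 1"
    and f: "\<And>x. 0 < f x" "integrable M f" and g: "\<And>x. 0 < g x" "integrable M g"
  shows "\<bar>(\<integral>x. a x * f x \<partial>M) / (\<integral>x. f x \<partial>M) - (\<integral>x. a x * g x \<partial>M) / (\<integral>x. g x \<partial>M)\<bar>
    \<le> 2 * (\<integral>x. \<bar>f x - g x\<bar> \<partial>M) / (\<integral>x. g x \<partial>M)"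
proof -
  have pos: "0 < (\<integral>x. h x \<partial>M)" if "\<And>x. 0 < h x" "integrable M h" for h :: "'a \<Rightarrow> real"
    using integral_less_AE_space[of "\<lambda>_. 0" h] that by (simp add: emeasure_space_1)
  have af: "integrable M (\<lambda>x. a x * h x)" if "integrable M h" for h :: "'a \<Rightarrow> real"
    by (rule Bochner_Integration.integrable_bound[OF that])
       (use a1 that in \<open>auto simp: abs_mult intro!: AE_I2 mult_left_le_one_le\<close>)
  let ?F = "\<integral>x. f x \<partial>M" and ?G = "\<integral>x. g x \<partial>M"
  let ?A = "\<integral>x. a x * f x \<partial>M" and ?B = "\<integral>x. a x * g x \<partial>M" and ?D = "\<integral>x. \<bar>f x - g x\<bar> \<partial>M"
  have F: "0 < ?F" and G: "0 < ?G" using pos f g by auto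
  have d: "integrable M (\<lambda>x. f x - g x)" using f g by simp
  have 1: "\<bar>?F - ?G\<bar> \<le> ?D"
    using f g integral_abs_bound[of M "\<lambda>x. f x - g x"] by simp
  have "?A - ?B = (\<integral>x. a x * (f x - g x) \<partial>M)"
    using af f g by (simp add: right_diff_distrib)
  also have "\<bar>\<dots>\<bar> \<le> (\<integral>x. \<bar>a x * (f x - g x)\<bar> \<partial>M)" by (rule integral_abs_bound)
  also have "\<dots> \<le> ?D"
    by (intro integral_mono integrable_abs af d) (use a1 in \<open>auto simp: abs_mult intro!: mult_left_le_one_le\<close>)
  finally have 2: "\<bar>?A - ?B\<bar> \<le> ?D" .
  have "\<bar>?A\<bar> \<le> (\<integral>x. \<bar>a x * f x\<bar> \<partial>M)" by (rule integral_abs_bound)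
  also have "\<dots> \<le> ?F"
    by (intro integral_mono integrable_abs af f) (use a1 f(1) in \<open>auto simp: abs_mult less_imp_le intro!: mult_left_le_one_le\<close>)
  finally have 3: "\<bar>?A / ?F\<bar> \<le> 1" using F by simp
  have alg: "A / F - B / G = (A - B) / G + A / F * ((G - F) / G)" if "0 < F" "0 < G" for A B F G :: real
    using that by (simp add: field_simps)
  have "\<bar>?A / ?F - ?B / ?G\<bar> = \<bar>(?A - ?B) / ?G + ?A / ?F * ((?G - ?F) / ?G)\<bar>"
    using F G by (subst alg) auto
  also have "\<dots> \<le> \<bar>(?A - ?B) / ?G\<bar> + \<bar>?A / ?F\<bar> * \<bar>(?G - ?F) / ?G\<bar>"
    unfolding abs_mult[symmetric] by (rule abs_triangle_ineq)
  also have "\<dots> \<le> \<bar>(?A - ?B) / ?G\<bar> + \<bar>(?G - ?F) / ?G\<bar>"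
    using mult_right_mono[OF 3 abs_ge_zero[of "(?G - ?F) / ?G"]] by linarith
  also have "\<dots> \<le> ?D / ?G + ?D / ?G"
    unfolding abs_divide abs_of_pos[OF G]
    by (intro add_mono divide_right_mono 2 less_imp_le[OF G]) (subst abs_minus_commute, rule 1)
  finally show ?thesis by simp
qed

lemma (in prob_space) square_expectation_le:
  fixes f :: "'a \<Rightarrow> real"
  assumes "integrable M f" "integrable M (\<lambda>x. (f x)\<^sup>2)"
  shows "(\<integral>x. f x \<partial>M)\<^sup>2 \<le> (\<integral>x. (f x)\<^sup>2 \<partial>M)"
  using variance_positive[of f] variance_eq[OF assms] by simp

text \<open>Jensen's inequality for \<open>1 / y\<close>: the tangent
  \<open>2 / m - y / m\<^sup>2\<close> at the mean \<open>m\<close> lies below the graph.\<close>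

lemma (in prob_space) inverse_expectation_le:
  fixes f :: "'a \<Rightarrow> real"
  assumes "\<And>x. 0 < f x" "integrable M f" "integrable M (\<lambda>x. 1 / f x)"
  shows "1 / (\<integral>x. f x \<partial>M) \<le> (\<integral>x. 1 / f x \<partial>M)"
proof -
  define m where "m = (\<integral>x. f x \<partial>M)"
  have m: "0 < m"
    using integral_less_AE_space[of "\<lambda>_. 0" f] assms by (simp add: emeasure_space_1 m_def)
  have "2 / m - f x / m\<^sup>2 \<le> 1 / f x" for x
  proof -
    have "0 \<le> (1 - f x / m)\<^sup>2 / f x" using assms(1)[of x] by simp
    also have "\<dots> = 1 / f x - 2 / m + f x / m\<^sup>2"
      using assms(1)[of x] m by (simp add: field_simps power2_eq_square)
    finally show ?thesis by simp
  qed
  then have "(\<integral>x. 2 / m - f x / m\<^sup>2 \<partial>M) \<le> (\<integral>x. 1 / f x \<partial>M)"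
    by (intro integral_mono) (use assms in auto)
  also have "(\<integral>x. 2 / m - f x / m\<^sup>2 \<partial>M) = 2 / m - m / m\<^sup>2"
    using assms(2) by (simp add: prob_space m_def)
  finally show ?thesis using m by (simp add: power2_eq_square m_def)
qed

text \<open>The quotients are bounded by \<open>1\<close>, so the difference of products is at most
  the sum of the differences of factors. The product of the means of
  \<open>\<bar>f - g\<bar>\<close> and \<open>1 / g\<close> is split by a weighted mean inequality
  because the bound is later integrated over the disorder: being linear in the two second moments,
  it then needs only the averaged law of the field.\<close>

lemma (in prob_space) tilted_product_diff_bound:
  fixes a :: "'i \<Rightarrow> 'a \<Rightarrow> real" and f g :: "'a \<Rightarrow> real"
  assumes a: "\<And>l. l \<in> I \<Longrightarrow> a l \<in> borel_measurable M" "\<And>l x. l \<in> I \<Longrightarrow> x \<in> space M \<Longrightarrow> \<bar>a l x\<bar> \<le> 1"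
    and f: "\<And>x. 0 < f x" "integrable M f" and g: "\<And>x. 0 < g x" "g \<in> borel_measurable M"
    and sq: "integrable M (\<lambda>x. (f x - g x)\<^sup>2)" "integrable M (\<lambda>x. (1 / g x)\<^sup>2)"
    and \<eta>: "0 < \<eta>"
  shows "\<bar>(\<Prod>l\<in>I. (\<integral>x. a l x * f x \<partial>M) / (\<integral>x. f x \<partial>M)) - (\<Prod>l\<in>I. (\<integral>x. a l x * g x \<partial>M) / (\<integral>x. g x \<partial>M))\<bar>
    \<le> real (card I) * ((\<integral>x. (f x - g x)\<^sup>2 \<partial>M) / \<eta> + \<eta> * (\<integral>x. (1 / g x)\<^sup>2 \<partial>M))"
proof -
  note [measurable] = g(2) borel_measurable_integrable[OF f(2)]
  have int1: "integrable M h" if "h \<in> borel_measurable M" "integrable M (\<lambda>x. (h x)\<^sup>2)" for h :: "'a \<Rightarrow> real"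
    using square_integrable_imp_integrable[OF that] .
  have d: "integrable M (\<lambda>x. f x - g x)" by (rule int1) (use sq in auto)
  have g1: "integrable M g" using Bochner_Integration.integrable_diff[OF f(2) d] by simp
  have i1: "integrable M (\<lambda>x. 1 / g x)" by (rule int1) (use sq in auto)
  have pos: "0 < (\<integral>x. h x \<partial>M)" if "\<And>x. 0 < h x" "integrable M h" for h :: "'a \<Rightarrow> real"
    using integral_less_AE_space[of "\<lambda>_. 0" h] that by (simp add: emeasure_space_1)
  let ?r = "\<lambda>l h. (\<integral>x. a l x * h x \<partial>M) / (\<integral>x. h x \<partial>M)"
  have le1: "norm (?r l h) \<le> 1" if "l \<in> I" "\<And>x. 0 < h x" "integrable M h" for h l
  proof -
    have "\<bar>\<integral>x. a l x * h x \<partial>M\<bar> \<le> (\<integral>x. \<bar>a l x * h x\<bar> \<partial>M)" by (rule integral_abs_bound)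
    also have "\<dots> \<le> (\<integral>x. h x \<partial>M)"
    proof (rule integral_mono)
      show "integrable M (\<lambda>x. \<bar>a l x * h x\<bar>)"
        by (rule Bochner_Integration.integrable_bound[OF that(3)])
          (use a that in \<open>auto simp: abs_mult intro!: AE_I2 mult_left_le_one_le\<close>)
    qed (use a that in \<open>auto simp: abs_mult less_imp_le intro!: mult_left_le_one_le\<close>)
    finally show ?thesis using pos[OF that(2,3)] by simp
  qed
  let ?x = "\<integral>x. \<bar>f x - g x\<bar> \<partial>M" and ?y = "\<integral>x. 1 / g x \<partial>M"
  let ?X = "\<integral>x. (f x - g x)\<^sup>2 \<partial>M" and ?Y = "\<integral>x. (1 / g x)\<^sup>2 \<partial>M"
  have "?x\<^sup>2 \<le> ?X" using square_expectation_le[of "\<lambda>x. \<bar>f x - g x\<bar>"] d sq by simp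
  moreover have "?y\<^sup>2 \<le> ?Y" using square_expectation_le[OF i1 sq(2)] .
  ultimately have "?x\<^sup>2 / \<eta> + \<eta> * ?y\<^sup>2 \<le> ?X / \<eta> + \<eta> * ?Y"
    using \<eta> by (intro add_mono divide_right_mono mult_left_mono) auto
  moreover have "2 * x * y \<le> x\<^sup>2 / \<eta> + \<eta> * y\<^sup>2" for x y
  proof -
    have "0 \<le> (x - \<eta> * y)\<^sup>2 / \<eta>" using \<eta> by simp
    then show ?thesis using \<eta> by (simp add: field_simps power2_eq_square)
  qed
  from this[of ?x ?y] have "2 * ?x * ?y \<le> ?x\<^sup>2 / \<eta> + \<eta> * ?y\<^sup>2" .
  ultimately have xy: "2 * ?x * ?y \<le> ?X / \<eta> + \<eta> * ?Y" by simp
  have "\<bar>?r l f - ?r l g\<bar> \<le> ?X / \<eta> + \<eta> * ?Y" if "l \<in> I" for l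
  proof -
    have "\<bar>?r l f - ?r l g\<bar> \<le> 2 * ?x * (1 / (\<integral>x. g x \<partial>M))"
      using ratio_diff_bound[OF a(1)[OF that] a(2)[OF that] f g(1) g1] by simp
    also have "\<dots> \<le> 2 * ?x * ?y"
      by (intro mult_left_mono inverse_expectation_le g1 i1 g) simp
    finally show ?thesis using xy by simp
  qed
  then have "(\<Sum>l\<in>I. norm (?r l f - ?r l g)) \<le> real (card I) * (?X / \<eta> + \<eta> * ?Y)"
    using sum_bounded_above[of I "\<lambda>l. norm (?r l f - ?r l g)"] by simp
  moreover have "norm ((\<Prod>l\<in>I. ?r l f) - (\<Prod>l\<in>I. ?r l g)) \<le> (\<Sum>l\<in>I. norm (?r l f - ?r l g))"
    by (rule norm_prod_diff) (use le1 f g g1 in auto)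
  ultimately show ?thesis by simp
qed

section \<open>Approximating the inverse power and the exponential\<close>

lemma inverse_power_poly_approx:
  assumes "0 < c" "0 < e"
  obtains b :: "nat \<Rightarrow> real" and m where
    "\<And>z. z \<in> {c..C} \<Longrightarrow> \<bar>(\<Sum>i\<le>m. b i * z ^ i) - 1 / z ^ q\<bar> < e"
proof -
  have "continuous_on {c..C} (\<lambda>z. 1 / z ^ q)"
    using assms by (intro continuous_intros) auto
  from continuous_poly_approx[OF this assms(2)] that show thesis by blast
qed

text \<open>An existential cannot range over index types; pairs of naturals suit the double index
  \<open>(k, j)\<close> that arises when \<open>sin ^ k\<close> is expanded binomially.\<close>

definition trig_poly :: "(real \<Rightarrow> real) \<Rightarrow> bool" where
  "trig_poly h \<longleftrightarrow> (\<exists>(J :: (nat \<times> nat) set) c \<theta>. finite J \<and>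
     (\<forall>x. complex_of_real (h x) = (\<Sum>j\<in>J. c j * iexp (\<theta> j * x))))"

lemma iexp_power: "iexp x ^ n = iexp (real n * x)"
  by (simp add: exp_of_nat_mult[symmetric] mult_ac)

text \<open>Euler's formula makes \<open>sin y\<close> a combination of \<open>iexp y\<close> and
  \<open>iexp (- y)\<close>; in its \<open>k\<close>-th power the binomial term with
  \<open>j\<close> factors of the first kind has frequency \<open>j - (k - j)\<close>.\<close>

lemma trig_poly_sin_polynomial:
  "trig_poly (\<lambda>x. \<Sum>k\<le>m. b k * sin (x / s) ^ k)"
proof -
  let ?J = "Sigma {..m} (\<lambda>k. {..k})"
  let ?c = "\<lambda>(k, j). of_real (b k) * (of_nat (k choose j) * (1 / (2 * \<i>)) ^ j * (- 1 / (2 * \<i>)) ^ (k - j))"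
  let ?\<theta> = "\<lambda>(k, j). (real j - real (k - j)) / s"
  have "complex_of_real (sin y) ^ k = (\<Sum>j\<le>k. of_nat (k choose j) * (1 / (2 * \<i>)) ^ j *
      (- 1 / (2 * \<i>)) ^ (k - j) * iexp ((real j - real (k - j)) * y))" for k y
  proof -
    have "complex_of_real (sin y) = iexp y * (1 / (2 * \<i>)) + iexp (- y) * (- 1 / (2 * \<i>))"
      by (simp add: sin_of_real[symmetric] sin_exp_eq field_simps)
    then have "complex_of_real (sin y) ^ k =
      (\<Sum>j\<le>k. of_nat (k choose j) * (iexp y * (1 / (2 * \<i>))) ^ j * (iexp (- y) * (- 1 / (2 * \<i>))) ^ (k - j))"
      by (simp only: binomial_ring)
    also have "\<dots> = (\<Sum>j\<le>k. of_nat (k choose j) * (1 / (2 * \<i>)) ^ j *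
      (- 1 / (2 * \<i>)) ^ (k - j) * (iexp (real j * y) * iexp (real (k - j) * (- y))))"
      unfolding power_mult_distrib iexp_power by (intro sum.cong refl) (simp only: mult_ac)
    also have "\<dots> = (\<Sum>j\<le>k. of_nat (k choose j) * (1 / (2 * \<i>)) ^ j *
      (- 1 / (2 * \<i>)) ^ (k - j) * iexp ((real j - real (k - j)) * y))"
      unfolding exp_add[symmetric] by (intro sum.cong refl) (simp add: algebra_simps)
    finally show ?thesis .
  qed
  note sin_pow = this
  have "complex_of_real (\<Sum>k\<le>m. b k * sin (x / s) ^ k) = (\<Sum>j\<in>?J. ?c j * iexp (?\<theta> j * x))" for x
  proof -
    have "complex_of_real (\<Sum>k\<le>m. b k * sin (x / s) ^ k) =
      (\<Sum>k\<le>m. \<Sum>j\<le>k. ?c (k, j) * iexp (?\<theta> (k, j) * x))"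
      unfolding of_real_sum of_real_mult of_real_power sin_pow sum_distrib_left
      by (simp add: mult.assoc)
    also have "\<dots> = (\<Sum>j\<in>?J. ?c j * iexp (?\<theta> j * x))"
      by (subst sum.Sigma) (auto intro!: sum.cong)
    finally show ?thesis .
  qed
  moreover have "finite ?J" by simp
  ultimately show ?thesis unfolding trig_poly_def by blast
qed

text \<open>Completing the square turns \<open>exp (s * x)\<close> times the standard density into
  \<open>exp (s\<^sup>2 / 2)\<close> times the normal density of mean \<open>s\<close>.\<close>

lemma integrable_exp_std_normal: "integrable std_normal_distribution (\<lambda>x. exp (s * x))"
proof -
  have "std_normal_density x * exp (s * x) = exp (s\<^sup>2 / 2) * normal_density s 1 x" for x
    by (simp add: normal_density_def exp_add[symmetric] power2_eq_square field_simps)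
  moreover have "integrable lborel (\<lambda>x. exp (s\<^sup>2 / 2) * normal_density s 1 x)" by simp
  ultimately show ?thesis
    by (subst integrable_density) (auto simp: normal_density_nonneg)
qed

text \<open>
  The functions \<open>exp (t * n * sin (x / n))\<close> converge to \<open>exp (t * x)\<close>, are dominated by
  \<open>exp \<bar>t * x\<bar>\<close> and are bounded away from \<open>0\<close>.
\<close>

lemma trig_poly_approx_exp:
  fixes t \<epsilon> :: real
  assumes "0 < \<epsilon>"
  obtains h c C where "trig_poly h" "0 < c" "\<And>x. c \<le> h x" "\<And>x. h x \<le> C" "h \<in> borel_measurable borel"
    "integrable std_normal_distribution (\<lambda>x. (h x - exp (t * x))\<^sup>2)"
    "(\<integral>x. (h x - exp (t * x))\<^sup>2 \<partial>std_normal_distribution) < \<epsilon>"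
proof -
  interpret N: real_distribution std_normal_distribution by (rule real_dist_normal_dist)
  let ?N = std_normal_distribution
  define f where "f n x = exp (t * (real (Suc n) * sin (x / real (Suc n))))" for n x
  \<comment> \<open>A majorant of the squared error for every \<open>n\<close>: both terms of the
    difference lie between \<open>0\<close> and \<open>exp \<bar>t * x\<bar>\<close>, and
    \<open>exp (2 * \<bar>t * x\<bar>)\<close> is at most the sum of the two exponentials.\<close>
  define D where "D x = 4 * (exp (2 * t * x) + exp (- 2 * t * x))" for x
  have D: "integrable ?N D"
    unfolding D_def using integrable_exp_std_normal[of "2 * t"] integrable_exp_std_normal[of "- 2 * t"]
    by simp
  have fm[measurable]: "f n \<in> borel_measurable borel" for n
    unfolding f_def by measurable
  have bound: "(f n x - exp (t * x))\<^sup>2 \<le> D x" for n x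
  proof -
    have "\<bar>real (Suc n) * sin (x / real (Suc n))\<bar> \<le> real (Suc n) * \<bar>x / real (Suc n)\<bar>"
      unfolding abs_mult by (intro mult_mono abs_sin_x_le_abs_x) auto
    then have "\<bar>real (Suc n) * sin (x / real (Suc n))\<bar> \<le> \<bar>x\<bar>" by simp
    then have "\<bar>t * (real (Suc n) * sin (x / real (Suc n)))\<bar> \<le> \<bar>t * x\<bar>"
      unfolding abs_mult[of t] by (intro mult_left_mono) auto
    then have "f n x \<le> exp \<bar>t * x\<bar>" unfolding f_def by simp
    moreover have "exp (t * x) \<le> exp \<bar>t * x\<bar>" by simp
    moreover have "0 < f n x" "0 < exp (t * x)" unfolding f_def by simp_all
    ultimately have "\<bar>f n x - exp (t * x)\<bar> \<le> exp \<bar>t * x\<bar>" by linarith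
    then have "(f n x - exp (t * x))\<^sup>2 \<le> (exp \<bar>t * x\<bar>)\<^sup>2" using abs_le_square_iff by fastforce
    also have "\<dots> = exp (2 * \<bar>t * x\<bar>)" by (simp add: exp_double)
    also have "\<dots> \<le> exp (2 * t * x) + exp (- 2 * t * x)"
      by (cases "0 \<le> t * x") (simp_all add: mult_ac)
    also have "\<dots> \<le> D x" unfolding D_def by simp
    finally show ?thesis .
  qed
  have sq_int: "integrable ?N (\<lambda>x. (f n x - exp (t * x))\<^sup>2)" for n
    by (rule Bochner_Integration.integrable_bound[OF D]) (use bound in \<open>auto simp: D_def intro!: AE_I2\<close>)
  have lim: "(\<lambda>n. f n x) \<longlonglongrightarrow> exp (t * x)" for x
  proof -
    have "(\<lambda>n. real (Suc n) * sin (x / real (Suc n))) \<longlonglongrightarrow> x"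
    proof (cases "x = 0")
      case False
      \<comment> \<open>The derivative of \<open>sin\<close> at \<open>0\<close>. The point
        \<open>x = 0\<close> is set apart because \<open>x / Suc n\<close> has to avoid
        \<open>0\<close> here.\<close>
      have "((\<lambda>y. sin y / y) \<longlongrightarrow> 1) (at (0::real))"
        using DERIV_sin[of "0::real"] by (simp add: has_field_derivative_iff)
      moreover have "filterlim (\<lambda>n. x / real (Suc n)) (at 0) sequentially"
        using False LIMSEQ_Suc[OF tendsto_divide_0[OF tendsto_const filterlim_at_top_imp_at_infinity[OF filterlim_real_sequentially], of x]]
        by (auto simp: filterlim_at)
      ultimately have "(\<lambda>n. sin (x / real (Suc n)) / (x / real (Suc n))) \<longlonglongrightarrow> 1"
        by (rule filterlim_compose)
      from tendsto_mult[OF tendsto_const[of x] this] show ?thesis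
        using False by (auto elim!: Lim_transform_eventually simp del: of_nat_Suc)
    qed simp
    then show ?thesis unfolding f_def by (intro tendsto_intros)
  qed
  have "(\<lambda>n. \<integral>x. (f n x - exp (t * x))\<^sup>2 \<partial>?N) \<longlonglongrightarrow> (\<integral>x. 0 \<partial>?N)"
  proof (rule integral_dominated_convergence[OF _ _ D])
    show "AE x in ?N. (\<lambda>n. (f n x - exp (t * x))\<^sup>2) \<longlonglongrightarrow> 0"
    proof (rule AE_I2)
      fix x show "(\<lambda>n. (f n x - exp (t * x))\<^sup>2) \<longlonglongrightarrow> 0"
        using tendsto_power[OF tendsto_diff[OF lim[of x] tendsto_const[of "exp (t * x)"]], of 2] by simp
    qed
  qed (use bound in \<open>auto simp: D_def intro!: AE_I2\<close>)
  then have "eventually (\<lambda>n. (\<integral>x. (f n x - exp (t * x))\<^sup>2 \<partial>?N) < \<epsilon> / 4) sequentially"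
    using assms by (intro order_tendstoD(2)[where y=0]) auto
  then obtain n where n: "(\<integral>x. (f n x - exp (t * x))\<^sup>2 \<partial>?N) < \<epsilon> / 4"
    by (auto simp: eventually_sequentially)
  define B where "B = \<bar>t\<bar> * real (Suc n)"
  \<comment> \<open>\<open>exp (- B) / 2\<close> keeps \<open>h\<close> positive, \<open>1\<close>
    gives \<open>\<delta>\<^sup>2 \<le> \<delta>\<close> and an upper bound for \<open>h\<close>,
    and \<open>\<epsilon> / 8\<close> leaves
    \<open>2 * \<delta>\<^sup>2 \<le> \<epsilon> / 4\<close> beside the
    \<open>\<epsilon> / 2\<close> that comes from the choice of \<open>n\<close>.\<close>
  define \<delta> where "\<delta> = min (exp (- B) / 2) (min 1 (\<epsilon> / 8))"
  have \<delta>: "0 < \<delta>" "\<delta> \<le> exp (- B) / 2" "\<delta> \<le> 1" "\<delta> \<le> \<epsilon> / 8"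
    using assms by (auto simp: \<delta>_def)
  \<comment> \<open>Approximating the outer function on \<open>[-1, 1]\<close>, which contains the
    range of \<open>sin\<close>, gives uniform closeness on the whole line.\<close>
  have "continuous_on {-1..1} (\<lambda>y. exp (t * (real (Suc n) * y)))"
    by (intro continuous_intros)
  from continuous_poly_approx[OF this \<delta>(1)]
  obtain b m where b: "\<And>y. y \<in> {-1..1} \<Longrightarrow> \<bar>(\<Sum>i\<le>m. b i * y ^ i) - exp (t * (real (Suc n) * y))\<bar> < \<delta>"
    by blast
  define h where "h x = (\<Sum>k\<le>m. b k * sin (x / real (Suc n)) ^ k)" for x
  have hf: "\<bar>h x - f n x\<bar> < \<delta>" for x
    unfolding h_def f_def by (rule b) auto
  have fB: "exp (- B) \<le> f n x" "f n x \<le> exp B" for x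
  proof -
    have "\<bar>t * (real (Suc n) * sin (x / real (Suc n)))\<bar> = B * \<bar>sin (x / real (Suc n))\<bar>"
      unfolding B_def by (simp add: abs_mult)
    also have "\<dots> \<le> B" by (intro mult_right_le_one_le) (auto simp: B_def)
    finally show "exp (- B) \<le> f n x" "f n x \<le> exp B" unfolding f_def by auto
  qed
  have hm[measurable]: "h \<in> borel_measurable borel" unfolding h_def by measurable
  have sq: "(h x - exp (t * x))\<^sup>2 \<le> 2 * \<delta>\<^sup>2 + 2 * (f n x - exp (t * x))\<^sup>2" for x
  proof -
    have "(h x - exp (t * x))\<^sup>2 \<le> 2 * (h x - f n x)\<^sup>2 + 2 * (f n x - exp (t * x))\<^sup>2"
      using sum_squares_bound[of "h x - f n x" "f n x - exp (t * x)"]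
      by (simp add: power2_eq_square algebra_simps)
    moreover have "(h x - f n x)\<^sup>2 \<le> \<delta>\<^sup>2"
      using hf[of x] \<delta>(1) by (simp add: abs_le_square_iff[symmetric])
    ultimately show ?thesis by simp
  qed
  have int: "integrable ?N (\<lambda>x. 2 * \<delta>\<^sup>2 + 2 * (f n x - exp (t * x))\<^sup>2)"
    using sq_int by simp
  have hint: "integrable ?N (\<lambda>x. (h x - exp (t * x))\<^sup>2)"
    by (rule Bochner_Integration.integrable_bound[OF int]) (use sq in \<open>auto intro!: AE_I2\<close>)
  have "(\<integral>x. (h x - exp (t * x))\<^sup>2 \<partial>?N) \<le> (\<integral>x. 2 * \<delta>\<^sup>2 + 2 * (f n x - exp (t * x))\<^sup>2 \<partial>?N)"
    by (rule integral_mono[OF hint int sq])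
  also have "\<dots> = 2 * \<delta>\<^sup>2 + 2 * (\<integral>x. (f n x - exp (t * x))\<^sup>2 \<partial>?N)"
    using sq_int by (simp add: N.prob_space[simplified])
  also have "\<dots> < \<epsilon>"
  proof -
    have "\<delta>\<^sup>2 \<le> \<delta>" using \<delta> by (simp add: power2_eq_square mult_left_le_one_le)
    then show ?thesis using n \<delta> assms by linarith
  qed
  finally have "(\<integral>x. (h x - exp (t * x))\<^sup>2 \<partial>?N) < \<epsilon>" .
  moreover have "exp (- B) / 2 \<le> h x" "h x \<le> exp B + 1" for x
    using hf[of x] fB[of x] \<delta> by linarith+
  moreover have "trig_poly h" unfolding h_def by (rule trig_poly_sin_polynomial)
  ultimately show thesis using that[of h "exp (- B) / 2" "exp B + 1"] hint hm by auto
qed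

section \<open>Gaussian processes\<close>

lemma char_sqrt_std_normal:
  assumes "0 \<le> v"
  shows "(\<integral>x. iexp (sqrt v * x) \<partial>std_normal_distribution) = complex_of_real (exp (- v / 2))"
proof -
  have "(\<integral>x. iexp (sqrt v * x) \<partial>std_normal_distribution) = char std_normal_distribution (sqrt v)"
    by (simp add: char_def)
  then show ?thesis using assms by (simp add: char_std_normal_distribution)
qed

text \<open>The points \<open>x l\<close> may coincide, as replicas may carry the same
  configuration, while the process is defined through sets of indices. Adding up the coefficients at
  equal points changes neither the linear combination nor its variance.\<close>

lemma centered_gaussian_process_char:
  assumes X: "centered_gaussian_process M T X K" and I: "finite I" "x ` I \<subseteq> T"
  shows "(\<integral>\<omega>. iexp (\<Sum>l\<in>I. \<theta> l * X (x l) \<omega>) \<partial>M) =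
    complex_of_real (exp (- (\<Sum>l\<in>I. \<Sum>l'\<in>I. \<theta> l * \<theta> l' * K (x l) (x l')) / 2))"
proof -
  define c where "c s = (\<Sum>l | l \<in> I \<and> x l = s. \<theta> l)" for s
  have group: "(\<Sum>s\<in>x ` I. c s * F s) = (\<Sum>l\<in>I. \<theta> l * F (x l))" for F :: "'b \<Rightarrow> real"
    using sum.group[of I "x ` I" x "\<lambda>l. \<theta> l * F (x l)"] I(1)
    by (simp add: c_def sum_distrib_right)
  define v where "v = (\<Sum>s\<in>x ` I. \<Sum>s'\<in>x ` I. c s * c s' * K s s')"
  have [measurable]: "X s \<in> borel_measurable M" if "s \<in> x ` I" for s
    using X I that by (auto simp: centered_gaussian_process_def)
  have v: "0 \<le> v" and d: "distr M borel (\<lambda>\<omega>. \<Sum>s\<in>x ` I. c s * X s \<omega>) =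
      distr std_normal_distribution borel (\<lambda>x. sqrt v * x)"
    using X I unfolding centered_gaussian_process_def Let_def v_def by auto
  have "v = (\<Sum>s\<in>x ` I. c s * (\<Sum>s'\<in>x ` I. c s' * K s s'))"
    unfolding v_def by (simp add: sum_distrib_left mult_ac)
  also have "\<dots> = (\<Sum>l\<in>I. \<theta> l * (\<Sum>l'\<in>I. \<theta> l' * K (x l) (x l')))"
    by (simp only: group)
  finally have v_eq: "v = (\<Sum>l\<in>I. \<Sum>l'\<in>I. \<theta> l * \<theta> l' * K (x l) (x l'))"
    by (simp add: sum_distrib_left mult_ac)
  have "(\<integral>\<omega>. iexp (\<Sum>l\<in>I. \<theta> l * X (x l) \<omega>) \<partial>M) = (\<integral>\<omega>. iexp (\<Sum>s\<in>x ` I. c s * X s \<omega>) \<partial>M)"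
    by (simp only: group)
  also have "\<dots> = (\<integral>y. iexp y \<partial>distr M borel (\<lambda>\<omega>. \<Sum>s\<in>x ` I. c s * X s \<omega>))"
    by (rule integral_distr[symmetric]) measurable
  also have "\<dots> = (\<integral>y. iexp (sqrt v * y) \<partial>std_normal_distribution)"
    unfolding d by (subst integral_distr) auto
  finally show ?thesis using char_sqrt_std_normal[OF v] by (simp add: v_eq)
qed

lemma centered_gaussian_process_marginal:
  assumes X: "centered_gaussian_process M T X K" and s: "s \<in> T"
  shows "0 \<le> K s s" "distr M borel (X s) = distr std_normal_distribution borel (\<lambda>x. sqrt (K s s) * x)"
proof -
  from X have *: "0 \<le> (\<Sum>a\<in>{s}. \<Sum>b\<in>{s}. 1 * 1 * K a b)"
    "distr M borel (\<lambda>\<omega>. \<Sum>a\<in>{s}. 1 * X a \<omega>) =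
      distr std_normal_distribution borel (\<lambda>x. sqrt (\<Sum>a\<in>{s}. \<Sum>b\<in>{s}. 1 * 1 * K a b) * x)"
    using s unfolding centered_gaussian_process_def Let_def
    by (auto dest!: spec[of _ "{s}"] spec[of _ "\<lambda>_. 1"])
  then show "0 \<le> K s s" "distr M borel (X s) = distr std_normal_distribution borel (\<lambda>x. sqrt (K s s) * x)"
    by simp_all
qed

text \<open>The exponents \<open>v * s\<^sup>2 / 2\<close> and
  \<open>(1 - v) * s\<^sup>2 / 2\<close> of the independent summands add up to
  \<open>s\<^sup>2 / 2\<close>, and characteristic functions determine the law. This is what
  \<open>z\<close> does for the limiting field.\<close>

lemma gaussian_completion:
  assumes "prob_space M" and Y[measurable]: "Y \<in> borel_measurable M" and v: "0 \<le> v" "v \<le> 1"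
    and d: "distr M borel Y = distr std_normal_distribution borel (\<lambda>x. sqrt v * x)"
  shows "distr (M \<Otimes>\<^sub>M std_normal_distribution) borel (\<lambda>(\<omega>, z). Y \<omega> + z * sqrt (1 - v)) = std_normal_distribution"
    (is "distr ?P _ ?f = _")
proof -
  interpret M: prob_space M by fact
  interpret N: real_distribution std_normal_distribution by (rule real_dist_normal_dist)
  interpret P: pair_prob_space M std_normal_distribution ..
  have [measurable_cong]: "sets std_normal_distribution = sets borel" by simp
  have f[measurable]: "?f \<in> borel_measurable ?P" by measurable
  have "prob_space (distr ?P borel ?f)" by (rule P.prob_space_distr) measurable
  then have rd: "real_distribution (distr ?P borel ?f)"
    by (simp add: real_distribution_def real_distribution_axioms_def)
  have "char (distr ?P borel ?f) s = char std_normal_distribution s" for s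
  proof -
    have 1: "(\<integral>\<omega>. iexp (s * Y \<omega>) \<partial>M) = complex_of_real (exp (- (v * s\<^sup>2) / 2))"
    proof -
      have "(\<integral>\<omega>. iexp (s * Y \<omega>) \<partial>M) = (\<integral>y. iexp (s * y) \<partial>distr M borel Y)"
        by (rule integral_distr[symmetric]) measurable
      also have "\<dots> = (\<integral>y. iexp ((s * sqrt v) * y) \<partial>std_normal_distribution)"
        unfolding d by (subst integral_distr) (auto simp: mult_ac)
      also have "\<dots> = char std_normal_distribution (s * sqrt v)" by (simp add: char_def)
      finally show ?thesis using v by (simp add: char_std_normal_distribution power_mult_distrib mult_ac)
    qed
    have "char (distr ?P borel ?f) s = (\<integral>p. iexp (s * ?f p) \<partial>?P)"
      unfolding char_def by (rule integral_distr) measurable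
    also have "\<dots> = (\<integral>p. iexp (s * Y (fst p)) * iexp (s * sqrt (1 - v) * snd p) \<partial>?P)"
      by (intro Bochner_Integration.integral_cong refl)
        (auto simp: exp_add[symmetric] algebra_simps)
    also have "\<dots> = (\<integral>\<omega>. \<integral>z. iexp (s * Y \<omega>) * iexp (s * sqrt (1 - v) * z) \<partial>std_normal_distribution \<partial>M)"
      by (subst P.integral_fst'[symmetric])
        (auto intro!: P.integrable_const_bound[where B=1] simp: norm_mult)
    also have "\<dots> = (\<integral>\<omega>. iexp (s * Y \<omega>) \<partial>M) * char std_normal_distribution (s * sqrt (1 - v))"
      by (simp add: char_def)
    also have "\<dots> = complex_of_real (exp (- (v * s\<^sup>2) / 2) * exp (- ((1 - v) * s\<^sup>2) / 2))"
      unfolding 1 using v by (simp add: char_std_normal_distribution power_mult_distrib mult_ac)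
    also have "\<dots> = char std_normal_distribution s"
      unfolding exp_add[symmetric] by (simp add: char_std_normal_distribution field_simps)
    finally show ?thesis .
  qed
  then show ?thesis by (intro Levy_uniqueness rd real_dist_normal_dist ext)
qed

section \<open>Convergence through approximation\<close>

lemma tendsto_uniform_approx:
  fixes x :: "nat \<Rightarrow> real"
  assumes "\<And>e. 0 < e \<Longrightarrow> \<exists>y y'. y \<longlonglongrightarrow> y' \<and> (\<forall>k. \<bar>x k - y k\<bar> \<le> e) \<and> \<bar>x' - y'\<bar> \<le> e"
  shows "x \<longlonglongrightarrow> x'"
proof (rule tendstoI)
  fix e :: real assume "0 < e"
  then obtain y y' where y: "y \<longlonglongrightarrow> y'" "\<And>k. \<bar>x k - y k\<bar> \<le> e / 4" "\<bar>x' - y'\<bar> \<le> e / 4"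
    using assms[of "e / 4"] by auto
  have "eventually (\<lambda>k. dist (y k) y' < e / 4) sequentially"
    using tendstoD[OF y(1), of "e / 4"] \<open>0 < e\<close> by simp
  then show "eventually (\<lambda>k. dist (x k) x' < e) sequentially"
  proof eventually_elim
    case (elim k)
    then have "\<bar>x k - x'\<bar> < e" using y(2)[of k] y(3) \<open>0 < e\<close> unfolding dist_real_def by linarith
    then show ?case by (simp add: dist_real_def)
  qed
qed

text \<open>A non-integrable function has integral \<open>0\<close>; the condition
  \<open>0 \<le> B\<close> covers that case.\<close>

lemma (in prob_space) integral_abs_le_const:
  fixes f :: "'a \<Rightarrow> real"
  assumes "\<And>x. x \<in> space M \<Longrightarrow> \<bar>f x\<bar> \<le> B" "0 \<le> B"
  shows "\<bar>\<integral>x. f x \<partial>M\<bar> \<le> B"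
proof (cases "integrable M f")
  case True
  have "\<bar>\<integral>x. f x \<partial>M\<bar> \<le> (\<integral>x. \<bar>f x\<bar> \<partial>M)" by (rule integral_abs_bound)
  also have "\<dots> \<le> B"
    using True assms by (intro integral_le_const) (auto intro!: AE_I2)
  finally show ?thesis .
qed (use assms in \<open>simp add: not_integrable_integral_eq\<close>)

section \<open>Joint moments of bounded variables\<close>

lemma prod_list_abs_le_1:
  fixes f :: "'a \<Rightarrow> real"
  assumes "\<And>x. x \<in> set xs \<Longrightarrow> \<bar>f x\<bar> \<le> 1"
  shows "\<bar>\<Prod>x\<leftarrow>xs. f x\<bar> \<le> 1"
  using assms by (induction xs) (auto simp: abs_mult intro!: mult_le_one)

text \<open>The spaces may differ with \<open>k\<close> and need no coupling with the limit. Moments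
  run over lists so that a variable can occur with any multiplicity.\<close>

locale moment_convergence =
  fixes \<Theta> :: "nat \<Rightarrow> 'a measure" and \<Theta>' :: "'b measure" and \<Lambda> :: "'l set"
    and R :: "nat \<Rightarrow> 'l \<Rightarrow> 'a \<Rightarrow> real" and R' :: "'l \<Rightarrow> 'b \<Rightarrow> real"
  assumes prob: "\<And>k. prob_space (\<Theta> k)" "prob_space \<Theta>'"
    and meas: "\<And>k L. L \<in> \<Lambda> \<Longrightarrow> R k L \<in> borel_measurable (\<Theta> k)" "\<And>L. L \<in> \<Lambda> \<Longrightarrow> R' L \<in> borel_measurable \<Theta>'"
    and le1: "\<And>k L x. L \<in> \<Lambda> \<Longrightarrow> x \<in> space (\<Theta> k) \<Longrightarrow> \<bar>R k L x\<bar> \<le> 1"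
      "\<And>L x. L \<in> \<Lambda> \<Longrightarrow> x \<in> space \<Theta>' \<Longrightarrow> \<bar>R' L x\<bar> \<le> 1"
    and moments: "\<And>Ls. Ls \<in> lists \<Lambda> \<Longrightarrow>
      (\<lambda>k. \<integral>x. (\<Prod>L\<leftarrow>Ls. R k L x) \<partial>\<Theta> k) \<longlonglongrightarrow> (\<integral>x. (\<Prod>L\<leftarrow>Ls. R' L x) \<partial>\<Theta>')"
begin

text \<open>A weighted form of the moment convergence: the monomials stay as free test factors, so
  that continuous functions can be moved into the weight one at a time.\<close>

definition moment_weight :: "(nat \<Rightarrow> 'a \<Rightarrow> real) \<Rightarrow> ('b \<Rightarrow> real) \<Rightarrow> bool" where
  "moment_weight A A' \<longleftrightarrow>
     (\<exists>B. (\<forall>k. \<forall>x\<in>space (\<Theta> k). \<bar>A k x\<bar> \<le> B) \<and> (\<forall>x\<in>space \<Theta>'. \<bar>A' x\<bar> \<le> B)) \<and>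
     (\<forall>k. A k \<in> borel_measurable (\<Theta> k)) \<and> A' \<in> borel_measurable \<Theta>' \<and>
     (\<forall>Ls\<in>lists \<Lambda>. (\<lambda>k. \<integral>x. A k x * (\<Prod>L\<leftarrow>Ls. R k L x) \<partial>\<Theta> k)
        \<longlonglongrightarrow> (\<integral>x. A' x * (\<Prod>L\<leftarrow>Ls. R' L x) \<partial>\<Theta>'))"

lemma moment_weight_one: "moment_weight (\<lambda>_ _. 1) (\<lambda>_. 1)"
  unfolding moment_weight_def using moments by (auto intro!: exI[of _ 1])

lemma moment_weight_limit:
  "moment_weight A A' \<Longrightarrow> (\<lambda>k. \<integral>x. A k x \<partial>\<Theta> k) \<longlonglongrightarrow> (\<integral>x. A' x \<partial>\<Theta>')"
  unfolding moment_weight_def by (force dest: bspec[of _ _ "[]"])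

text \<open>A power \<open>y ^ i\<close> under the integral amounts to \<open>i\<close> further
  copies of \<open>L\<close> in the list, so a polynomial in place of \<open>\<phi>\<close> yields
  weighted moments. Stated for one space \<open>\<Omega>\<close>, the estimate serves the members of
  the sequence as well as the limit.\<close>

lemma poly_weight_diff:
  fixes \<Omega> :: "'c measure" and Q :: "'l \<Rightarrow> 'c \<Rightarrow> real"
  assumes "prob_space \<Omega>" "A \<in> borel_measurable \<Omega>" "\<And>L. L \<in> \<Lambda> \<Longrightarrow> Q L \<in> borel_measurable \<Omega>"
    and A: "\<And>x. x \<in> space \<Omega> \<Longrightarrow> \<bar>A x\<bar> \<le> B"
    and Q: "\<And>L x. L \<in> \<Lambda> \<Longrightarrow> x \<in> space \<Omega> \<Longrightarrow> \<bar>Q L x\<bar> \<le> 1"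
    and \<phi>: "\<phi> \<in> borel_measurable borel" "\<And>y. y \<in> {-1..1} \<Longrightarrow> \<bar>(\<Sum>i\<le>m. c i * y ^ i) - \<phi> y\<bar> < e"
    and "L \<in> \<Lambda>" "Ls \<in> lists \<Lambda>" "0 < e" "0 \<le> B"
  shows "\<bar>(\<integral>x. A x * \<phi> (Q L x) * (\<Prod>L\<leftarrow>Ls. Q L x) \<partial>\<Omega>) -
    (\<Sum>i\<le>m. c i * (\<integral>x. A x * (\<Prod>L\<leftarrow>replicate i L @ Ls. Q L x) \<partial>\<Omega>))\<bar> \<le> B * e"
proof -
  interpret \<Omega>: prob_space \<Omega> by fact
  note [measurable] = assms(2,3) \<phi>(1)
  have Lsm[measurable]: "(\<lambda>x. \<Prod>L\<leftarrow>Ls'. Q L x) \<in> borel_measurable \<Omega>" if "Ls' \<in> lists \<Lambda>" for Ls'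
    using that by (induction Ls') (auto intro!: borel_measurable_times assms(3))
  have P1: "\<bar>\<Prod>L\<leftarrow>Ls'. Q L x\<bar> \<le> 1" if "Ls' \<in> lists \<Lambda>" "x \<in> space \<Omega>" for Ls' x
    by (rule prod_list_abs_le_1) (use that Q in auto)
  have int: "integrable \<Omega> (\<lambda>x. A x * (\<Prod>L\<leftarrow>Ls'. Q L x))" if "Ls' \<in> lists \<Lambda>" for Ls'
  proof (rule \<Omega>.integrable_const_bound[where B="B * 1"])
    show "AE x in \<Omega>. norm (A x * (\<Prod>L\<leftarrow>Ls'. Q L x)) \<le> B * 1"
      unfolding norm_mult real_norm_def abs_mult using A P1[OF that] \<open>0 \<le> B\<close> by (intro AE_I2 mult_mono) auto
  qed (use that in measurable)
  have rep: "replicate i L @ Ls \<in> lists \<Lambda>" for i using assms by (auto simp: in_lists_conv_set)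
  let ?P = "\<lambda>x. (\<Sum>i\<le>m. c i * Q L x ^ i)" and ?S = "\<lambda>x. \<Prod>L\<leftarrow>Ls. Q L x"
  have "(\<Sum>i\<le>m. c i * (\<integral>x. A x * (\<Prod>L\<leftarrow>replicate i L @ Ls. Q L x) \<partial>\<Omega>)) =
    (\<integral>x. (\<Sum>i\<le>m. c i * (A x * (\<Prod>L\<leftarrow>replicate i L @ Ls. Q L x))) \<partial>\<Omega>)"
    using int[OF rep] by simp
  also have "\<dots> = (\<integral>x. A x * ?P x * ?S x \<partial>\<Omega>)"
    by (simp add: sum_distrib_left sum_distrib_right prod_list_replicate mult_ac)
  finally have eq: "(\<Sum>i\<le>m. c i * (\<integral>x. A x * (\<Prod>L\<leftarrow>replicate i L @ Ls. Q L x) \<partial>\<Omega>)) =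
    (\<integral>x. A x * ?P x * ?S x \<partial>\<Omega>)" .
  have PB: "\<bar>?P x - \<phi> (Q L x)\<bar> \<le> e" if "x \<in> space \<Omega>" for x
    using \<phi>(2)[of "Q L x"] Q[OF \<open>L \<in> \<Lambda>\<close> that] by (auto simp: abs_le_iff less_imp_le)
  have intP: "integrable \<Omega> (\<lambda>x. A x * ?P x * ?S x)"
  proof -
    have "integrable \<Omega> (\<lambda>x. (\<Sum>i\<le>m. c i * (A x * (\<Prod>L\<leftarrow>replicate i L @ Ls. Q L x))))"
      using int[OF rep] by simp
    then show ?thesis
      by (simp add: sum_distrib_left sum_distrib_right prod_list_replicate mult_ac)
  qed
  have small: "\<bar>A x * \<phi> (Q L x) * ?S x - A x * ?P x * ?S x\<bar> \<le> B * e" if "x \<in> space \<Omega>" for x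
  proof -
    have "\<bar>A x * \<phi> (Q L x) * ?S x - A x * ?P x * ?S x\<bar> = \<bar>A x\<bar> * \<bar>?P x - \<phi> (Q L x)\<bar> * \<bar>?S x\<bar>"
      unfolding abs_mult[symmetric] by (simp add: algebra_simps abs_minus_commute)
    also have "\<dots> \<le> B * e * 1"
      using A[OF that] PB[OF that] P1[OF \<open>Ls \<in> lists \<Lambda>\<close> that] \<open>0 \<le> B\<close> \<open>0 < e\<close> by (intro mult_mono) auto
    finally show ?thesis by simp
  qed
  have "integrable \<Omega> (\<lambda>x. A x * \<phi> (Q L x) * ?S x - A x * ?P x * ?S x)"
    by (rule \<Omega>.integrable_const_bound[where B="B * e"])
      (use small assms in \<open>auto intro!: AE_I2\<close>)
  from Bochner_Integration.integrable_add[OF this intP] have "integrable \<Omega> (\<lambda>x. A x * \<phi> (Q L x) * ?S x)" by simp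
  then have "(\<integral>x. A x * \<phi> (Q L x) * ?S x \<partial>\<Omega>) - (\<integral>x. A x * ?P x * ?S x \<partial>\<Omega>) =
    (\<integral>x. A x * \<phi> (Q L x) * ?S x - A x * ?P x * ?S x \<partial>\<Omega>)"
    using intP by simp
  then show ?thesis
    unfolding eq using \<Omega>.integral_abs_le_const[OF small] \<open>0 \<le> B\<close> \<open>0 < e\<close> by simp
qed

lemma moment_weight_continuous:
  assumes A: "moment_weight A A'" and L: "L \<in> \<Lambda>" and \<phi>: "continuous_on UNIV \<phi>"
  shows "moment_weight (\<lambda>k x. A k x * \<phi> (R k L x)) (\<lambda>x. A' x * \<phi> (R' L x))"
proof -
  obtain B where B: "\<And>k x. x \<in> space (\<Theta> k) \<Longrightarrow> \<bar>A k x\<bar> \<le> B" "\<And>x. x \<in> space \<Theta>' \<Longrightarrow> \<bar>A' x\<bar> \<le> B"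
    and m[measurable]: "\<And>k. A k \<in> borel_measurable (\<Theta> k)" "A' \<in> borel_measurable \<Theta>'"
    and conv: "\<And>Ls. Ls \<in> lists \<Lambda> \<Longrightarrow> (\<lambda>k. \<integral>x. A k x * (\<Prod>L\<leftarrow>Ls. R k L x) \<partial>\<Theta> k)
        \<longlonglongrightarrow> (\<integral>x. A' x * (\<Prod>L\<leftarrow>Ls. R' L x) \<partial>\<Theta>')"
    using A unfolding moment_weight_def by blast
  have \<phi>m[measurable]: "\<phi> \<in> borel_measurable borel"
    using \<phi> by (rule borel_measurable_continuous_onI)
  note [measurable] = meas[OF L]
  \<comment> \<open>A probability space is not empty, hence a bound of
    \<open>\<bar>A' x\<bar>\<close> is nonnegative.\<close>
  obtain x0 where "x0 \<in> space \<Theta>'" using prob_space.not_empty[OF prob(2)] by blast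
  then have B0: "0 \<le> B" using B(2)[of x0] by linarith
  have "bounded (\<phi> ` {-1..1})"
    by (intro compact_imp_bounded compact_continuous_image continuous_on_subset[OF \<phi>]) auto
  then obtain b where b: "\<And>y. y \<in> {-1..1} \<Longrightarrow> \<bar>\<phi> y\<bar> \<le> b" unfolding bounded_iff by (metis imageI real_norm_def)
  have "\<bar>a * \<phi> y\<bar> \<le> B * b" if "\<bar>a\<bar> \<le> B" "\<bar>y\<bar> \<le> 1" for a y
    unfolding abs_mult using that b[of y] B0 by (intro mult_mono) (auto simp: abs_le_iff)
  then have bd: "\<forall>k. \<forall>x\<in>space (\<Theta> k). \<bar>A k x * \<phi> (R k L x)\<bar> \<le> B * b" "\<forall>x\<in>space \<Theta>'. \<bar>A' x * \<phi> (R' L x)\<bar> \<le> B * b"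
    using B le1[OF L] by auto
  have "(\<lambda>k. \<integral>x. A k x * \<phi> (R k L x) * (\<Prod>L\<leftarrow>Ls. R k L x) \<partial>\<Theta> k)
    \<longlonglongrightarrow> (\<integral>x. A' x * \<phi> (R' L x) * (\<Prod>L\<leftarrow>Ls. R' L x) \<partial>\<Theta>')" if Ls: "Ls \<in> lists \<Lambda>" for Ls
  proof (rule tendsto_uniform_approx)
    fix e :: real assume "0 < e"
    \<comment> \<open>The summand \<open>1\<close> keeps the denominator positive when
      \<open>B = 0\<close>.\<close>
    define e' where "e' = e / (B + 1)"
    have e': "0 < e'" "B * e' \<le> e" using \<open>0 < e\<close> B0 by (auto simp: e'_def field_simps)
    obtain c n where c: "\<And>y. y \<in> {-1..1} \<Longrightarrow> \<bar>(\<Sum>i\<le>n. c i * y ^ i) - \<phi> y\<bar> < e'"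
      using continuous_poly_approx[OF continuous_on_subset[OF \<phi>] e'(1)] by (metis subset_UNIV)
    let ?y = "\<lambda>k. \<Sum>i\<le>n. c i * (\<integral>x. A k x * (\<Prod>L\<leftarrow>replicate i L @ Ls. R k L x) \<partial>\<Theta> k)"
    let ?y' = "\<Sum>i\<le>n. c i * (\<integral>x. A' x * (\<Prod>L\<leftarrow>replicate i L @ Ls. R' L x) \<partial>\<Theta>')"
    have "?y \<longlonglongrightarrow> ?y'"
      by (intro tendsto_sum tendsto_mult tendsto_const conv) (use L Ls in \<open>auto simp: in_lists_conv_set\<close>)
    moreover have "\<bar>(\<integral>x. A k x * \<phi> (R k L x) * (\<Prod>L\<leftarrow>Ls. R k L x) \<partial>\<Theta> k) - ?y k\<bar> \<le> e" for k
      by (rule order_trans[OF poly_weight_diff[OF prob(1) m(1) meas(1) B(1) le1(1) \<phi>m c L Ls e'(1) B0] e'(2)])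
    moreover have "\<bar>(\<integral>x. A' x * \<phi> (R' L x) * (\<Prod>L\<leftarrow>Ls. R' L x) \<partial>\<Theta>') - ?y'\<bar> \<le> e"
      by (rule order_trans[OF poly_weight_diff[OF prob(2) m(2) meas(2) B(2) le1(2) \<phi>m c L Ls e'(1) B0] e'(2)])
    ultimately show "\<exists>y y'. y \<longlonglongrightarrow> y' \<and>
        (\<forall>k. \<bar>(\<integral>x. A k x * \<phi> (R k L x) * (\<Prod>L\<leftarrow>Ls. R k L x) \<partial>\<Theta> k) - y k\<bar> \<le> e) \<and>
        \<bar>(\<integral>x. A' x * \<phi> (R' L x) * (\<Prod>L\<leftarrow>Ls. R' L x) \<partial>\<Theta>') - y'\<bar> \<le> e"
      by blast
  qed
  then show ?thesis
    unfolding moment_weight_def using bd by (intro conjI exI[of _ "B * b"]) auto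
qed

lemma moment_weight_prod:
  assumes "finite J" "\<And>j. j \<in> J \<Longrightarrow> L j \<in> \<Lambda>" "\<And>j. j \<in> J \<Longrightarrow> continuous_on UNIV (\<phi> j)" "moment_weight A A'"
  shows "moment_weight (\<lambda>k x. A k x * (\<Prod>j\<in>J. \<phi> j (R k (L j) x))) (\<lambda>x. A' x * (\<Prod>j\<in>J. \<phi> j (R' (L j) x)))"
  using assms
proof (induction J)
  case (insert j J)
  then have "moment_weight (\<lambda>k x. A k x * (\<Prod>j\<in>J. \<phi> j (R k (L j) x)) * \<phi> j (R k (L j) x))
    (\<lambda>x. A' x * (\<Prod>j\<in>J. \<phi> j (R' (L j) x)) * \<phi> j (R' (L j) x))"
    by (intro moment_weight_continuous) auto
  then show ?case using insert by (simp add: mult_ac)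
qed simp

end

section \<open>Exponential tilts by a Gaussian field\<close>

text \<open>
  Covers both sides: \<open>\<nu> \<omega>\<close> is the Gibbs measure, or the law of \<open>(u, z)\<close>. The index \<open>l\<close> of \<open>a l\<close>
  ranges over all naturals with \<open>a l = 1\<close> beyond \<open>q\<close>, so that powers of the normalisation are
  products of averages too.
\<close>

locale gaussian_tilt = prob_space M for M :: "'a measure" +
  fixes \<nu> :: "'a \<Rightarrow> 'b measure" and X :: "'a \<Rightarrow> 'b \<Rightarrow> real" and a :: "nat \<Rightarrow> 'a \<Rightarrow> 'b \<Rightarrow> real" and q :: nat
  assumes prob_\<nu>: "\<And>\<omega>. \<omega> \<in> space M \<Longrightarrow> prob_space (\<nu> \<omega>)"
    and X_meas: "\<And>\<omega>. \<omega> \<in> space M \<Longrightarrow> X \<omega> \<in> borel_measurable (\<nu> \<omega>)"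
    and a_meas: "\<And>l \<omega>. \<omega> \<in> space M \<Longrightarrow> a l \<omega> \<in> borel_measurable (\<nu> \<omega>)"
    and a_le1: "\<And>l \<omega> x. \<omega> \<in> space M \<Longrightarrow> x \<in> space (\<nu> \<omega>) \<Longrightarrow> \<bar>a l \<omega> x\<bar> \<le> 1"
    and a_one: "\<And>l \<omega> x. q < l \<Longrightarrow> a l \<omega> x = 1"
    and int_meas: "\<And>l h. h \<in> borel_measurable borel \<Longrightarrow>
      (\<lambda>\<omega>. \<integral>x. a l \<omega> x * h (X \<omega> x) \<partial>\<nu> \<omega>) \<in> borel_measurable M"
    and nn_meas: "\<And>h. h \<in> borel_measurable borel \<Longrightarrow> (\<lambda>\<omega>. \<integral>\<^sup>+x. ennreal (h (X \<omega> x)) \<partial>\<nu> \<omega>) \<in> borel_measurable M"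
    and marginal: "\<And>h. h \<in> borel_measurable borel \<Longrightarrow> (\<And>x. 0 \<le> h x) \<Longrightarrow>
      (\<integral>\<^sup>+\<omega>. \<integral>\<^sup>+x. ennreal (h (X \<omega> x)) \<partial>\<nu> \<omega> \<partial>M) = (\<integral>\<^sup>+x. ennreal (h x) \<partial>std_normal_distribution)"
begin

definition avg :: "nat \<Rightarrow> (real \<Rightarrow> real) \<Rightarrow> 'a \<Rightarrow> real" where
  "avg l h \<omega> = (\<integral>x. a l \<omega> x * h (X \<omega> x) \<partial>\<nu> \<omega>)"

definition mass :: "(real \<Rightarrow> real) \<Rightarrow> 'a \<Rightarrow> real" where
  "mass h \<omega> = (\<integral>x. h (X \<omega> x) \<partial>\<nu> \<omega>)"

definition tilt :: "(real \<Rightarrow> real) \<Rightarrow> real" where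
  "tilt h = (\<integral>\<omega>. (\<Prod>l=1..q. avg l h \<omega> / mass h \<omega>) \<partial>M)"

definition char_moment :: "nat \<Rightarrow> (nat \<Rightarrow> real) \<Rightarrow> complex" where
  "char_moment n \<theta> = (\<integral>\<omega>. (\<Prod>l=1..n. \<integral>x. of_real (a l \<omega> x) * iexp (\<theta> l * X \<omega> x) \<partial>\<nu> \<omega>) \<partial>M)"

lemma mass_avg: "q < l \<Longrightarrow> mass h \<omega> = avg l h \<omega>"
  unfolding mass_def avg_def by (simp add: a_one)

lemma avg_meas[measurable (raw)]: "h \<in> borel_measurable borel \<Longrightarrow> avg l h \<in> borel_measurable M"
  unfolding avg_def by (rule int_meas)

lemma mass_meas[measurable (raw)]: "h \<in> borel_measurable borel \<Longrightarrow> mass h \<in> borel_measurable M"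
  using avg_meas[of h "Suc q"] mass_avg[of "Suc q" h] by (metis ext lessI)

text \<open>The mean over \<open>\<omega>\<close> of the inner integral is a finite Gaussian
  integral, so the inner one is finite for almost every \<open>\<omega>\<close>. For the
  exponential, integrability is available only in this almost sure sense.\<close>

lemma mass_marginal:
  assumes [measurable]: "h \<in> borel_measurable borel" and h: "\<And>x. 0 \<le> h x" and int: "integrable std_normal_distribution h"
  shows "AE \<omega> in M. integrable (\<nu> \<omega>) (\<lambda>x. h (X \<omega> x))"
    and "has_bochner_integral M (mass h) (\<integral>x. h x \<partial>std_normal_distribution)"
proof -
  have fin: "(\<integral>\<^sup>+\<omega>. \<integral>\<^sup>+x. ennreal (h (X \<omega> x)) \<partial>\<nu> \<omega> \<partial>M) = ennreal (\<integral>x. h x \<partial>std_normal_distribution)"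
    using int h by (subst marginal) (auto intro!: nn_integral_eq_integral)
  have "AE \<omega> in M. (\<integral>\<^sup>+x. ennreal (h (X \<omega> x)) \<partial>\<nu> \<omega>) \<noteq> \<infinity>"
    by (rule nn_integral_PInf_AE) (use nn_meas fin in auto)
  then have AE: "AE \<omega> in M. integrable (\<nu> \<omega>) (\<lambda>x. h (X \<omega> x)) \<and>
    (\<integral>\<^sup>+x. ennreal (h (X \<omega> x)) \<partial>\<nu> \<omega>) = ennreal (mass h \<omega>)"
  proof (rule AE_mp, intro AE_I2 impI)
    fix \<omega> assume \<omega>: "\<omega> \<in> space M" and f: "(\<integral>\<^sup>+x. ennreal (h (X \<omega> x)) \<partial>\<nu> \<omega>) \<noteq> \<infinity>"
    note [measurable] = X_meas[OF \<omega>]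
    have i: "integrable (\<nu> \<omega>) (\<lambda>x. h (X \<omega> x))"
      by (rule integrableI_nonneg) (use h f in \<open>auto simp: top.not_eq_extremum\<close>)
    then show "integrable (\<nu> \<omega>) (\<lambda>x. h (X \<omega> x)) \<and>
      (\<integral>\<^sup>+x. ennreal (h (X \<omega> x)) \<partial>\<nu> \<omega>) = ennreal (mass h \<omega>)"
      unfolding mass_def using h by (auto intro!: nn_integral_eq_integral)
  qed
  then show "AE \<omega> in M. integrable (\<nu> \<omega>) (\<lambda>x. h (X \<omega> x))" by (rule AE_mp) auto
  have "(\<integral>\<^sup>+\<omega>. ennreal (mass h \<omega>) \<partial>M) = (\<integral>\<^sup>+\<omega>. \<integral>\<^sup>+x. ennreal (h (X \<omega> x)) \<partial>\<nu> \<omega> \<partial>M)"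
    by (rule nn_integral_cong_AE) (use AE in auto)
  then show "has_bochner_integral M (mass h) (\<integral>x. h x \<partial>std_normal_distribution)"
    unfolding fin by (intro has_bochner_integral_nn_integral) (use h in \<open>auto simp: mass_def intro!: AE_I2\<close>)
qed

lemma abs_avg_le_mass:
  assumes \<omega>: "\<omega> \<in> space M" and h: "h \<in> borel_measurable borel" "\<And>x. 0 \<le> h x"
    and int: "integrable (\<nu> \<omega>) (\<lambda>x. h (X \<omega> x))"
  shows "\<bar>avg l h \<omega>\<bar> \<le> mass h \<omega>"
proof -
  note [measurable] = a_meas[OF \<omega>] X_meas[OF \<omega>] h(1)
  have "\<bar>avg l h \<omega>\<bar> \<le> (\<integral>x. \<bar>a l \<omega> x * h (X \<omega> x)\<bar> \<partial>\<nu> \<omega>)"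
    unfolding avg_def by (rule integral_abs_bound)
  also have "\<dots> \<le> mass h \<omega>" unfolding mass_def
  proof (rule integral_mono)
    show "integrable (\<nu> \<omega>) (\<lambda>x. \<bar>a l \<omega> x * h (X \<omega> x)\<bar>)"
      by (rule Bochner_Integration.integrable_bound[OF int])
        (use a_le1[OF \<omega>] in \<open>auto simp: abs_mult intro!: AE_I2 mult_left_le_one_le\<close>)
  qed (use a_le1[OF \<omega>] h int in \<open>auto simp: abs_mult intro!: mult_left_le_one_le\<close>)
  finally show ?thesis .
qed

text \<open>The bound holds at every \<open>\<omega>\<close>: where the inner integral of
  \<open>h\<close> does not exist, the mass is \<open>0\<close> by convention, and so is the
  quotient.\<close>

lemma abs_avg_div_mass:
  assumes \<omega>: "\<omega> \<in> space M" and h: "h \<in> borel_measurable borel" "\<And>x. 0 \<le> h x"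
  shows "\<bar>avg l h \<omega> / mass h \<omega>\<bar> \<le> 1"
proof (cases "integrable (\<nu> \<omega>) (\<lambda>x. h (X \<omega> x))")
  case True
  from abs_avg_le_mass[OF \<omega> h True, of l] show ?thesis
    by (cases "mass h \<omega> = 0") (auto simp: abs_divide divide_le_eq)
qed (simp add: mass_def not_integrable_integral_eq)

lemma tilt_integrable:
  assumes [measurable]: "h \<in> borel_measurable borel" and "\<And>x. 0 \<le> h x"
  shows "integrable M (\<lambda>\<omega>. \<Prod>l=1..q. avg l h \<omega> / mass h \<omega>)"
proof (rule integrable_const_bound[where B=1])
  show "AE \<omega> in M. norm (\<Prod>l=1..q. avg l h \<omega> / mass h \<omega>) \<le> 1"
    unfolding real_norm_def abs_prod
    by (intro AE_I2 prod_le_1) (use abs_avg_div_mass[OF _ assms] in auto)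
qed measurable

text \<open>Pointwise, \<open>tilted_product_diff_bound\<close> gives a combination of the mass of
  the squared error and the mass of \<open>exp (- 2 * t * x)\<close>. Their means over
  \<open>\<omega>\<close> are Gaussian integrals by \<open>marginal\<close>, hence the bound is the
  same for every field with standard Gaussian marginal.\<close>

lemma tilt_diff_exp:
  assumes h[measurable]: "h \<in> borel_measurable borel" and c: "0 < c" "\<And>x. c \<le> h x" "\<And>x. h x \<le> C"
    and int: "integrable std_normal_distribution (\<lambda>x. (h x - exp (t * x))\<^sup>2)" and \<eta>: "0 < \<eta>"
  shows "\<bar>tilt h - tilt (\<lambda>x. exp (t * x))\<bar> \<le> real q *
    ((\<integral>x. (h x - exp (t * x))\<^sup>2 \<partial>std_normal_distribution) / \<eta> +
     \<eta> * (\<integral>x. exp (- 2 * t * x) \<partial>std_normal_distribution))"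
proof -
  let ?e = "\<lambda>x. exp (t * x)" and ?d = "\<lambda>x. (h x - exp (t * x))\<^sup>2" and ?i = "\<lambda>x. exp (- 2 * t * x)"
  let ?R = "\<lambda>h \<omega>. \<Prod>l=1..q. avg l h \<omega> / mass h \<omega>"
  have h0: "0 < h x" for x using c(1) c(2)[of x] by linarith
  have d: "?d \<in> borel_measurable borel" "\<And>x. 0 \<le> ?d x" by auto
  have i: "?i \<in> borel_measurable borel" "\<And>x. 0 \<le> ?i x" by auto
  note D = mass_marginal[OF d int] and I = mass_marginal[OF i integrable_exp_std_normal]
  have "AE \<omega> in M. \<bar>?R h \<omega> - ?R ?e \<omega>\<bar> \<le> real q * (mass ?d \<omega> / \<eta> + \<eta> * mass ?i \<omega>)"
    using D(1) I(1) AE_space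
  proof eventually_elim
    case (elim \<omega>)
    then have \<omega>: "\<omega> \<in> space M" by simp
    interpret \<nu>: prob_space "\<nu> \<omega>" by (rule prob_\<nu>[OF \<omega>])
    note [measurable] = X_meas[OF \<omega>] a_meas[OF \<omega>]
    have inv: "(1 / exp (t * X \<omega> x))\<^sup>2 = exp (- 2 * t * X \<omega> x)" for x
      by (simp add: power2_eq_square exp_minus exp_add[symmetric] inverse_eq_divide[symmetric]
        inverse_mult_distrib[symmetric] del: inverse_mult_distrib)
    have hint: "integrable (\<nu> \<omega>) (\<lambda>x. h (X \<omega> x))"
      by (rule \<nu>.integrable_const_bound[where B=C]) (use c h0 in \<open>auto simp: abs_of_pos intro!: AE_I2\<close>)
    show ?case
      using \<nu>.tilted_product_diff_bound[of "{1..q}" "\<lambda>l. a l \<omega>" "\<lambda>x. h (X \<omega> x)" "\<lambda>x. exp (t * X \<omega> x)" \<eta>]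
        a_le1[OF \<omega>] h0 hint elim \<eta>
      unfolding inv avg_def mass_def by simp
  qed
  moreover have Ri: "integrable M (?R h)" "integrable M (?R ?e)"
    using tilt_integrable[OF h less_imp_le[OF h0]] tilt_integrable[of ?e] by auto
  moreover have B: "has_bochner_integral M (\<lambda>\<omega>. real q * (mass ?d \<omega> / \<eta> + \<eta> * mass ?i \<omega>))
    (real q * ((\<integral>x. ?d x \<partial>std_normal_distribution) / \<eta> + \<eta> * (\<integral>x. ?i x \<partial>std_normal_distribution)))"
    by (intro has_bochner_integral_mult_right has_bochner_integral_add has_bochner_integral_divide D I)
  ultimately have "(\<integral>\<omega>. \<bar>?R h \<omega> - ?R ?e \<omega>\<bar> \<partial>M) \<le> (\<integral>\<omega>. real q * (mass ?d \<omega> / \<eta> + \<eta> * mass ?i \<omega>) \<partial>M)"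
    by (intro integral_mono_AE) (auto simp: has_bochner_integral_iff)
  moreover have "\<bar>tilt h - tilt ?e\<bar> \<le> (\<integral>\<omega>. \<bar>?R h \<omega> - ?R ?e \<omega>\<bar> \<partial>M)"
    unfolding tilt_def using Ri integral_abs_bound[of M "\<lambda>\<omega>. ?R h \<omega> - ?R ?e \<omega>"] by simp
  ultimately show ?thesis using has_bochner_integral_integral_eq[OF B] by linarith
qed

lemma mass_bounds:
  assumes h[measurable]: "h \<in> borel_measurable borel" and c: "\<And>x. c \<le> h x" "\<And>x. h x \<le> C" and "0 \<le> c" and \<omega>: "\<omega> \<in> space M"
  shows "integrable (\<nu> \<omega>) (\<lambda>x. h (X \<omega> x))" "c \<le> mass h \<omega>" "mass h \<omega> \<le> C"
proof -
  interpret \<nu>: prob_space "\<nu> \<omega>" by (rule prob_\<nu>[OF \<omega>])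
  note [measurable] = X_meas[OF \<omega>]
  have "\<bar>h x\<bar> \<le> C" for x using c[of x] \<open>0 \<le> c\<close> by simp
  then show i: "integrable (\<nu> \<omega>) (\<lambda>x. h (X \<omega> x))"
    by (intro \<nu>.integrable_const_bound[where B=C]) auto
  show "c \<le> mass h \<omega>" "mass h \<omega> \<le> C"
    unfolding mass_def using c by (auto intro!: \<nu>.integral_ge_const \<nu>.integral_le_const i)
qed

text \<open>The mass lies in \<open>{c..C}\<close>, where \<open>1 / z ^ q\<close> is close to a
  polynomial. Since \<open>a l = 1\<close> beyond \<open>q\<close>, a power
  \<open>mass h \<omega> ^ i\<close> is the product of the averages with indices
  \<open>q + 1\<close> to \<open>q + i\<close>. The factor \<open>C ^ q\<close> bounds the product
  of the first \<open>q\<close> averages.\<close>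

lemma tilt_moment_approx:
  assumes h[measurable]: "h \<in> borel_measurable borel" and c: "0 < c" "\<And>x. c \<le> h x" "\<And>x. h x \<le> C"
    and b: "\<And>z. z \<in> {c..C} \<Longrightarrow> \<bar>(\<Sum>i\<le>m. b i * z ^ i) - 1 / z ^ q\<bar> < \<delta>"
  shows "\<bar>tilt h - (\<Sum>i\<le>m. b i * (\<integral>\<omega>. (\<Prod>l=1..q + i. avg l h \<omega>) \<partial>M))\<bar> \<le> C ^ q * \<delta>"
proof -
  have h0: "0 \<le> h x" for x using c(1) c(2)[of x] by linarith
  have C: "0 < C" using c(1) c(2)[of 0] c(3)[of 0] by linarith
  have \<delta>: "0 < \<delta>" using b[of c] c(2)[of 0] c(3)[of 0] by auto
  note mb = mass_bounds[OF h c(2,3) less_imp_le[OF c(1)]]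
  let ?A = "\<lambda>\<omega>. \<Prod>l=1..q. avg l h \<omega>"
  have A: "\<bar>?A \<omega>\<bar> \<le> C ^ q" if "\<omega> \<in> space M" for \<omega>
  proof -
    have "\<bar>?A \<omega>\<bar> \<le> (\<Prod>l=1..q. C)"
      unfolding abs_prod using abs_avg_le_mass[OF that h h0 mb(1)[OF that]] mb(3)[OF that]
      by (intro prod_mono) (auto intro: order_trans)
    then show ?thesis by simp
  qed
  have split: "(\<Prod>l=1..q + i. avg l h \<omega>) = ?A \<omega> * mass h \<omega> ^ i" for i \<omega>
  proof (induction i)
    case (Suc i)
    then show ?case using mass_avg[of "Suc (q + i)" h \<omega>] by (simp add: mult_ac)
  qed simp
  have mb': "\<bar>mass h \<omega>\<bar> \<le> C" if "\<omega> \<in> space M" for \<omega>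
    using mb(2,3)[OF that] c(1) by linarith
  have int: "integrable M (\<lambda>\<omega>. ?A \<omega> * mass h \<omega> ^ i)" for i
  proof (rule integrable_const_bound[where B="C ^ q * C ^ i"])
    show "AE \<omega> in M. norm (?A \<omega> * mass h \<omega> ^ i) \<le> C ^ q * C ^ i"
      unfolding real_norm_def abs_mult power_abs
      using A mb' C by (intro AE_I2 mult_mono power_mono) auto
  qed measurable
  let ?P = "\<lambda>\<omega>. \<Sum>i\<le>m. b i * mass h \<omega> ^ i"
  have eq: "(\<Sum>i\<le>m. b i * (\<integral>\<omega>. (\<Prod>l=1..q + i. avg l h \<omega>) \<partial>M)) = (\<integral>\<omega>. ?A \<omega> * ?P \<omega> \<partial>M)"
  proof -
    have "(\<Sum>i\<le>m. b i * (\<integral>\<omega>. ?A \<omega> * mass h \<omega> ^ i \<partial>M)) = (\<integral>\<omega>. (\<Sum>i\<le>m. b i * (?A \<omega> * mass h \<omega> ^ i)) \<partial>M)"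
      using int by simp
    then show ?thesis unfolding split by (simp add: sum_distrib_left mult.left_commute)
  qed
  have intP: "integrable M (\<lambda>\<omega>. ?A \<omega> * ?P \<omega>)"
  proof -
    have "integrable M (\<lambda>\<omega>. (\<Sum>i\<le>m. b i * (?A \<omega> * mass h \<omega> ^ i)))" using int by simp
    then show ?thesis by (simp add: sum_distrib_left mult.left_commute)
  qed
  have "tilt h - (\<integral>\<omega>. ?A \<omega> * ?P \<omega> \<partial>M) = (\<integral>\<omega>. (\<Prod>l=1..q. avg l h \<omega> / mass h \<omega>) - ?A \<omega> * ?P \<omega> \<partial>M)"
    unfolding tilt_def using tilt_integrable[OF h h0] intP by simp
  also have "\<bar>\<dots>\<bar> \<le> C ^ q * \<delta>"
  proof (rule integral_abs_le_const)
    fix \<omega> assume \<omega>: "\<omega> \<in> space M"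
    have "(\<Prod>l=1..q. avg l h \<omega> / mass h \<omega>) - ?A \<omega> * ?P \<omega> = ?A \<omega> * (1 / mass h \<omega> ^ q - ?P \<omega>)"
      by (simp add: prod_dividef right_diff_distrib)
    then have "\<bar>(\<Prod>l=1..q. avg l h \<omega> / mass h \<omega>) - ?A \<omega> * ?P \<omega>\<bar> = \<bar>?A \<omega>\<bar> * \<bar>?P \<omega> - 1 / mass h \<omega> ^ q\<bar>"
      by (simp only: abs_mult abs_minus_commute)
    also have "\<dots> \<le> C ^ q * \<delta>"
      using A[OF \<omega>] b[of "mass h \<omega>"] mb[OF \<omega>] C by (intro mult_mono) auto
    finally show "\<bar>(\<Prod>l=1..q. avg l h \<omega> / mass h \<omega>) - ?A \<omega> * ?P \<omega>\<bar> \<le> C ^ q * \<delta>" .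
  qed (use C \<delta> in simp)
  finally show ?thesis unfolding eq .
qed

text \<open>When the product is multiplied out, each term chooses a frequency \<open>f l\<close> for
  every \<open>l\<close>; the coefficients leave the integral and a characteristic moment
  remains.\<close>

lemma avg_trig_expand:
  assumes h: "\<And>x. complex_of_real (h x) = (\<Sum>j\<in>J. c j * iexp (\<theta> j * x))" and "finite J"
  shows "complex_of_real (\<integral>\<omega>. (\<Prod>l=1..n. avg l h \<omega>) \<partial>M) =
    (\<Sum>f\<in>PiE {1..n} (\<lambda>_. J). (\<Prod>l=1..n. c (f l)) * char_moment n (\<lambda>l. \<theta> (f l)))"
proof -
  let ?m = "\<lambda>l s \<omega>. \<integral>x. of_real (a l \<omega> x) * iexp (s * X \<omega> x) \<partial>\<nu> \<omega>"
  have int: "integrable (\<nu> \<omega>) (\<lambda>x. of_real (a l \<omega> x) * iexp (s * X \<omega> x))" if \<omega>: "\<omega> \<in> space M" for l s \<omega>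
  proof -
    interpret \<nu>: prob_space "\<nu> \<omega>" by (rule prob_\<nu>[OF \<omega>])
    note [measurable] = X_meas[OF \<omega>] a_meas[OF \<omega>]
    show ?thesis
      by (rule \<nu>.integrable_const_bound[where B=1]) (use a_le1[OF \<omega>] in \<open>auto simp: norm_mult intro!: AE_I2\<close>)
  qed
  have m1: "norm (?m l s \<omega>) \<le> 1" if \<omega>: "\<omega> \<in> space M" for l s \<omega>
  proof -
    interpret \<nu>: prob_space "\<nu> \<omega>" by (rule prob_\<nu>[OF \<omega>])
    have "norm (?m l s \<omega>) \<le> (\<integral>x. norm (of_real (a l \<omega> x) * iexp (s * X \<omega> x)) \<partial>\<nu> \<omega>)"
      by (rule integral_norm_bound)
    also have "\<dots> \<le> 1"
      using int[OF \<omega>] a_le1[OF \<omega>] by (intro \<nu>.integral_le_const integrable_norm) (auto simp: norm_mult intro!: AE_I2)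
    finally show ?thesis .
  qed
  \<comment> \<open>The locale grants measurability for real test functions only, so the complex
    average is assembled from \<open>cos\<close> and \<open>sin\<close>.\<close>
  have mm: "?m l s \<in> borel_measurable M" for l s
  proof -
    have "?m l s \<omega> = of_real (\<integral>x. a l \<omega> x * cos (s * X \<omega> x) \<partial>\<nu> \<omega>) + \<i> * of_real (\<integral>x. a l \<omega> x * sin (s * X \<omega> x) \<partial>\<nu> \<omega>)"
      if \<omega>: "\<omega> \<in> space M" for \<omega>
    proof -
      have "Re (?m l s \<omega>) = (\<integral>x. a l \<omega> x * cos (s * X \<omega> x) \<partial>\<nu> \<omega>)"
        using int[OF \<omega>] by (subst integral_Re[symmetric]) (auto simp: Re_exp)
      moreover have "Im (?m l s \<omega>) = (\<integral>x. a l \<omega> x * sin (s * X \<omega> x) \<partial>\<nu> \<omega>)"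
        using int[OF \<omega>] by (subst integral_Im[symmetric]) (auto simp: Im_exp)
      ultimately show ?thesis by (simp add: complex_eq_iff)
    qed
    moreover have "(\<lambda>\<omega>. of_real (\<integral>x. a l \<omega> x * cos (s * X \<omega> x) \<partial>\<nu> \<omega>) + \<i> * of_real (\<integral>x. a l \<omega> x * sin (s * X \<omega> x) \<partial>\<nu> \<omega>))
      \<in> borel_measurable M"
      using int_meas[of "\<lambda>x. cos (s * x)" l] int_meas[of "\<lambda>x. sin (s * x)" l] by measurable
    ultimately show ?thesis by (simp cong: measurable_cong)
  qed
  have avg: "complex_of_real (avg l h \<omega>) = (\<Sum>j\<in>J. c j * ?m l (\<theta> j) \<omega>)" if \<omega>: "\<omega> \<in> space M" for l \<omega>
  proof -
    have "complex_of_real (avg l h \<omega>) = (\<integral>x. (\<Sum>j\<in>J. c j * (of_real (a l \<omega> x) * iexp (\<theta> j * X \<omega> x))) \<partial>\<nu> \<omega>)"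
      unfolding avg_def by (simp add: integral_complex_of_real[symmetric] h sum_distrib_left mult_ac)
    also have "\<dots> = (\<Sum>j\<in>J. c j * ?m l (\<theta> j) \<omega>)"
      using int[OF \<omega>] by simp
    finally show ?thesis .
  qed
  have "complex_of_real (\<integral>\<omega>. (\<Prod>l=1..n. avg l h \<omega>) \<partial>M) = (\<integral>\<omega>. (\<Prod>l=1..n. complex_of_real (avg l h \<omega>)) \<partial>M)"
    by (simp add: integral_complex_of_real[symmetric])
  also have "\<dots> = (\<integral>\<omega>. (\<Sum>f\<in>PiE {1..n} (\<lambda>_. J). (\<Prod>l=1..n. c (f l)) * (\<Prod>l=1..n. ?m l (\<theta> (f l)) \<omega>)) \<partial>M)"
    by (intro Bochner_Integration.integral_cong refl)
      (simp add: avg prod_sum_PiE \<open>finite J\<close> prod.distrib)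
  also have "\<dots> = (\<Sum>f\<in>PiE {1..n} (\<lambda>_. J). (\<integral>\<omega>. (\<Prod>l=1..n. c (f l)) * (\<Prod>l=1..n. ?m l (\<theta> (f l)) \<omega>) \<partial>M))"
  proof (rule Bochner_Integration.integral_sum, rule integrable_mult_right)
    fix f show "integrable M (\<lambda>\<omega>. \<Prod>l=1..n. ?m l (\<theta> (f l)) \<omega>)"
      by (rule integrable_const_bound[where B=1])
        (use m1 mm in \<open>auto simp: prod_norm[symmetric] intro!: AE_I2 prod_le_1\<close>)
  qed
  finally show ?thesis unfolding char_moment_def by simp
qed

end

section \<open>From characteristic moments to exponential tilts\<close>

lemma sum_average_abs_le:
  fixes F G :: "'k \<Rightarrow> real"
  assumes "finite K" "K \<noteq> {}" "\<And>\<kappa>. \<kappa> \<in> K \<Longrightarrow> \<bar>F \<kappa> - G \<kappa>\<bar> \<le> B"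
  shows "\<bar>(\<Sum>\<kappa>\<in>K. F \<kappa>) / real (card K) - (\<Sum>\<kappa>\<in>K. G \<kappa>) / real (card K)\<bar> \<le> B"
proof -
  have "\<bar>(\<Sum>\<kappa>\<in>K. F \<kappa>) - (\<Sum>\<kappa>\<in>K. G \<kappa>)\<bar> \<le> (\<Sum>\<kappa>\<in>K. \<bar>F \<kappa> - G \<kappa>\<bar>)"
    by (simp add: sum_subtractf[symmetric] sum_abs)
  also have "\<dots> \<le> real (card K) * B"
    using sum_bounded_above[of K "\<lambda>\<kappa>. \<bar>F \<kappa> - G \<kappa>\<bar>" B] assms(3) by simp
  finally show ?thesis
    using assms(1,2) by (simp add: diff_divide_distrib[symmetric] abs_divide field_simps card_gt_0_iff)
qed

text \<open>Convergence is assumed for averages over \<open>K k\<close>, because a single choice of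
  sites \<open>\<kappa>\<close> does not lead to a function of the overlaps. Averaging commutes with
  the expansion into characteristic moments, and the approximation errors do not depend on
  \<open>\<kappa>\<close>.\<close>

lemma tilt_limit:
  fixes M :: "'a measure" and M' :: "'d measure" and K :: "nat \<Rightarrow> 'k set"
  assumes K: "\<And>k. finite (K k)" "\<And>k. K k \<noteq> {}"
    and T: "\<And>k \<kappa>. \<kappa> \<in> K k \<Longrightarrow> gaussian_tilt M (\<nu> k) (X k) (a k \<kappa>) q"
    and T': "gaussian_tilt M' \<nu>' X' a' q"
    and conv: "\<And>n \<theta>. (\<lambda>k. (\<Sum>\<kappa>\<in>K k. gaussian_tilt.char_moment M (\<nu> k) (X k) (a k \<kappa>) n \<theta>) / of_nat (card (K k)))
      \<longlonglongrightarrow> gaussian_tilt.char_moment M' \<nu>' X' a' n \<theta>"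
  shows "(\<lambda>k. (\<Sum>\<kappa>\<in>K k. gaussian_tilt.tilt M (\<nu> k) (X k) (a k \<kappa>) q (\<lambda>x. exp (t * x))) / real (card (K k)))
      \<longlonglongrightarrow> gaussian_tilt.tilt M' \<nu>' X' a' q (\<lambda>x. exp (t * x))"
proof (rule tendsto_uniform_approx)
  fix e :: real assume e: "0 < e"
  let ?N = std_normal_distribution and ?e = "\<lambda>x. exp (t * x)"
  define E where "E = (\<integral>x. exp (- 2 * t * x) \<partial>?N)"
  have E: "0 \<le> E" unfolding E_def by simp
  \<comment> \<open>The first constant makes the contribution \<open>q * (\<eta> * E)\<close> of the
    negative exponential moments at most \<open>e / 3\<close>. Adding \<open>1\<close> keeps the
    denominators positive.\<close>
  define \<eta> where "\<eta> = e / (3 * (real q + 1) * (E + 1))"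
  have \<eta>: "0 < \<eta>" "real q * (\<eta> * E) \<le> e / 3"
  proof -
    show "0 < \<eta>" using e E by (simp add: \<eta>_def)
    have "real q * (\<eta> * E) \<le> (real q + 1) * (\<eta> * (E + 1))"
      using E \<open>0 < \<eta>\<close> by (intro mult_mono) auto
    also have "\<dots> = e / 3"
    proof -
      have "x * (e / (3 * x * y) * y) = e / 3" if "0 < x" "0 < y" for x y :: real
        using that by simp
      from this[of "real q + 1" "E + 1"] show ?thesis unfolding \<eta>_def using E by linarith
    qed
    finally show "real q * (\<eta> * E) \<le> e / 3" .
  qed
  \<comment> \<open>With \<open>\<eta>\<close> fixed, the mean square error of \<open>h\<close> can
    be made small against it, so that \<open>q * (\<epsilon> / \<eta>) \<le> e / 3\<close>.\<close>
  define \<epsilon> where "\<epsilon> = e * \<eta> / (3 * (real q + 1))"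
  have \<epsilon>: "0 < \<epsilon>" using e \<eta> by (simp add: \<epsilon>_def)
  have \<epsilon>': "real q * (\<epsilon> / \<eta>) \<le> e / 3"
  proof -
    have "real q * (\<epsilon> / \<eta>) \<le> (real q + 1) * (\<epsilon> / \<eta>)"
      using \<epsilon> \<eta> by (intro mult_right_mono) auto
    also have "\<dots> = e / 3"
    proof -
      have "x * (e * \<eta> / (3 * x) / \<eta>) = e / 3" if "0 < x" for x :: real
        using that \<eta> by simp
      from this[of "real q + 1"] show ?thesis unfolding \<epsilon>_def by linarith
    qed
    finally show ?thesis .
  qed
  obtain h c C where h: "trig_poly h" "h \<in> borel_measurable borel" and c: "0 < c" "\<And>x. c \<le> h x" "\<And>x. h x \<le> C"
    and i: "integrable ?N (\<lambda>x. (h x - exp (t * x))\<^sup>2)" "(\<integral>x. (h x - exp (t * x))\<^sup>2 \<partial>?N) < \<epsilon>"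
    by (rule trig_poly_approx_exp[OF \<epsilon>]) (rule that)
  have C: "0 < C" using c(1) c(2)[of 0] c(3)[of 0] by linarith
  \<comment> \<open>The bound \<open>C\<close> comes with \<open>h\<close>, so the precision for the
    inverse power is chosen last; it accounts for the remaining \<open>e / 3\<close>.\<close>
  define \<delta> where "\<delta> = e / (3 * C ^ q)"
  have \<delta>: "0 < \<delta>" "C ^ q * \<delta> \<le> e / 3" using e C by (auto simp: \<delta>_def)
  obtain b m where b: "\<And>z. z \<in> {c..C} \<Longrightarrow> \<bar>(\<Sum>i\<le>m. b i * z ^ i) - 1 / z ^ q\<bar> < \<delta>"
    by (rule inverse_power_poly_approx[OF c(1) \<delta>(1)]) (rule that)
  obtain J :: "(nat \<times> nat) set" and d \<theta> where J: "finite J" "\<And>x. complex_of_real (h x) = (\<Sum>j\<in>J. d j * iexp (\<theta> j * x))"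
    using h(1) unfolding trig_poly_def by blast
  \<comment> \<open>Valid on any spaces, so that the finite systems and the limit share one
    estimate.\<close>
  have approx: "\<bar>gaussian_tilt.tilt \<Omega> \<nu> X a q ?e -
      (\<Sum>i\<le>m. b i * (\<integral>\<omega>. (\<Prod>l=1..q + i. gaussian_tilt.avg \<nu> X a l h \<omega>) \<partial>\<Omega>))\<bar> \<le> e"
    if "gaussian_tilt \<Omega> \<nu> X a q" for \<Omega> :: "'x measure" and \<nu> :: "'x \<Rightarrow> 'y measure" and X a
  proof -
    interpret gaussian_tilt \<Omega> \<nu> X a q by fact
    have "\<bar>tilt h - tilt ?e\<bar> \<le> real q * ((\<integral>x. (h x - exp (t * x))\<^sup>2 \<partial>?N) / \<eta> + \<eta> * E)"
      unfolding E_def by (rule tilt_diff_exp[OF h(2) c i(1) \<eta>(1)])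
    also have "\<dots> \<le> real q * (\<epsilon> / \<eta> + \<eta> * E)"
      using i(2) \<eta>(1) by (intro mult_left_mono add_right_mono divide_right_mono) auto
    also have "\<dots> \<le> e / 3 + e / 3" using \<epsilon>' \<eta>(2) by (simp add: distrib_left)
    finally show ?thesis using tilt_moment_approx[OF h(2) c b] \<delta>(2) by linarith
  qed
  let ?mom = "\<lambda>i k \<kappa>. \<integral>\<omega>. (\<Prod>l=1..q + i. gaussian_tilt.avg (\<nu> k) (X k) (a k \<kappa>) l h \<omega>) \<partial>M"
  let ?mom' = "\<lambda>i. \<integral>\<omega>. (\<Prod>l=1..q + i. gaussian_tilt.avg \<nu>' X' a' l h \<omega>) \<partial>M'"
  have mom: "(\<lambda>k. (\<Sum>\<kappa>\<in>K k. ?mom i k \<kappa>) / real (card (K k))) \<longlonglongrightarrow> ?mom' i" for i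
  proof -
    let ?F = "PiE {1..q + i} (\<lambda>_. J)"
    have "(\<lambda>k. \<Sum>f\<in>?F. (\<Prod>l=1..q + i. d (f l)) *
        ((\<Sum>\<kappa>\<in>K k. gaussian_tilt.char_moment M (\<nu> k) (X k) (a k \<kappa>) (q + i) (\<lambda>l. \<theta> (f l))) / of_nat (card (K k))))
      \<longlonglongrightarrow> (\<Sum>f\<in>?F. (\<Prod>l=1..q + i. d (f l)) * gaussian_tilt.char_moment M' \<nu>' X' a' (q + i) (\<lambda>l. \<theta> (f l)))"
      by (intro tendsto_sum tendsto_mult tendsto_const conv)
    also have "(\<Sum>f\<in>?F. (\<Prod>l=1..q + i. d (f l)) * gaussian_tilt.char_moment M' \<nu>' X' a' (q + i) (\<lambda>l. \<theta> (f l))) =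
      complex_of_real (?mom' i)"
      by (rule gaussian_tilt.avg_trig_expand[OF T' J(2,1), symmetric])
    also have "(\<lambda>k. \<Sum>f\<in>?F. (\<Prod>l=1..q + i. d (f l)) *
        ((\<Sum>\<kappa>\<in>K k. gaussian_tilt.char_moment M (\<nu> k) (X k) (a k \<kappa>) (q + i) (\<lambda>l. \<theta> (f l))) / of_nat (card (K k)))) =
      (\<lambda>k. complex_of_real ((\<Sum>\<kappa>\<in>K k. ?mom i k \<kappa>) / real (card (K k))))"
    proof
      fix k
      have "complex_of_real (\<Sum>\<kappa>\<in>K k. ?mom i k \<kappa>) = (\<Sum>\<kappa>\<in>K k. \<Sum>f\<in>?F. (\<Prod>l=1..q + i. d (f l)) *
        gaussian_tilt.char_moment M (\<nu> k) (X k) (a k \<kappa>) (q + i) (\<lambda>l. \<theta> (f l)))"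
        unfolding of_real_sum by (intro sum.cong refl gaussian_tilt.avg_trig_expand[OF T J(2,1)])
      also have "\<dots> = (\<Sum>f\<in>?F. (\<Prod>l=1..q + i. d (f l)) *
        (\<Sum>\<kappa>\<in>K k. gaussian_tilt.char_moment M (\<nu> k) (X k) (a k \<kappa>) (q + i) (\<lambda>l. \<theta> (f l))))"
        unfolding sum_distrib_left by (rule sum.swap)
      finally show "(\<Sum>f\<in>?F. (\<Prod>l=1..q + i. d (f l)) *
        ((\<Sum>\<kappa>\<in>K k. gaussian_tilt.char_moment M (\<nu> k) (X k) (a k \<kappa>) (q + i) (\<lambda>l. \<theta> (f l))) / of_nat (card (K k)))) =
        complex_of_real ((\<Sum>\<kappa>\<in>K k. ?mom i k \<kappa>) / real (card (K k)))"
        by (simp only: times_divide_eq_right sum_divide_distrib[symmetric] of_real_divide of_real_of_nat_eq)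
    qed
    finally show ?thesis by (simp only: tendsto_of_real_iff)
  qed
  let ?y = "\<lambda>k. (\<Sum>\<kappa>\<in>K k. \<Sum>i\<le>m. b i * ?mom i k \<kappa>) / real (card (K k))"
  have "(\<lambda>k. \<Sum>i\<le>m. b i * ((\<Sum>\<kappa>\<in>K k. ?mom i k \<kappa>) / real (card (K k)))) \<longlonglongrightarrow> (\<Sum>i\<le>m. b i * ?mom' i)"
    by (intro tendsto_sum tendsto_mult tendsto_const mom)
  also have "(\<lambda>k. \<Sum>i\<le>m. b i * ((\<Sum>\<kappa>\<in>K k. ?mom i k \<kappa>) / real (card (K k)))) = ?y"
    by (rule ext, subst sum.swap) (simp add: sum_distrib_left sum_divide_distrib)
  finally have y: "?y \<longlonglongrightarrow> (\<Sum>i\<le>m. b i * ?mom' i)" .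
  have "\<bar>(\<Sum>\<kappa>\<in>K k. gaussian_tilt.tilt M (\<nu> k) (X k) (a k \<kappa>) q ?e) / real (card (K k)) - ?y k\<bar> \<le> e" for k
    by (intro sum_average_abs_le K approx T)
  then show "\<exists>y y'. y \<longlonglongrightarrow> y' \<and>
      (\<forall>k. \<bar>(\<Sum>\<kappa>\<in>K k. gaussian_tilt.tilt M (\<nu> k) (X k) (a k \<kappa>) q ?e) / real (card (K k)) - y k\<bar> \<le> e) \<and>
      \<bar>gaussian_tilt.tilt M' \<nu>' X' a' q ?e - y'\<bar> \<le> e"
    using y approx[OF T'] by blast
qed

lemma measurable_component_compose:
  assumes "i \<in> I" "g \<in> M i \<rightarrow>\<^sub>M L"
  shows "(\<lambda>x. g (x i)) \<in> PiM I M \<rightarrow>\<^sub>M L"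
  by (rule measurable_compose[where f="\<lambda>x. x i" and N="M i"]) (use assms in auto)

section \<open>Gibbs averages\<close>

definition gibbs_weight :: "nat \<Rightarrow> (config \<Rightarrow> real) \<Rightarrow> config \<Rightarrow> real" where
  "gibbs_weight N H \<sigma> = exp (- H \<sigma>) / (\<Sum>\<tau>\<in>configs N. exp (- H \<tau>))"

lemma finite_configs: "finite (configs N)"
  unfolding configs_def by (intro finite_PiE) auto

lemma configs_nonempty: "configs N \<noteq> {}"
  unfolding configs_def by (simp add: PiE_eq_empty_iff)

lemma partition_pos: "0 < (\<Sum>\<tau>\<in>configs N. exp (- H \<tau>))" for H :: "config \<Rightarrow> real"
  by (intro sum_pos finite_configs configs_nonempty) simp

lemma gibbs_weight_nonneg: "0 \<le> gibbs_weight N H \<sigma>"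
  unfolding gibbs_weight_def using partition_pos[of H N] by (intro divide_nonneg_pos) auto

lemma sum_gibbs_weight: "(\<Sum>\<sigma>\<in>configs N. gibbs_weight N H \<sigma>) = 1"
  unfolding gibbs_weight_def using partition_pos[of H N] by (simp add: sum_divide_distrib[symmetric])

lemma gibbs_weight_le_1: "\<sigma> \<in> configs N \<Longrightarrow> gibbs_weight N H \<sigma> \<le> 1"
  using member_le_sum[of \<sigma> "configs N" "gibbs_weight N H"] finite_configs
  by (simp add: sum_gibbs_weight gibbs_weight_nonneg)

lemma gibbs_measure_eq: "gibbs_measure N H = point_measure (configs N) (\<lambda>\<sigma>. ennreal (gibbs_weight N H \<sigma>))"
  unfolding gibbs_measure_def gibbs_weight_def ..

lemma space_gibbs_measure[simp]: "space (gibbs_measure N H) = configs N"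
  and sets_gibbs_measure[simp]: "sets (gibbs_measure N H) = Pow (configs N)"
  unfolding gibbs_measure_def by (simp_all add: space_point_measure sets_point_measure)

lemma measurable_gibbs_measure[simp]: "measurable (gibbs_measure N H) A = (configs N \<rightarrow> space A)"
  by (auto simp: measurable_def)

lemma prob_space_gibbs_measure: "prob_space (gibbs_measure N H)"
  unfolding gibbs_measure_eq
  by (intro prob_space_point_measure finite_configs) (simp_all add: sum_gibbs_weight gibbs_weight_nonneg)

lemma integral_gibbs_measure:
  fixes f :: "config \<Rightarrow> 'b::{banach, second_countable_topology}"
  shows "(\<integral>\<sigma>. f \<sigma> \<partial>gibbs_measure N H) = (\<Sum>\<sigma>\<in>configs N. gibbs_weight N H \<sigma> *\<^sub>R f \<sigma>)"
  unfolding gibbs_measure_eq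
  by (rule lebesgue_integral_point_measure_finite[OF finite_configs]) (rule gibbs_weight_nonneg)

lemma integrable_gibbs_measure:
  fixes f :: "config \<Rightarrow> 'b::{banach, second_countable_topology}"
  shows "integrable (gibbs_measure N H) f"
  unfolding gibbs_measure_eq by (rule integrable_point_measure_finite[OF finite_configs])

lemma nn_integral_gibbs_measure:
  "(\<integral>\<^sup>+\<sigma>. f \<sigma> \<partial>gibbs_measure N H) = (\<Sum>\<sigma>\<in>configs N. ennreal (gibbs_weight N H \<sigma>) * f \<sigma>)"
  unfolding gibbs_measure_eq
  by (rule nn_integral_point_measure_finite[OF finite_configs])

lemma product_prob_space_gibbs: "product_prob_space (\<lambda>_. gibbs_measure N H)"
  by (intro product_prob_spaceI prob_space_gibbs_measure)

lemma finite_tuples: "finite J \<Longrightarrow> finite (J \<rightarrow>\<^sub>E configs N)"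
  by (intro finite_PiE finite_configs)

lemma sum_prod_gibbs_weight:
  assumes "finite J"
  shows "(\<Sum>\<tau>\<in>J \<rightarrow>\<^sub>E configs N. \<Prod>l\<in>J. gibbs_weight N H (\<tau> l)) = 1"
proof -
  have "(\<Sum>\<tau>\<in>J \<rightarrow>\<^sub>E configs N. \<Prod>l\<in>J. gibbs_weight N H (\<tau> l)) =
    (\<Prod>l\<in>J. \<Sum>\<sigma>\<in>configs N. gibbs_weight N H \<sigma>)"
    by (rule prod_sum_PiE[symmetric]) (auto simp: assms finite_configs)
  then show ?thesis by (simp add: sum_gibbs_weight)
qed

text \<open>A product of coordinate indicators singles out one tuple, so a function of finitely many
  replicas is a sum of products, to which a product measure applies factor by factor.\<close>

lemma tuple_function_expand:
  fixes f :: "(nat \<Rightarrow> config) \<Rightarrow> real"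
  assumes J: "finite J" and \<tau>: "\<tau> \<in> J \<rightarrow>\<^sub>E configs N"
  shows "f \<tau> = (\<Sum>\<tau>'\<in>J \<rightarrow>\<^sub>E configs N. f \<tau>' * (\<Prod>l\<in>J. indicator {\<tau>' l} (\<tau> l)))"
proof -
  have "(\<Prod>l\<in>J. indicator {\<tau>' l} (\<tau> l)) = (if \<tau>' = \<tau> then 1 else 0 :: real)" if \<tau>': "\<tau>' \<in> J \<rightarrow>\<^sub>E configs N" for \<tau>'
  proof (cases "\<tau>' = \<tau>")
    case False
    then obtain l where "l \<in> J" "\<tau>' l \<noteq> \<tau> l" using PiE_ext[OF \<tau>' \<tau>] by blast
    then have "(\<Prod>l\<in>J. indicator {\<tau>' l} (\<tau> l)) = (0::real)"
      using J by (intro prod_zero bexI[of _ l]) auto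
    then show ?thesis using False by simp
  qed simp
  then have "(\<Sum>\<tau>'\<in>J \<rightarrow>\<^sub>E configs N. f \<tau>' * (\<Prod>l\<in>J. indicator {\<tau>' l} (\<tau> l))) =
    (\<Sum>\<tau>'\<in>J \<rightarrow>\<^sub>E configs N. if \<tau>' = \<tau> then f \<tau>' else 0)"
    by (intro sum.cong refl) simp
  also have "\<dots> = f \<tau>" using \<tau> finite_tuples[OF J] by simp
  finally show ?thesis ..
qed

text \<open>Only the marginal of \<open>replica_measure\<close> on \<open>J\<close> matters. It
  lives on finitely many tuples, so \<open>f\<close> can be expanded in indicators and its average
  is a finite sum.\<close>

lemma gibbs_average_finite:
  fixes f :: "(nat \<Rightarrow> config) \<Rightarrow> real"
  assumes J: "finite J" "J \<subseteq> {1..}" and f: "\<And>s. f (restrict s J) = f s"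
  shows "gibbs_average N H f =
      (\<Sum>\<tau>\<in>J \<rightarrow>\<^sub>E configs N. (\<Prod>l\<in>J. gibbs_weight N H (\<tau> l)) * f \<tau>)"
proof -
  interpret product_prob_space "\<lambda>_::nat. gibbs_measure N H" "{1..}"
    by (rule product_prob_space_gibbs)
  let ?G = "\<lambda>_::nat. gibbs_measure N H"
  let ?g = "\<lambda>s. \<Sum>\<tau>\<in>J \<rightarrow>\<^sub>E configs N. f \<tau> * (\<Prod>l\<in>J. indicator {\<tau> l} (s l))"
  have eq: "f s = ?g s" if "restrict s J \<in> J \<rightarrow>\<^sub>E configs N" for s
  proof -
    have "f (restrict s J) = (\<Sum>\<tau>\<in>J \<rightarrow>\<^sub>E configs N. f \<tau> * (\<Prod>l\<in>J. indicator {\<tau> l} (restrict s J l)))"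
      by (rule tuple_function_expand[OF J(1) that])
    then show ?thesis by (simp add: f)
  qed
  have int: "(\<integral>s. (\<Prod>l\<in>J. indicator {\<tau> l} (s l)) \<partial>PiM J ?G) = (\<Prod>l\<in>J. gibbs_weight N H (\<tau> l))"
    if "\<tau> \<in> J \<rightarrow>\<^sub>E configs N" for \<tau>
  proof -
    have "(\<integral>s. (\<Prod>l\<in>J. indicator {\<tau> l} (s l)) \<partial>PiM J ?G) =
      (\<Prod>l\<in>J. (\<integral>\<sigma>. indicator {\<tau> l} \<sigma> \<partial>gibbs_measure N H) :: real)"
      by (rule product_integral_prod[OF J(1) integrable_gibbs_measure])
    also have "\<dots> = (\<Prod>l\<in>J. gibbs_weight N H (\<tau> l))"
    proof (intro prod.cong refl)
      fix l assume "l \<in> J"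
      then have "\<tau> l \<in> configs N" using that by auto
      then show "(\<integral>\<sigma>. indicator {\<tau> l} \<sigma> \<partial>gibbs_measure N H) = gibbs_weight N H (\<tau> l)"
        unfolding integral_gibbs_measure by (simp add: indicator_def if_distrib[of "\<lambda>x. _ * x"] finite_configs cong: if_cong)
    qed
    finally show ?thesis .
  qed
  interpret PJ: prob_space "PiM J ?G" by (rule prob_space_PiM) (rule prob_space_gibbs_measure)
  have intg: "integrable (PiM J ?G) (\<lambda>s. (\<Prod>l\<in>J. indicator {\<tau> l} (s l)) :: real)" for \<tau>
    using J(1) by (intro product_integrable_prod) (auto intro: integrable_gibbs_measure)
  have "gibbs_average N H f = (\<integral>s. f (restrict s J) \<partial>PiM {1..} ?G)"
    unfolding gibbs_average_def replica_measure_def by (simp add: f)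
  also have "\<dots> = (\<integral>s. ?g (restrict s J) \<partial>PiM {1..} ?G)"
    by (intro Bochner_Integration.integral_cong refl eq) (use J in \<open>auto simp: space_PiM\<close>)
  also have "\<dots> = (\<integral>s. ?g s \<partial>distr (PiM {1..} ?G) (PiM J ?G) (\<lambda>s. restrict s J))"
  proof (rule integral_distr[symmetric])
    show "?g \<in> borel_measurable (PiM J ?G)"
      by (intro borel_measurable_sum borel_measurable_times borel_measurable_const borel_measurable_integrable[OF intg])
    show "(\<lambda>s. restrict s J) \<in> PiM {1..} ?G \<rightarrow>\<^sub>M PiM J ?G"
      using J(2) by (rule measurable_restrict_subset)
  qed
  also have "\<dots> = (\<integral>s. ?g s \<partial>PiM J ?G)"
    by (simp only: distr_PiM_restrict_finite[OF J])
  also have "\<dots> = (\<Sum>\<tau>\<in>J \<rightarrow>\<^sub>E configs N. f \<tau> * (\<Prod>l\<in>J. gibbs_weight N H (\<tau> l)))"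
    using intg int by simp
  finally show "gibbs_average N H f = (\<Sum>\<tau>\<in>J \<rightarrow>\<^sub>E configs N. (\<Prod>l\<in>J. gibbs_weight N H (\<tau> l)) * f \<tau>)"
    by (simp add: mult.commute)
qed

section \<open>The annealed law of finitely many replicas\<close>

definition replica_weight :: "'a measure \<Rightarrow> nat \<Rightarrow> ('a \<Rightarrow> config \<Rightarrow> real) \<Rightarrow> nat set \<Rightarrow> (nat \<Rightarrow> config) \<Rightarrow> real" where
  "replica_weight M N H J \<tau> = (\<integral>\<omega>. (\<Prod>l\<in>J. gibbs_weight N (H \<omega>) (\<tau> l)) \<partial>M)"

lemma gibbs_weight_measurable[measurable (raw)]:
  assumes "\<And>\<sigma>. (\<lambda>\<omega>. H \<omega> \<sigma>) \<in> borel_measurable M"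
  shows "(\<lambda>\<omega>. gibbs_weight N (H \<omega>) \<sigma>) \<in> borel_measurable M"
  unfolding gibbs_weight_def using assms by measurable

lemma tuple_weight_bounds:
  assumes "\<tau> \<in> J \<rightarrow>\<^sub>E configs N"
  shows "0 \<le> (\<Prod>l\<in>J. gibbs_weight N H (\<tau> l))" "(\<Prod>l\<in>J. gibbs_weight N H (\<tau> l)) \<le> 1"
  using assms by (auto intro!: prod_nonneg prod_le_1 gibbs_weight_nonneg gibbs_weight_le_1)

context prob_space
begin

lemma tuple_weight_integrable:
  assumes [measurable]: "\<And>\<sigma>. (\<lambda>\<omega>. H \<omega> \<sigma>) \<in> borel_measurable M" and "\<tau> \<in> J \<rightarrow>\<^sub>E configs N"
  shows "integrable M (\<lambda>\<omega>. \<Prod>l\<in>J. gibbs_weight N (H \<omega>) (\<tau> l))"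
  by (rule integrable_const_bound[where B=1]) (use tuple_weight_bounds[OF assms(2)] in auto)

lemma replica_weight_nonneg: "\<tau> \<in> J \<rightarrow>\<^sub>E configs N \<Longrightarrow> 0 \<le> replica_weight M N H J \<tau>"
  unfolding replica_weight_def by (intro Bochner_Integration.integral_nonneg tuple_weight_bounds)

lemma sum_replica_weight:
  assumes "\<And>\<sigma>. (\<lambda>\<omega>. H \<omega> \<sigma>) \<in> borel_measurable M" "finite J"
  shows "(\<Sum>\<tau>\<in>J \<rightarrow>\<^sub>E configs N. replica_weight M N H J \<tau>) = 1"
proof -
  have "(\<Sum>\<tau>\<in>J \<rightarrow>\<^sub>E configs N. replica_weight M N H J \<tau>) =
    (\<integral>\<omega>. (\<Sum>\<tau>\<in>J \<rightarrow>\<^sub>E configs N. \<Prod>l\<in>J. gibbs_weight N (H \<omega>) (\<tau> l)) \<partial>M)"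
    unfolding replica_weight_def
    by (rule Bochner_Integration.integral_sum[symmetric]) (rule tuple_weight_integrable[OF assms(1)])
  then show ?thesis by (simp add: sum_prod_gibbs_weight[OF assms(2)] prob_space)
qed

text \<open>A point measure on finitely many tuples, so that every function of the replicas is
  measurable and its integral is a finite sum.\<close>

definition replica_space :: "nat \<Rightarrow> ('a \<Rightarrow> config \<Rightarrow> real) \<Rightarrow> nat set \<Rightarrow> (nat \<Rightarrow> config) measure" where
  "replica_space N H J = point_measure (J \<rightarrow>\<^sub>E configs N) (replica_weight M N H J)"

lemma prob_space_replica_space:
  assumes "\<And>\<sigma>. (\<lambda>\<omega>. H \<omega> \<sigma>) \<in> borel_measurable M" "finite J"
  shows "prob_space (replica_space N H J)"
  unfolding replica_space_def
  using sum_replica_weight[OF assms]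
  by (intro prob_space_point_measure finite_tuples assms) (simp_all add: sum_ennreal replica_weight_nonneg)

lemma integral_replica_space:
  fixes f :: "_ \<Rightarrow> 'b::{banach, second_countable_topology}"
  assumes "finite J"
  shows "(\<integral>\<tau>. f \<tau> \<partial>replica_space N H J) = (\<Sum>\<tau>\<in>J \<rightarrow>\<^sub>E configs N. replica_weight M N H J \<tau> *\<^sub>R f \<tau>)"
  unfolding replica_space_def
  by (intro lebesgue_integral_point_measure_finite finite_tuples assms replica_weight_nonneg)

lemma annealed_average_finite:
  assumes H: "\<And>\<sigma>. (\<lambda>\<omega>. H \<omega> \<sigma>) \<in> borel_measurable M"
    and J: "finite J" "J \<subseteq> {1..}" and f: "\<And>s. f (restrict s J) = f s"
  shows "annealed_average M N H f = (\<integral>\<tau>. f \<tau> \<partial>replica_space N H J)"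
proof -
  have "annealed_average M N H f =
    (\<Sum>\<tau>\<in>J \<rightarrow>\<^sub>E configs N. (\<integral>\<omega>. (\<Prod>l\<in>J. gibbs_weight N (H \<omega>) (\<tau> l)) * f \<tau> \<partial>M))"
    unfolding annealed_average_def gibbs_average_finite[where f=f, OF J f]
    by (intro Bochner_Integration.integral_sum integrable_mult_left tuple_weight_integrable[OF H])
  then show ?thesis unfolding integral_replica_space[OF J(1)] by (simp add: replica_weight_def)
qed

end

section \<open>The law of the spins\<close>

text \<open>\<open>spin_law\<close> is a \<open>bind\<close>, whose integrals are computed through a
  measurable kernel. Cylinders generate the product, and the probability of a cylinder is a product
  of finite sums of Gibbs weights.\<close>

lemma replica_kernel_measurable:
  assumes [measurable]: "\<And>\<sigma>. (\<lambda>\<omega>. H \<omega> \<sigma>) \<in> borel_measurable M"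
  shows "(\<lambda>\<omega>. replica_measure N (H \<omega>)) \<in> M \<rightarrow>\<^sub>M subprob_algebra (PiM {1..} (\<lambda>_. count_space (configs N)))"
proof -
  let ?C = "\<lambda>_::nat. count_space (configs N)"
  let ?\<Omega> = "\<Pi>\<^sub>E i\<in>{1::nat..}. space (?C i)"
  have ps: "prob_space (replica_measure N H)" for H
    unfolding replica_measure_def by (rule prob_space_PiM) (rule prob_space_gibbs_measure)
  show ?thesis
  proof (rule measurable_subprob_algebra_generated[OF sets_PiM Int_stable_prod_algebra prod_algebra_sets_into_space])
    show "subprob_space (replica_measure N (H \<omega>))" for \<omega>
      by (rule prob_space_imp_subprob_space[OF ps])
    show "sets (replica_measure N (H \<omega>)) = sets (PiM {1..} ?C)" for \<omega>
      unfolding replica_measure_def by (rule sets_PiM_cong) auto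
    have "space (replica_measure N (H \<omega>)) = ?\<Omega>" for \<omega>
      unfolding replica_measure_def by (simp add: space_PiM)
    then have "emeasure (replica_measure N (H \<omega>)) ?\<Omega> = 1" for \<omega>
      using prob_space.emeasure_space_1[OF ps] by metis
    then show "(\<lambda>\<omega>. emeasure (replica_measure N (H \<omega>)) ?\<Omega>) \<in> borel_measurable M" by simp
  next
    fix A assume "A \<in> prod_algebra {1..} ?C"
    then obtain J E where A: "A = prod_emb {1..} ?C J (Pi\<^sub>E J E)" and J: "finite J" "J \<subseteq> {1..}"
      and E: "\<And>i. i \<in> J \<Longrightarrow> E i \<in> sets (?C i)"
      by (rule prod_algebraE) blast
    have "emeasure (replica_measure N (H \<omega>)) A = (\<Prod>l\<in>J. ennreal (\<Sum>\<sigma>\<in>E l. gibbs_weight N (H \<omega>) \<sigma>))" for \<omega>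
    proof -
      interpret product_prob_space "\<lambda>_::nat. gibbs_measure N (H \<omega>)" "{1..}"
        by (rule product_prob_space_gibbs)
      have "A = prod_emb {1..} (\<lambda>_. gibbs_measure N (H \<omega>)) J (Pi\<^sub>E J E)"
        unfolding A prod_emb_def by simp
      then have "emeasure (replica_measure N (H \<omega>)) A = (\<Prod>l\<in>J. emeasure (gibbs_measure N (H \<omega>)) (E l))"
        unfolding replica_measure_def using emeasure_PiM_emb[OF J(2,1), of E] E by simp
      also have "\<dots> = (\<Prod>l\<in>J. ennreal (\<Sum>\<sigma>\<in>E l. gibbs_weight N (H \<omega>) \<sigma>))"
        using E unfolding gibbs_measure_eq
        by (intro prod.cong refl) (auto simp: emeasure_point_measure_finite finite_configs gibbs_weight_nonneg)
      finally show ?thesis .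
    qed
    then show "(\<lambda>\<omega>. emeasure (replica_measure N (H \<omega>)) A) \<in> borel_measurable M" by simp
  qed
qed

lemma spin_array_measurable: "spin_array N \<in> PiM {1..} (\<lambda>_. count_space (configs N)) \<rightarrow>\<^sub>M array_space"
  unfolding spin_array_def array_space_def
proof (rule measurable_restrict, clarify)
  fix i l :: nat assume "1 \<le> i" "1 \<le> l"
  show "(\<lambda>s. if i \<le> N then s l i else 0) \<in> PiM {1..} (\<lambda>_. count_space (configs N)) \<rightarrow>\<^sub>M count_space {-1, 0, 1}"
  proof (cases "i \<le> N")
    case True
    have "(\<lambda>\<sigma>. \<sigma> i) \<in> count_space (configs N) \<rightarrow>\<^sub>M count_space {-1, 0, 1::real}"
      using True \<open>1 \<le> i\<close> by (auto simp: configs_def)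
    from measurable_component_compose[of l "{1..}" "\<lambda>\<sigma>. \<sigma> i" "\<lambda>_. count_space (configs N)", OF _ this] \<open>1 \<le> l\<close> True
    show ?thesis by simp
  qed simp
qed

lemma array_space_coordinate:
  "x \<in> space array_space \<Longrightarrow> j \<in> array_indices \<Longrightarrow> x j \<in> {-1, 0, 1}"
  unfolding array_space_def space_PiM by (drule PiE_mem) auto

text \<open>Entries take finitely many values, so a product of entries is a combination of cylinder
  indicators. This is how the convergence of cylinder probabilities in \<open>limit_laws\<close>
  reaches moments.\<close>

lemma array_coordinate_prod:
  fixes \<mu> :: "(nat \<times> nat \<Rightarrow> real) measure"
  assumes "prob_space \<mu>" and \<mu>: "sets \<mu> = sets array_space" and D: "finite D" "D \<subseteq> array_indices"
  shows "(\<integral>x. (\<Prod>j\<in>D. x j) \<partial>\<mu>) =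
    (\<Sum>a\<in>D \<rightarrow>\<^sub>E {-1, 0, 1}. (\<Prod>j\<in>D. a j) * measure \<mu> {x \<in> space array_space. \<forall>j\<in>D. x j = a j})"
proof -
  interpret prob_space \<mu> by fact
  have sp: "space \<mu> = space array_space" by (rule sets_eq_imp_space_eq[OF \<mu>])
  let ?cyl = "\<lambda>a. {x \<in> space array_space. \<forall>j\<in>D. x j = a j}"
  have fin: "finite (D \<rightarrow>\<^sub>E {-1, 0, 1::real})" using D by (intro finite_PiE) auto
  have cyl: "?cyl a \<in> sets \<mu>" for a
  proof -
    have "{x \<in> space array_space. x j = a j} \<in> sets array_space" if "j \<in> D" for j
    proof -
      have "(\<lambda>x. x j) \<in> array_space \<rightarrow>\<^sub>M count_space {-1, 0, 1}"
        unfolding array_space_def using that D by (intro measurable_component_singleton) auto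
      from measurable_sets[OF this, of "{a j} \<inter> {-1, 0, 1}"]
      have "(\<lambda>x. x j) -` ({a j} \<inter> {-1, 0, 1}) \<inter> space array_space \<in> sets array_space" by simp
      moreover have "x j \<in> {-1, 0, 1}" if "x \<in> space array_space" for x
        using array_space_coordinate[OF that] \<open>j \<in> D\<close> D(2) by blast
      then have "(\<lambda>x. x j) -` ({a j} \<inter> {-1, 0, 1}) \<inter> space array_space = {x \<in> space array_space. x j = a j}"
        by blast
      ultimately show ?thesis by simp
    qed
    then show ?thesis unfolding \<mu> using D(1) by (intro sets.sets_Collect_finite_All) auto
  qed
  have "(\<integral>x. (\<Prod>j\<in>D. x j) \<partial>\<mu>) = (\<integral>x. (\<Sum>a\<in>D \<rightarrow>\<^sub>E {-1, 0, 1}. (\<Prod>j\<in>D. a j) * indicator (?cyl a) x) \<partial>\<mu>)"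
  proof (rule Bochner_Integration.integral_cong[OF refl])
    fix x assume x: "x \<in> space \<mu>"
    have r: "restrict x D \<in> D \<rightarrow>\<^sub>E {-1, 0, 1}"
      unfolding restrict_PiE_iff using array_space_coordinate[OF x[unfolded sp]] D(2) by blast
    have "indicator (?cyl a) x = (if a = restrict x D then 1 else 0 :: real)" if "a \<in> D \<rightarrow>\<^sub>E {-1, 0, 1}" for a
    proof -
      have "(\<forall>j\<in>D. x j = a j) \<longleftrightarrow> a = restrict x D"
      proof
        assume "\<forall>j\<in>D. x j = a j" then show "a = restrict x D" by (intro PiE_ext[OF that r]) simp
      qed simp
      then show ?thesis using x unfolding sp indicator_def by simp
    qed
    then have "(\<Sum>a\<in>D \<rightarrow>\<^sub>E {-1, 0, 1}. (\<Prod>j\<in>D. a j) * indicator (?cyl a) x) =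
      (\<Sum>a\<in>D \<rightarrow>\<^sub>E {-1, 0, 1}. if a = restrict x D then \<Prod>j\<in>D. a j else 0)"
      by (intro sum.cong refl) (auto simp only: mult_1_right mult_zero_right split: if_split)
    also have "\<dots> = (\<Prod>j\<in>D. x j)" using r fin by simp
    finally show "(\<Prod>j\<in>D. x j) = (\<Sum>a\<in>D \<rightarrow>\<^sub>E {-1, 0, 1}. (\<Prod>j\<in>D. a j) * indicator (?cyl a) x)" ..
  qed
  also have "\<dots> = (\<Sum>a\<in>D \<rightarrow>\<^sub>E {-1, 0, 1}. (\<Prod>j\<in>D. a j) * measure \<mu> (?cyl a))"
  proof -
    have "integrable \<mu> (indicator (?cyl a) :: _ \<Rightarrow> real)" "(\<integral>x. indicator (?cyl a) x \<partial>\<mu>) = measure \<mu> (?cyl a)" for a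
      using cyl[of a] by (simp_all add: emeasure_eq_measure sets.Int_space_eq2)
    then show ?thesis by (subst Bochner_Integration.integral_sum) auto
  qed
  finally show ?thesis .
qed

text \<open>With \<open>D\<close> inside \<open>{1..N} \<times> J\<close> the entries are genuine
  spins and not the zeros that pad the array.\<close>

lemma (in prob_space) spin_law_coordinate_prod:
  assumes H: "\<And>\<sigma>. (\<lambda>\<omega>. H N \<omega> \<sigma>) \<in> borel_measurable M"
    and D: "finite D" "D \<subseteq> {1..N} \<times> J" and J: "finite J" "J \<subseteq> {1..}"
  shows "prob_space (spin_law M H N)" "sets (spin_law M H N) = sets array_space"
    "(\<integral>x. (\<Prod>j\<in>D. x j) \<partial>spin_law M H N) = (\<integral>\<tau>. (\<Prod>(i, l)\<in>D. \<tau> l i) \<partial>replica_space N (H N) J)"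
proof -
  let ?K = "\<lambda>\<omega>. distr (replica_measure N (H N \<omega>)) array_space (spin_array N)"
  have K: "?K \<in> M \<rightarrow>\<^sub>M subprob_algebra array_space"
    by (rule measurable_compose[OF replica_kernel_measurable[OF H] measurable_distr[OF spin_array_measurable]])
  have sets_R: "sets (replica_measure N H) = sets (PiM {1..} (\<lambda>_. count_space (configs N)))" for H
    unfolding replica_measure_def by (rule sets_PiM_cong) auto
  have SA: "spin_array N \<in> replica_measure N H \<rightarrow>\<^sub>M array_space" for H
    using spin_array_measurable by (simp add: measurable_cong_sets[OF sets_R refl])
  have pK: "prob_space (?K \<omega>)" for \<omega>
  proof (rule prob_space.prob_space_distr[OF _ SA])
    show "prob_space (replica_measure N (H N \<omega>))"
      unfolding replica_measure_def by (rule prob_space_PiM) (rule prob_space_gibbs_measure)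
  qed
  show sets: "sets (spin_law M H N) = sets array_space"
    unfolding spin_law_def using not_empty by (intro sets_bind) auto
  show "prob_space (spin_law M H N)"
    unfolding spin_law_def by (rule prob_space_bind[OF _ K]) (use pK in auto)
  have Dm: "(\<lambda>x. \<Prod>j\<in>D. x j) \<in> borel_measurable array_space"
  proof (rule borel_measurable_prod)
    fix j assume "j \<in> D"
    then have "(\<lambda>x. x j) \<in> array_space \<rightarrow>\<^sub>M count_space {-1, 0, 1}"
      unfolding array_space_def using D J by (intro measurable_component_singleton) auto
    from measurable_compose[OF this, of "\<lambda>x. x" borel] show "(\<lambda>x. x j) \<in> borel_measurable array_space" by simp
  qed
  have Db: "\<bar>\<Prod>j\<in>D. x j\<bar> \<le> 1" if "x \<in> space array_space" for x
  proof -
    have "\<bar>x j\<bar> \<le> 1" if "j \<in> D" for j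
    proof -
      have "j \<in> array_indices" using that D(2) J(2) by auto
      then have "x j \<in> {-1, 0, 1}" using array_space_coordinate \<open>x \<in> space array_space\<close> by blast
      then show ?thesis by auto
    qed
    then show ?thesis unfolding abs_prod by (intro prod_le_1) auto
  qed
  have "(\<integral>x. (\<Prod>j\<in>D. x j) \<partial>spin_law M H N) = (\<integral>\<omega>. (\<integral>x. (\<Prod>j\<in>D. x j) \<partial>?K \<omega>) \<partial>M)"
    unfolding spin_law_def
  proof (rule integral_bind[OF Dm Db K finite_measure_axioms, where B'=1])
    show "AE \<omega> in M. emeasure (?K \<omega>) (space (?K \<omega>)) \<le> ennreal 1"
      unfolding prob_space.emeasure_space_1[OF pK] by simp
  qed
  also have "\<dots> = (\<integral>\<omega>. gibbs_average N (H N \<omega>) (\<lambda>s. \<Prod>(i, l)\<in>D. s l i) \<partial>M)"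
  proof (rule Bochner_Integration.integral_cong[OF refl])
    fix \<omega>
    have "(\<integral>x. (\<Prod>j\<in>D. x j) \<partial>?K \<omega>) = (\<integral>s. (\<Prod>j\<in>D. spin_array N s j) \<partial>replica_measure N (H N \<omega>))"
      by (rule integral_distr[OF SA Dm])
    also have "\<dots> = gibbs_average N (H N \<omega>) (\<lambda>s. \<Prod>(i, l)\<in>D. s l i)"
      unfolding gibbs_average_def
      by (intro Bochner_Integration.integral_cong refl prod.cong) (use D J in \<open>auto simp: spin_array_def\<close>)
    finally show "(\<integral>x. (\<Prod>j\<in>D. x j) \<partial>?K \<omega>) = gibbs_average N (H N \<omega>) (\<lambda>s. \<Prod>(i, l)\<in>D. s l i)" .
  qed
  also have "\<dots> = (\<integral>\<tau>. (\<Prod>(i, l)\<in>D. \<tau> l i) \<partial>replica_space N (H N) J)"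
    unfolding annealed_average_def[symmetric]
    by (rule annealed_average_finite[OF H J]) (use D in \<open>auto intro!: prod.cong\<close>)
  finally show "(\<integral>x. (\<Prod>j\<in>D. x j) \<partial>spin_law M H N) = (\<integral>\<tau>. (\<Prod>(i, l)\<in>D. \<tau> l i) \<partial>replica_space N (H N) J)" .
qed

section \<open>The Hamiltonian as a function of the disorder\<close>

lemma pspin_hamiltonian_measurable:
  assumes "1 \<le> p" "\<And>L. L \<in> coeff_indices \<Longrightarrow> g L \<in> borel_measurable M"
  shows "(\<lambda>\<omega>. pspin_hamiltonian g N p \<omega> \<sigma>) \<in> borel_measurable M"
  unfolding pspin_hamiltonian_def
proof (intro borel_measurable_uminus borel_measurable_times borel_measurable_const borel_measurable_sum)
  fix L assume "L \<in> {L. length L = p \<and> set L \<subseteq> {1..N}}"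
  then have "L \<in> coeff_indices" using assms(1) by (auto simp: coeff_indices_def)
  then show "g L \<in> borel_measurable M" by (rule assms(2))
qed

lemma mixed_hamiltonian_measurable:
  assumes "P \<subseteq> {1..}" "\<And>L. L \<in> coeff_indices \<Longrightarrow> g L \<in> borel_measurable M"
  shows "(\<lambda>\<omega>. mixed_hamiltonian P b g N \<omega> \<sigma>) \<in> borel_measurable M"
  unfolding mixed_hamiltonian_def
proof (rule borel_measurable_suminf)
  fix p show "(\<lambda>\<omega>. if p \<in> P then b p * pspin_hamiltonian g N p \<omega> \<sigma> else 0) \<in> borel_measurable M"
    using assms pspin_hamiltonian_measurable[of p g M N \<sigma>] by (cases "p \<in> P") auto
qed

lemma model_degrees_ge_1: "model_degrees \<subseteq> {1..}"
  by (auto simp: model_degrees_def)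

lemma perturbed_hamiltonian_measurable:
  assumes "\<And>L. L \<in> coeff_indices \<Longrightarrow> g L \<in> borel_measurable M" "\<And>L. L \<in> coeff_indices \<Longrightarrow> g' L \<in> borel_measurable M"
  shows "(\<lambda>\<omega>. perturbed_hamiltonian \<beta> \<delta> \<beta>' g g' N \<omega> \<sigma>) \<in> borel_measurable M"
  unfolding perturbed_hamiltonian_def
  by (intro borel_measurable_add borel_measurable_times borel_measurable_const
      mixed_hamiltonian_measurable model_degrees_ge_1 order_refl assms)

text \<open>Degrees in \<open>P\<close> are at least \<open>1\<close>, so the sums visit only
  nonempty lists of positive sites, which belong to \<open>coeff_indices\<close>.\<close>

lemma mixed_hamiltonian_cong:
  assumes "P \<subseteq> {1..}" "\<And>L. L \<in> coeff_indices \<Longrightarrow> g L \<omega> = h L y"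
  shows "mixed_hamiltonian P b g N \<omega> \<sigma> = mixed_hamiltonian P b h N y \<sigma>"
  unfolding mixed_hamiltonian_def
proof (intro suminf_cong if_cong refl arg_cong2[where f="(*)"])
  fix p assume "p \<in> P"
  then have "1 \<le> p" using assms by auto
  then show "pspin_hamiltonian g N p \<omega> \<sigma> = pspin_hamiltonian h N p y \<sigma>"
    unfolding pspin_hamiltonian_def
    by (intro arg_cong[where f=uminus] arg_cong2[where f="(*)"] refl sum.cong assms(2))
      (auto simp: coeff_indices_def)
qed

lemma perturbed_hamiltonian_cong:
  assumes "\<And>L. L \<in> coeff_indices \<Longrightarrow> g L \<omega> = h L y" "\<And>L. L \<in> coeff_indices \<Longrightarrow> g' L \<omega> = h' L y"
  shows "perturbed_hamiltonian \<beta> \<delta> \<beta>' g g' N \<omega> \<sigma> = perturbed_hamiltonian \<beta> \<delta> \<beta>' h h' N y \<sigma>"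
  unfolding perturbed_hamiltonian_def
  by (intro arg_cong2[where f="(+)"] arg_cong2[where f="(*)"] refl mixed_hamiltonian_cong
      model_degrees_ge_1 order_refl assms)

text \<open>Substituting \<open>map \<pi> L\<close> for the summation index moves the permutation
  from the spins to the coefficients, where it appears inverted.\<close>

lemma pspin_hamiltonian_permute:
  assumes "\<pi> permutes {1..N}"
  shows "pspin_hamiltonian g N p \<omega> (\<sigma> \<circ> \<pi>) = pspin_hamiltonian (\<lambda>L. g (map (inv \<pi>) L)) N p \<omega> \<sigma>"
proof -
  have "(\<Sum>L | length L = p \<and> set L \<subseteq> {1..N}. g L \<omega> * (\<Prod>i\<leftarrow>L. (\<sigma> \<circ> \<pi>) i)) =
    (\<Sum>L | length L = p \<and> set L \<subseteq> {1..N}. g (map (inv \<pi>) L) \<omega> * (\<Prod>i\<leftarrow>L. \<sigma> i))"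
  proof (rule sum.reindex_bij_witness[where i="map (inv \<pi>)" and j="map \<pi>"])
    have inv: "map (inv \<pi>) (map \<pi> L) = L" "map \<pi> (map (inv \<pi>) L) = L" for L
      by (simp_all add: comp_def permutes_inverses[OF assms])
    have sub: "set (map \<rho> L) \<subseteq> {1..N}" if "\<rho> permutes {1..N}" "set L \<subseteq> {1..N}" for \<rho> and L :: "nat list"
      using image_mono[OF that(2), of \<rho>] permutes_image[OF that(1)] by simp
    fix L assume L: "L \<in> {L. length L = p \<and> set L \<subseteq> {1..N}}"
    show "map (inv \<pi>) (map \<pi> L) = L" "map \<pi> (map (inv \<pi>) L) = L" by (rule inv)+
    show "map \<pi> L \<in> {L. length L = p \<and> set L \<subseteq> {1..N}}" "map (inv \<pi>) L \<in> {L. length L = p \<and> set L \<subseteq> {1..N}}"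
      using L sub[OF assms] sub[OF permutes_inv[OF assms]] by simp_all
    show "g (map (inv \<pi>) (map \<pi> L)) \<omega> * (\<Prod>i\<leftarrow>map \<pi> L. \<sigma> i) = g L \<omega> * (\<Prod>i\<leftarrow>L. (\<sigma> \<circ> \<pi>) i)"
      unfolding inv by (simp add: comp_def)
  qed
  then show ?thesis unfolding pspin_hamiltonian_def by (simp only:)
qed

lemma perturbed_hamiltonian_permute:
  assumes "\<pi> permutes {1..N}"
  shows "perturbed_hamiltonian \<beta> \<delta> \<beta>' g g' N \<omega> (\<sigma> \<circ> \<pi>) =
    perturbed_hamiltonian \<beta> \<delta> \<beta>' (\<lambda>L. g (map (inv \<pi>) L)) (\<lambda>L. g' (map (inv \<pi>) L)) N \<omega> \<sigma>"
  unfolding perturbed_hamiltonian_def mixed_hamiltonian_def pspin_hamiltonian_permute[OF assms] ..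

lemma configs_permute_bij:
  assumes "\<pi> permutes {1..N}"
  shows "bij_betw (\<lambda>\<sigma>. \<sigma> \<circ> \<pi>) (configs N) (configs N)"
proof (rule bij_betw_byWitness[where f'="\<lambda>\<sigma>. \<sigma> \<circ> inv \<pi>"])
  have *: "(\<lambda>\<sigma>. \<sigma> \<circ> \<rho>) ` configs N \<subseteq> configs N" if "\<rho> permutes {1..N}" for \<rho>
  proof clarify
    fix \<sigma> assume \<sigma>: "\<sigma> \<in> configs N"
    show "\<sigma> \<circ> \<rho> \<in> configs N"
      unfolding configs_def
    proof (rule PiE_I)
      fix i assume "i \<in> {1..N}"
      then have "\<rho> i \<in> {1..N}" using permutes_in_image[OF that] by simp
      from PiE_mem[OF \<sigma>[unfolded configs_def] this] show "(\<sigma> \<circ> \<rho>) i \<in> {-1, 1}" by (simp only: comp_apply)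
    next
      \<comment> \<open>Outside the sites a configuration is \<open>undefined\<close>, and
        \<open>\<rho>\<close> fixes such points, so extensionality is kept.\<close>
      fix i assume "i \<notin> {1..N}"
      then show "(\<sigma> \<circ> \<rho>) i = undefined"
        using permutes_not_in[OF that, of i] PiE_arb[OF \<sigma>[unfolded configs_def], of i] by simp
    qed
  qed
  show "(\<lambda>\<sigma>. \<sigma> \<circ> \<pi>) ` configs N \<subseteq> configs N" "(\<lambda>\<sigma>. \<sigma> \<circ> inv \<pi>) ` configs N \<subseteq> configs N"
    using *[OF assms] *[OF permutes_inv[OF assms]] by auto
qed (simp_all add: fun_eq_iff permutes_inverses[OF assms])

text \<open>The partition function sums over all configurations, which the permutation merely
  rearranges.\<close>

lemma gibbs_weight_permute:
  assumes "\<pi> permutes {1..N}"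
  shows "gibbs_weight N H (\<sigma> \<circ> \<pi>) = gibbs_weight N (\<lambda>\<sigma>. H (\<sigma> \<circ> \<pi>)) \<sigma>"
  unfolding gibbs_weight_def
  using sum.reindex_bij_betw[OF configs_permute_bij[OF assms], of "\<lambda>\<tau>. exp (- H \<tau>)"] by simp

text \<open>The Gibbs weight contains \<open>exp (- t * G)\<close>, so the field of the tilt is the
  negated process. Its covariance is the same because the variance is quadratic in the
  coefficients.\<close>

lemma centered_gaussian_process_uminus:
  assumes "centered_gaussian_process M T X K"
  shows "centered_gaussian_process M T (\<lambda>s \<omega>. - X s \<omega>) K"
  unfolding centered_gaussian_process_def
proof (intro conjI ballI allI impI)
  show "(\<lambda>\<omega>. - X s \<omega>) \<in> borel_measurable M" if "s \<in> T" for s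
    using assms that unfolding centered_gaussian_process_def by auto
next
  fix S and c :: "'b \<Rightarrow> real" assume "finite S" "S \<subseteq> T"
  with assms have "let v = (\<Sum>s\<in>S. \<Sum>s'\<in>S. - c s * - c s' * K s s') in 0 \<le> v \<and>
      distr M borel (\<lambda>\<omega>. \<Sum>s\<in>S. - c s * X s \<omega>) = distr std_normal_distribution borel (\<lambda>x. sqrt v * x)"
    unfolding centered_gaussian_process_def by (elim conjE allE[of _ S] allE[of _ "\<lambda>s. - c s"]) simp
  then show "let v = (\<Sum>s\<in>S. \<Sum>s'\<in>S. c s * c s' * K s s') in 0 \<le> v \<and>
      distr M borel (\<lambda>\<omega>. \<Sum>s\<in>S. c s * - X s \<omega>) = distr std_normal_distribution borel (\<lambda>x. sqrt v * x)"
    by simp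
qed

section \<open>Symmetry between sites\<close>

text \<open>Domain and image of the injection have complements of equal size in the finite set
  \<open>S\<close>; any bijection between these completes it.\<close>

lemma permutation_extending_injection:
  assumes S: "finite S" and A: "A \<subseteq> S" and f: "inj_on f A" "f ` A \<subseteq> S"
  obtains \<pi> where "\<pi> permutes S" "\<And>x. x \<in> A \<Longrightarrow> \<pi> x = f x"
proof -
  have fin: "finite A" using A S by (rule finite_subset)
  have "card (S - A) = card (S - f ` A)"
    using card_Diff_subset[OF fin A] card_Diff_subset[OF finite_imageI[OF fin] f(2)] card_image[OF f(1)] by simp
  then obtain h where h: "bij_betw h (S - A) (S - f ` A)"
    using S finite_same_card_bij[of "S - A" "S - f ` A"] by auto
  define \<pi> where "\<pi> x = (if x \<in> A then f x else if x \<in> S then h x else x)" for x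
  have "bij_betw \<pi> A (f ` A)"
    using f(1) by (auto simp: bij_betw_def inj_on_def \<pi>_def)
  moreover have "bij_betw \<pi> (S - A) (S - f ` A)"
    using h by (subst bij_betw_cong[where g=h]) (auto simp: \<pi>_def)
  ultimately have "bij_betw \<pi> (A \<union> (S - A)) (f ` A \<union> (S - f ` A))"
    by (rule bij_betw_combine) auto
  then have "bij_betw \<pi> S S" using A f(2) by (simp add: Un_absorb1)
  then have "\<pi> permutes S" by (rule bij_imp_permutes) (use A in \<open>auto simp: \<pi>_def\<close>)
  then show thesis by (rule that) (simp add: \<pi>_def)
qed

text \<open>Indexed by a set, in contrast to \<open>multi_overlap\<close>: the sets
  \<open>{l. i \<in> C l}\<close> contain every replica at most once.\<close>

definition set_overlap :: "nat \<Rightarrow> nat set \<Rightarrow> (nat \<Rightarrow> config) \<Rightarrow> real" where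
  "set_overlap N L s = (\<Sum>i=1..N. \<Prod>l\<in>L. s l i) / real N"

lemma config_abs: "\<sigma> \<in> configs N \<Longrightarrow> i \<in> {1..N} \<Longrightarrow> \<bar>\<sigma> i\<bar> = 1"
  by (auto simp: configs_def dest!: PiE_mem)

lemma abs_set_overlap_le_1:
  assumes "\<tau> \<in> J \<rightarrow>\<^sub>E configs N" "L \<subseteq> J"
  shows "\<bar>set_overlap N L \<tau>\<bar> \<le> 1"
proof -
  have "\<bar>\<Prod>l\<in>L. \<tau> l i\<bar> = 1" if "i \<in> {1..N}" for i
    unfolding abs_prod using assms that by (intro prod.neutral) (auto intro!: config_abs)
  then have "(\<Sum>i=1..N. \<bar>\<Prod>l\<in>L. \<tau> l i\<bar>) = real N" by simp
  moreover have "\<bar>\<Sum>i=1..N. \<Prod>l\<in>L. \<tau> l i\<bar> \<le> (\<Sum>i=1..N. \<bar>\<Prod>l\<in>L. \<tau> l i\<bar>)" by (rule sum_abs)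
  ultimately show ?thesis unfolding set_overlap_def by (simp add: abs_divide divide_le_eq_1) linarith
qed

text \<open>Multiplying out the site sums gives each factor its own site \<open>\<kappa> j\<close>;
  these sites may coincide.\<close>

lemma prod_set_overlap_eq_average:
  assumes "finite I"
  shows "(\<Prod>j\<in>I. set_overlap N (L j) \<tau>) =
    (\<Sum>\<kappa>\<in>I \<rightarrow>\<^sub>E {1..N}. \<Prod>j\<in>I. \<Prod>l\<in>L j. \<tau> l (\<kappa> j)) / real (card (I \<rightarrow>\<^sub>E {1..N}))"
  unfolding set_overlap_def prod_dividef using assms
  by (simp add: prod_sum_PiE card_funcsetE)

text \<open>Independently chosen sites are distinct with probability tending to \<open>1\<close>:
  among the \<open>N ^ n\<close> choices, \<open>\<Prod>i<n. N - i\<close> are injective.\<close>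

lemma injective_fraction_tendsto:
  assumes N: "filterlim N at_top sequentially"
  shows "(\<lambda>k. real (card {\<kappa> \<in> {..<n} \<rightarrow>\<^sub>E {1..N k}. inj_on \<kappa> {..<n}}) / real (N k) ^ n) \<longlonglongrightarrow> 1"
proof -
  have card: "card {\<kappa> \<in> {..<n} \<rightarrow>\<^sub>E {1..m}. inj_on \<kappa> {..<n}} = (\<Prod>i<n. m - i)" for m :: nat
    using card_inj_on_subset_funcset[of "{..<n}" "{1..m}" "{..<n}"] by (simp add: lessThan_atLeast0)
  have lim: "(\<lambda>k. real (N k - i) / real (N k)) \<longlonglongrightarrow> 1" for i
  proof -
    have "filterlim (\<lambda>k. real (N k)) at_top sequentially"
      by (rule filterlim_compose[OF filterlim_real_sequentially N])
    then have "(\<lambda>k. 1 - real i / real (N k)) \<longlonglongrightarrow> 1 - 0"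
      by (intro tendsto_diff tendsto_const tendsto_divide_0[OF tendsto_const] filterlim_at_top_imp_at_infinity)
    moreover have "eventually (\<lambda>k. 1 - real i / real (N k) = real (N k - i) / real (N k)) sequentially"
      using eventually_compose_filterlim[OF eventually_ge_at_top[of "Suc i"] N]
      by eventually_elim (simp add: of_nat_diff diff_divide_distrib)
    ultimately show ?thesis by (simp add: filterlim_cong)
  qed
  have "(\<lambda>k. \<Prod>i<n. real (N k - i) / real (N k)) \<longlonglongrightarrow> (\<Prod>i<n. 1)"
    by (intro tendsto_prod lim)
  then show ?thesis unfolding card by (simp add: prod_dividef)
qed

section \<open>The perturbed spin glass\<close>

context perturbed_spin_glass
begin

abbreviation "H \<equiv> perturbed_hamiltonian \<beta> \<delta> \<beta>' g g'"

section \<open>Law and symmetry of the disorder\<close>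

abbreviation disorder_indices :: "(nat list + nat list) set" where
  "disorder_indices \<equiv> coeff_indices <+> coeff_indices"

text \<open>Both coefficient families form one point of a product space, restricted in the same way
  as in the independence assumption on \<open>G\<close>.\<close>

definition disorder :: "'a \<Rightarrow> nat list + nat list \<Rightarrow> real" where
  "disorder \<omega> = (\<lambda>j\<in>disorder_indices. case_sum g g' j \<omega>)"

abbreviation disorder_space :: "(nat list + nat list \<Rightarrow> real) measure" where
  "disorder_space \<equiv> PiM disorder_indices (\<lambda>_. borel)"

text \<open>The Hamiltonian as a deterministic function of the coefficient point: \<open>Inl\<close>
  carries the coefficients of the model and \<open>Inr\<close> those of the perturbation.\<close>

definition disorder_hamiltonian :: "nat \<Rightarrow> (nat list + nat list \<Rightarrow> real) \<Rightarrow> config \<Rightarrow> real" where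
  "disorder_hamiltonian = perturbed_hamiltonian \<beta> \<delta> \<beta>' (\<lambda>L y. y (Inl L)) (\<lambda>L y. y (Inr L))"

lemma coefficient_measurable:
  "j \<in> disorder_indices \<Longrightarrow> (\<lambda>\<omega>. case_sum g g' j \<omega>) \<in> borel_measurable M"
  using coeffs_gaussian by (auto simp: distributed_def)

lemma H_measurable: "(\<lambda>\<omega>. H N \<omega> \<sigma>) \<in> borel_measurable M"
  by (rule perturbed_hamiltonian_measurable) (use coeffs_gaussian in \<open>auto simp: distributed_def\<close>)

lemma disorder_measurable: "disorder \<in> M \<rightarrow>\<^sub>M disorder_space"
  unfolding disorder_def by (rule measurable_restrict) (rule coefficient_measurable)

lemma disorder_hamiltonian_measurable:
  "(\<lambda>y. disorder_hamiltonian N y \<sigma>) \<in> borel_measurable disorder_space"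
  unfolding disorder_hamiltonian_def
  by (rule perturbed_hamiltonian_measurable) (auto intro!: measurable_component_singleton)

lemma H_eq_disorder_hamiltonian: "H N \<omega> = disorder_hamiltonian N (disorder \<omega>)"
  unfolding disorder_hamiltonian_def
  by (rule ext, rule perturbed_hamiltonian_cong) (auto simp: disorder_def)

lemma disorder_law: "distr M disorder_space disorder = PiM disorder_indices (\<lambda>_. std_normal_distribution)"
proof -
  have ne: "disorder_indices \<noteq> {}" by (auto simp: coeff_indices_def intro!: exI[of _ "[1]"])
  have "distr M borel (case_sum g g' j) = std_normal_distribution" if "j \<in> disorder_indices" for j
    using that coeffs_gaussian by (auto simp: distributed_def cong: distr_cong)
  then have "PiM disorder_indices (\<lambda>j. distr M borel (case_sum g g' j)) = PiM disorder_indices (\<lambda>_. std_normal_distribution)"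
    by (intro PiM_cong) auto
  then show ?thesis
    using coeffs_indep indep_vars_iff_distr_eq_PiM'[of disorder_indices "case_sum g g'" "\<lambda>_. borel"] ne coefficient_measurable
    unfolding disorder_def by simp
qed

text \<open>The coefficients are independent and identically distributed, so an injective
  relabelling preserves their joint law.\<close>

lemma disorder_reindex:
  assumes f: "inj_on f disorder_indices" "f \<in> disorder_indices \<rightarrow> disorder_indices"
    and \<Psi>: "\<Psi> \<in> borel_measurable disorder_space"
  shows "(\<integral>\<omega>. \<Psi> (\<lambda>j\<in>disorder_indices. disorder \<omega> (f j)) \<partial>M) = (\<integral>\<omega>. \<Psi> (disorder \<omega>) \<partial>M :: real)"
proof -
  let ?P = "PiM disorder_indices (\<lambda>_. std_normal_distribution)"
  let ?r = "\<lambda>y. \<lambda>j\<in>disorder_indices. y (f j)"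
  have sets: "sets ?P = sets disorder_space" by (rule sets_PiM_cong) auto
  have r: "?r \<in> disorder_space \<rightarrow>\<^sub>M disorder_space"
    using f(2) by (intro measurable_restrict measurable_component_singleton) auto
  have "distr ?P ?P ?r = ?P"
    by (rule distr_PiM_reindex[OF _ f]) (intro real_distribution.axioms(1) real_dist_normal_dist)
  then have reindex: "distr ?P disorder_space ?r = ?P"
    using distr_cong[OF refl sets, of ?P ?r ?r] by simp
  have \<Psi>': "\<Psi> \<in> borel_measurable ?P" using \<Psi> by (simp add: measurable_cong_sets[OF sets refl])
  have r': "?r \<in> ?P \<rightarrow>\<^sub>M disorder_space" using r by (simp add: measurable_cong_sets[OF sets refl])
  have "(\<integral>\<omega>. \<Psi> (?r (disorder \<omega>)) \<partial>M) = (\<integral>y. \<Psi> (?r y) \<partial>distr M disorder_space disorder)"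
    by (rule integral_distr[symmetric, OF disorder_measurable]) (rule measurable_compose[OF r \<Psi>])
  also have "\<dots> = (\<integral>y. \<Psi> y \<partial>distr ?P disorder_space ?r)"
    unfolding disorder_law by (rule integral_distr[symmetric, OF r' \<Psi>])
  also have "\<dots> = (\<integral>y. \<Psi> y \<partial>distr M disorder_space disorder)"
    unfolding reindex disorder_law ..
  also have "\<dots> = (\<integral>\<omega>. \<Psi> (disorder \<omega>) \<partial>M)"
    by (rule integral_distr[OF disorder_measurable \<Psi>])
  finally show ?thesis .
qed

text \<open>Permuting the sites in all replicas amounts to relabelling the coefficients by
  \<open>inv \<pi>\<close>, under which the law of the disorder is invariant. For a fixed disorder
  there is in general no such symmetry.\<close>

lemma replica_weight_permute:
  assumes \<pi>: "\<pi> permutes {1..N}"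
  shows "replica_weight M N (H N) J (\<lambda>l\<in>J. \<tau> l \<circ> \<pi>) = replica_weight M N (H N) J \<tau>"
proof -
  let ?f = "map_sum (map (inv \<pi>)) (map (inv \<pi>))"
  let ?\<Psi> = "\<lambda>y. \<Prod>l\<in>J. gibbs_weight N (disorder_hamiltonian N y) (\<tau> l)"
  have inj: "inj (map (inv \<pi>))" by (intro inj_mapI permutes_inj[OF permutes_inv[OF \<pi>]])
  have mem: "map (inv \<pi>) L \<in> coeff_indices" if "L \<in> coeff_indices" for L
  proof -
    \<comment> \<open>Coefficients are indexed by all positive sites and not just those up to
      \<open>N\<close>, so the points that \<open>inv \<pi>\<close> fixes have to be treated
      too.\<close>
    have "1 \<le> inv \<pi> i" if "1 \<le> i" for i
      using permutes_in_image[OF permutes_inv[OF \<pi>], of i] permutes_not_in[OF permutes_inv[OF \<pi>], of i] that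
      by (cases "i \<in> {1..N}") auto
    then show ?thesis using that by (auto simp: coeff_indices_def)
  qed
  have f: "inj_on ?f disorder_indices" "?f \<in> disorder_indices \<rightarrow> disorder_indices"
  proof -
    show "inj_on ?f disorder_indices"
      using inj by (auto simp: inj_on_def)
    show "?f \<in> disorder_indices \<rightarrow> disorder_indices" using mem by auto
  qed
  have Hp: "H N \<omega> (\<sigma> \<circ> \<pi>) = disorder_hamiltonian N (\<lambda>j\<in>disorder_indices. disorder \<omega> (?f j)) \<sigma>" for \<omega> \<sigma>
    unfolding perturbed_hamiltonian_permute[OF \<pi>] disorder_hamiltonian_def
    by (rule perturbed_hamiltonian_cong) (use mem in \<open>auto simp: disorder_def\<close>)
  have \<Psi>: "?\<Psi> \<in> borel_measurable disorder_space"
    by (intro borel_measurable_prod gibbs_weight_measurable disorder_hamiltonian_measurable)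
  have "replica_weight M N (H N) J (\<lambda>l\<in>J. \<tau> l \<circ> \<pi>) = (\<integral>\<omega>. ?\<Psi> (\<lambda>j\<in>disorder_indices. disorder \<omega> (?f j)) \<partial>M)"
    unfolding replica_weight_def by (simp add: gibbs_weight_permute[OF \<pi>] Hp)
  also have "\<dots> = (\<integral>\<omega>. ?\<Psi> (disorder \<omega>) \<partial>M)" by (rule disorder_reindex[OF f \<Psi>])
  finally show ?thesis unfolding replica_weight_def H_eq_disorder_hamiltonian .
qed

lemma replica_space_permute:
  fixes F :: "(nat \<Rightarrow> config) \<Rightarrow> real"
  assumes \<pi>: "\<pi> permutes {1..N}" and J: "finite J"
  shows "(\<integral>\<tau>. F (\<lambda>l\<in>J. \<tau> l \<circ> \<pi>) \<partial>replica_space N (H N) J) = (\<integral>\<tau>. F \<tau> \<partial>replica_space N (H N) J)"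
proof -
  have bij: "bij_betw (\<lambda>\<tau>. \<lambda>l\<in>J. \<tau> l \<circ> \<pi>) (J \<rightarrow>\<^sub>E configs N) (J \<rightarrow>\<^sub>E configs N)"
  proof (rule bij_betw_byWitness[where f'="\<lambda>\<tau>. \<lambda>l\<in>J. \<tau> l \<circ> inv \<pi>"])
    have "\<sigma> \<circ> \<rho> \<in> configs N" if "\<rho> permutes {1..N}" "\<sigma> \<in> configs N" for \<rho> \<sigma>
      using bij_betwE[OF configs_permute_bij[OF that(1)]] that(2) by auto
    then show "(\<lambda>\<tau>. \<lambda>l\<in>J. \<tau> l \<circ> \<pi>) ` (J \<rightarrow>\<^sub>E configs N) \<subseteq> J \<rightarrow>\<^sub>E configs N"
      "(\<lambda>\<tau>. \<lambda>l\<in>J. \<tau> l \<circ> inv \<pi>) ` (J \<rightarrow>\<^sub>E configs N) \<subseteq> J \<rightarrow>\<^sub>E configs N"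
      using \<pi> permutes_inv[OF \<pi>] by (auto simp: PiE_iff)
    have "\<tau> = (\<lambda>l\<in>J. \<tau> l)" if "\<tau> \<in> J \<rightarrow>\<^sub>E configs N" for \<tau>
      using that by (simp add: PiE_restrict)
    then show "\<forall>\<tau>\<in>J \<rightarrow>\<^sub>E configs N. (\<lambda>l\<in>J. (\<lambda>l\<in>J. \<tau> l \<circ> \<pi>) l \<circ> inv \<pi>) = \<tau>"
      "\<forall>\<tau>\<in>J \<rightarrow>\<^sub>E configs N. (\<lambda>l\<in>J. (\<lambda>l\<in>J. \<tau> l \<circ> inv \<pi>) l \<circ> \<pi>) = \<tau>"
      by (auto simp: comp_assoc permutes_inv_o[OF \<pi>] cong: restrict_cong)
  qed
  show ?thesis
    unfolding integral_replica_space[OF J]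
    using sum.reindex_bij_betw[OF bij, of "\<lambda>\<tau>. replica_weight M N (H N) J \<tau> *\<^sub>R F \<tau>"]
    by (simp add: replica_weight_permute[OF \<pi>])
qed

text \<open>The expected product of overlaps is the average of \<open>m k \<kappa>\<close> over all
  site choices \<open>\<kappa>\<close>. By symmetry every injective choice gives the value at the
  sites \<open>1\<close> to \<open>n\<close>; the other choices have vanishing proportion and
  deviate by at most \<open>2\<close>.\<close>

lemma site_average_tendsto:
  assumes J: "finite J" and N: "filterlim N at_top sequentially"
    and L: "\<And>j. j < n \<Longrightarrow> L j \<subseteq> J"
  shows "(\<lambda>k. (\<integral>\<tau>. (\<Prod>j<n. set_overlap (N k) (L j) \<tau>) \<partial>replica_space (N k) (H (N k)) J) -
    (\<integral>\<tau>. (\<Prod>j<n. \<Prod>l\<in>L j. \<tau> l (Suc j)) \<partial>replica_space (N k) (H (N k)) J)) \<longlonglongrightarrow> 0"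
proof -
  let ?\<Theta> = "\<lambda>k. replica_space (N k) (H (N k)) J"
  define m where "m k \<kappa> = (\<integral>\<tau>. (\<Prod>j<n. \<Prod>l\<in>L j. \<tau> l (\<kappa> j)) \<partial>?\<Theta> k)" for k and \<kappa> :: "nat \<Rightarrow> nat"
  let ?K = "\<lambda>k. {..<n} \<rightarrow>\<^sub>E {1..N k}" and ?I = "\<lambda>k. {\<kappa> \<in> {..<n} \<rightarrow>\<^sub>E {1..N k}. inj_on \<kappa> {..<n}}"
  let ?frac = "\<lambda>k. real (card (?I k)) / real (N k) ^ n"
  have ps: "prob_space (?\<Theta> k)" for k by (rule prob_space_replica_space[OF H_measurable J])
  have space: "space (?\<Theta> k) = J \<rightarrow>\<^sub>E configs (N k)" for k
    by (simp add: replica_space_def space_point_measure)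
  have m1: "\<bar>m k \<kappa>\<bar> \<le> 1" if "\<And>j. j < n \<Longrightarrow> \<kappa> j \<in> {1..N k}" for k \<kappa>
    unfolding m_def
  proof (rule prob_space.integral_abs_le_const[OF ps])
    fix \<tau> assume "\<tau> \<in> space (?\<Theta> k)"
    then have "\<bar>\<tau> l (\<kappa> j)\<bar> = 1" if "j < n" "l \<in> L j" for j l
      using that L \<open>\<And>j. j < n \<Longrightarrow> \<kappa> j \<in> {1..N k}\<close> unfolding space by (intro config_abs) auto
    then show "\<bar>\<Prod>j<n. \<Prod>l\<in>L j. \<tau> l (\<kappa> j)\<bar> \<le> 1" unfolding abs_prod by simp
  qed simp
  \<comment> \<open>\<open>Suc\<close> is the reference choice, since factors are counted from
    \<open>0\<close> and sites from \<open>1\<close>.\<close>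
  have inj: "m k \<kappa> = m k Suc" if \<kappa>: "\<kappa> \<in> ?I k" for k \<kappa>
  proof -
    have "n \<le> N k"
      using card_inj_on_le[of \<kappa> "{..<n}" "{1..N k}"] \<kappa> by auto
    then have sub: "Suc ` {..<n} \<subseteq> {1..N k}" by auto
    have "inj_on (\<lambda>i. \<kappa> (i - 1)) (Suc ` {..<n})" using \<kappa> by (auto simp: inj_on_def)
    moreover have "(\<lambda>i. \<kappa> (i - 1)) ` Suc ` {..<n} \<subseteq> {1..N k}" using \<kappa> by (auto simp: PiE_iff)
    ultimately obtain \<pi> where \<pi>: "\<pi> permutes {1..N k}" "\<And>x. x \<in> Suc ` {..<n} \<Longrightarrow> \<pi> x = \<kappa> (x - 1)"
      using permutation_extending_injection[OF finite_atLeastAtMost sub] by blast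
    have "m k Suc = (\<integral>\<tau>. (\<Prod>j<n. \<Prod>l\<in>L j. (\<lambda>l\<in>J. \<tau> l \<circ> \<pi>) l (Suc j)) \<partial>?\<Theta> k)"
      unfolding m_def by (rule replica_space_permute[OF \<pi>(1) J, symmetric])
    also have "\<dots> = m k \<kappa>"
      unfolding m_def
    proof (intro Bochner_Integration.integral_cong refl prod.cong)
      fix \<tau> j l assume "j \<in> {..<n}" "l \<in> L j"
      then show "(\<lambda>l\<in>J. \<tau> l \<circ> \<pi>) l (Suc j) = \<tau> l (\<kappa> j)" using \<pi>(2)[of "Suc j"] L[of j] by auto
    qed
    finally show ?thesis ..
  qed
  have "eventually (\<lambda>k. \<bar>(\<integral>\<tau>. (\<Prod>j<n. set_overlap (N k) (L j) \<tau>) \<partial>?\<Theta> k) - m k Suc\<bar> \<le> 2 * (1 - ?frac k)) sequentially"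
    \<comment> \<open>\<open>N k > n\<close> makes the sites \<open>1\<close> to \<open>n\<close>
      available and also excludes \<open>N k = 0\<close> when \<open>n = 0\<close>.\<close>
    using eventually_compose_filterlim[OF eventually_ge_at_top[of "Suc n"] N]
  proof eventually_elim
    case (elim k)
    have fin: "finite (?K k)" by (intro finite_PiE) auto
    have cardK: "real (card (?K k)) = real (N k) ^ n" by (simp add: card_funcsetE)
    have pos: "0 < real (card (?K k))" unfolding cardK using elim by simp
    have "(\<integral>\<tau>. (\<Prod>j<n. set_overlap (N k) (L j) \<tau>) \<partial>?\<Theta> k) = (\<Sum>\<kappa>\<in>?K k. m k \<kappa>) / real (card (?K k))"
      unfolding m_def prod_set_overlap_eq_average[OF finite_lessThan] integral_replica_space[OF J]
      by (simp add: sum_divide_distrib sum_distrib_left) (rule sum.swap)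
    then have "(\<integral>\<tau>. (\<Prod>j<n. set_overlap (N k) (L j) \<tau>) \<partial>?\<Theta> k) - m k Suc =
      (\<Sum>\<kappa>\<in>?K k. m k \<kappa> - m k Suc) / real (card (?K k))"
      using pos by (simp add: sum_subtractf diff_divide_distrib)
    also have "(\<Sum>\<kappa>\<in>?K k. m k \<kappa> - m k Suc) = (\<Sum>\<kappa>\<in>?K k - ?I k. m k \<kappa> - m k Suc)"
      using inj fin by (intro sum.mono_neutral_right) auto
    finally have "\<bar>(\<integral>\<tau>. (\<Prod>j<n. set_overlap (N k) (L j) \<tau>) \<partial>?\<Theta> k) - m k Suc\<bar> =
      \<bar>\<Sum>\<kappa>\<in>?K k - ?I k. m k \<kappa> - m k Suc\<bar> / real (card (?K k))" by (simp add: abs_divide)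
    also have "\<dots> \<le> (2 * real (card (?K k - ?I k))) / real (card (?K k))"
    proof (rule divide_right_mono)
      have "\<bar>m k \<kappa> - m k Suc\<bar> \<le> 2" if "\<kappa> \<in> ?K k - ?I k" for \<kappa>
      proof -
        have \<kappa>: "\<kappa> \<in> ?K k" using that by blast
        have "\<bar>m k \<kappa>\<bar> \<le> 1" by (rule m1, rule PiE_mem[OF \<kappa>]) simp
        moreover have "\<bar>m k Suc\<bar> \<le> 1" by (rule m1) (use elim in auto)
        ultimately show ?thesis by linarith
      qed
      then show "\<bar>\<Sum>\<kappa>\<in>?K k - ?I k. m k \<kappa> - m k Suc\<bar> \<le> 2 * real (card (?K k - ?I k))"
        using sum_norm_bound[of "?K k - ?I k" "\<lambda>\<kappa>. m k \<kappa> - m k Suc" 2] by (simp add: mult.commute)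
    qed simp
    also have "real (card (?K k - ?I k)) = real (card (?K k)) - real (card (?I k))"
    proof -
      have "card (?I k) \<le> card (?K k)" by (intro card_mono fin) auto
      moreover have "card (?K k - ?I k) = card (?K k) - card (?I k)"
        by (intro card_Diff_subset finite_subset[OF _ fin]) auto
      ultimately show ?thesis by (simp add: of_nat_diff)
    qed
    also have "2 * (real (card (?K k)) - real (card (?I k))) / real (card (?K k)) = 2 * (1 - ?frac k)"
      using pos unfolding cardK by (simp add: diff_divide_distrib)
    finally show ?case .
  qed
  then have ev: "eventually (\<lambda>k. norm ((\<integral>\<tau>. (\<Prod>j<n. set_overlap (N k) (L j) \<tau>) \<partial>?\<Theta> k) - m k Suc) \<le> 2 * (1 - ?frac k)) sequentially"
    by (simp only: real_norm_def)
  have "(\<lambda>k. 2 * (1 - ?frac k)) \<longlonglongrightarrow> 2 * (1 - 1)"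
    by (intro tendsto_mult tendsto_diff tendsto_const injective_fraction_tendsto N)
  then have "(\<lambda>k. 2 * (1 - ?frac k)) \<longlonglongrightarrow> 0" by (simp only: diff_self mult_zero_right)
  from Lim_null_comparison[OF ev this]
  have "(\<lambda>k. (\<integral>\<tau>. (\<Prod>j<n. set_overlap (N k) (L j) \<tau>) \<partial>?\<Theta> k) - m k Suc) \<longlonglongrightarrow> 0" .
  then show ?thesis unfolding m_def .
qed

end

section \<open>Characteristic moments as functions of the overlaps\<close>

lemma prod_swap_sites:
  fixes F :: "nat \<Rightarrow> 'i \<Rightarrow> 'a::comm_monoid_mult" and n :: nat
  assumes "finite I" "\<And>l. C l \<subseteq> I"
  shows "(\<Prod>l=1..n. \<Prod>i\<in>C l. F l i) = (\<Prod>i\<in>I. \<Prod>l\<in>{l \<in> {1..n}. i \<in> C l}. F l i)"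
proof -
  have "(\<Prod>l=1..n. \<Prod>i\<in>C l. F l i) = (\<Prod>l=1..n. \<Prod>i\<in>{i \<in> I. i \<in> C l}. F l i)"
    using assms(2) by (intro prod.cong) auto
  also have "\<dots> = (\<Prod>i\<in>I. \<Prod>l\<in>{l \<in> {1..n}. i \<in> C l}. F l i)"
    by (rule prod.swap_restrict) (auto simp: assms)
  finally show ?thesis .
qed

text \<open>
  The conditional expectation of \<open>\<Prod>\<^sub>i R\<^bsub>L\<^sub>i\<^esub> * exp (i * \<Sum>\<^sub>l \<theta>\<^sub>l X\<^sub>l)\<close> given the overlaps, for Gaussian \<open>X\<^sub>l\<close> with
  variance \<open>1\<close> and covariances \<open>R\<^bsub>{l,l'}\<^esub>\<^sup>p\<close>: the diagonal is separated because \<open>R\<^bsub>{l}\<^esub>\<close> is not the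
  self-overlap.
\<close>

definition overlap_exponential ::
  "nat \<Rightarrow> nat \<Rightarrow> (nat \<Rightarrow> real) \<Rightarrow> nat set \<Rightarrow> (nat \<Rightarrow> nat set) \<Rightarrow> (nat set \<Rightarrow> real) \<Rightarrow> real" where
  "overlap_exponential p n \<theta> I L R = exp (- (\<Sum>l=1..n. (\<theta> l)\<^sup>2) / 2) * ((\<Prod>i\<in>I. R (L i)) *
     (\<Prod>j\<in>{j \<in> {1..n} \<times> {1..n}. fst j \<noteq> snd j}. exp (- (\<theta> (fst j) * \<theta> (snd j) * R {fst j, snd j} ^ p) / 2)))"

text \<open>Both models fit: at finite size the squares of the spins are \<open>1\<close>, and in
  the limit \<open>z\<close> raises the diagonal to \<open>1\<close>. Pairs are ordered, so each
  \<open>R {l, l'}\<close> occurs twice, as in the double sum.\<close>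

lemma overlap_exponential_eq:
  assumes diag: "\<And>l. l \<in> {1..n} \<Longrightarrow> K l l = 1"
    and off: "\<And>l l'. l \<in> {1..n} \<Longrightarrow> l' \<in> {1..n} \<Longrightarrow> l \<noteq> l' \<Longrightarrow> K l l' = R {l, l'} ^ p"
  shows "overlap_exponential p n \<theta> I L R =
    (\<Prod>i\<in>I. R (L i)) * exp (- (\<Sum>l=1..n. \<Sum>l'=1..n. \<theta> l * \<theta> l' * K l l') / 2)"
proof -
  let ?F = "\<lambda>j. \<theta> (fst j) * \<theta> (snd j) * K (fst j) (snd j)"
  let ?O = "{j \<in> {1..n} \<times> {1..n}. fst j \<noteq> snd j}"
  have diagset: "{1..n} \<times> {1..n} - ?O = (\<lambda>l. (l, l)) ` {1..n}" by auto
  have "(\<Sum>l=1..n. \<Sum>l'=1..n. \<theta> l * \<theta> l' * K l l') = (\<Sum>j\<in>{1..n} \<times> {1..n}. ?F j)"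
    by (simp add: sum.cartesian_product split_def)
  also have "\<dots> = (\<Sum>j\<in>{1..n} \<times> {1..n} - ?O. ?F j) + (\<Sum>j\<in>?O. ?F j)"
    by (rule sum.subset_diff) auto
  also have "(\<Sum>j\<in>{1..n} \<times> {1..n} - ?O. ?F j) = (\<Sum>l=1..n. (\<theta> l)\<^sup>2)"
    unfolding diagset by (subst sum.reindex) (auto simp: inj_on_def diag power2_eq_square)
  also have "(\<Sum>j\<in>?O. ?F j) = (\<Sum>j\<in>?O. \<theta> (fst j) * \<theta> (snd j) * R {fst j, snd j} ^ p)"
    by (intro sum.cong refl) (auto simp: off)
  finally have "exp (- (\<Sum>l=1..n. \<Sum>l'=1..n. \<theta> l * \<theta> l' * K l l') / 2) =
    exp (- (\<Sum>l=1..n. (\<theta> l)\<^sup>2) / 2) * exp (- (\<Sum>j\<in>?O. \<theta> (fst j) * \<theta> (snd j) * R {fst j, snd j} ^ p) / 2)"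
    by (simp only: exp_add[symmetric] minus_add_distrib add_divide_distrib)
  also have "- (\<Sum>j\<in>?O. \<theta> (fst j) * \<theta> (snd j) * R {fst j, snd j} ^ p) / 2 =
      (\<Sum>j\<in>?O. - (\<theta> (fst j) * \<theta> (snd j) * R {fst j, snd j} ^ p) / 2)"
    by (simp only: sum_negf[symmetric] sum_divide_distrib)
  finally have "exp (- (\<Sum>l=1..n. \<Sum>l'=1..n. \<theta> l * \<theta> l' * K l l') / 2) =
    exp (- (\<Sum>l=1..n. (\<theta> l)\<^sup>2) / 2) * exp (\<Sum>j\<in>?O. - (\<theta> (fst j) * \<theta> (snd j) * R {fst j, snd j} ^ p) / 2)" .
  then show ?thesis unfolding overlap_exponential_def by (simp add: exp_sum mult_ac)
qed

text \<open>The integrand is a product of continuous functions of one overlap each, the identity at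
  every \<open>L i\<close> and an exponential at every pair. That is the form
  \<open>moment_weight_prod\<close> handles.\<close>

lemma overlap_exponential_tendsto:
  assumes "moment_convergence \<Theta> \<Theta>' (Pow {1..n}) R R'" "finite I" and L: "\<And>i. i \<in> I \<Longrightarrow> L i \<subseteq> {1..n}"
  shows "(\<lambda>k. \<integral>x. overlap_exponential p n \<theta> I L (\<lambda>L. R k L x) \<partial>\<Theta> k)
    \<longlonglongrightarrow> (\<integral>x. overlap_exponential p n \<theta> I L (\<lambda>L. R' L x) \<partial>\<Theta>')"
proof -
  interpret moment_convergence \<Theta> \<Theta>' "Pow {1..n}" R R' by fact
  let ?O = "{j \<in> {1..n} \<times> {1..n}. fst j \<noteq> snd j}"
  let ?\<phi> = "\<lambda>j y. exp (- (\<theta> (fst j) * \<theta> (snd j) * y ^ p) / 2)"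
  have "moment_weight (\<lambda>k x. 1 * (\<Prod>i\<in>I. R k (L i) x)) (\<lambda>x. 1 * (\<Prod>i\<in>I. R' (L i) x))"
    by (rule moment_weight_prod[where \<phi>="\<lambda>_ y. y"]) (use assms moment_weight_one in auto)
  note A = this
  have "moment_weight (\<lambda>k x. 1 * (\<Prod>i\<in>I. R k (L i) x) * (\<Prod>j\<in>?O. ?\<phi> j (R k {fst j, snd j} x)))
    (\<lambda>x. 1 * (\<Prod>i\<in>I. R' (L i) x) * (\<Prod>j\<in>?O. ?\<phi> j (R' {fst j, snd j} x)))"
    by (rule moment_weight_prod[where J="?O" and L="\<lambda>j. {fst j, snd j}" and \<phi>="?\<phi>", OF _ _ _ A])
      (auto intro!: continuous_intros)
  from moment_weight_limit[OF this] show ?thesis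
    unfolding overlap_exponential_def by (auto intro!: tendsto_mult_left)
qed

lemma (in prob_space) indep_set_commute: "indep_set A B \<Longrightarrow> indep_set B A"
  unfolding indep_sets2_eq by (metis Int_commute mult.commute)

text \<open>The independence of \<open>G\<close> from the coefficients is assumed for the
  sigma-algebras of whole families; a random variable computed from a family generates a smaller
  one.\<close>

lemma (in prob_space) indep_var_vimage_algebra:
  assumes ind: "indep_set (sets (vimage_algebra (space M) X A)) (sets (vimage_algebra (space M) Y B))"
    and X: "X \<in> M \<rightarrow>\<^sub>M A" and Y: "Y \<in> M \<rightarrow>\<^sub>M B" and f: "f \<in> A \<rightarrow>\<^sub>M S" and g: "g \<in> B \<rightarrow>\<^sub>M S'"
  shows "indep_var S (\<lambda>\<omega>. f (X \<omega>)) S' (\<lambda>\<omega>. g (Y \<omega>))"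
proof -
  have sub: "sigma_sets (space M) {(\<lambda>\<omega>. h (Z \<omega>)) -` E \<inter> space M | E. E \<in> sets T} \<subseteq> sets (vimage_algebra (space M) Z D)"
    if Z: "Z \<in> M \<rightarrow>\<^sub>M D" and h: "h \<in> D \<rightarrow>\<^sub>M T" for Z :: "'a \<Rightarrow> 'x" and h :: "'x \<Rightarrow> 'y" and D T
  proof -
    have "{(\<lambda>\<omega>. h (Z \<omega>)) -` E \<inter> space M | E. E \<in> sets T} \<subseteq> sets (vimage_algebra (space M) Z D)"
    proof clarify
      fix E assume "E \<in> sets T"
      then have "h -` E \<inter> space D \<in> sets D" by (rule measurable_sets[OF h])
      then have "Z -` (h -` E \<inter> space D) \<inter> space M \<in> sets (vimage_algebra (space M) Z D)" by (rule in_vimage_algebra)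
      moreover have "Z -` (h -` E \<inter> space D) \<inter> space M = (\<lambda>\<omega>. h (Z \<omega>)) -` E \<inter> space M"
        using measurable_space[OF Z] by auto
      ultimately show "(\<lambda>\<omega>. h (Z \<omega>)) -` E \<inter> space M \<in> sets (vimage_algebra (space M) Z D)" by simp
    qed
    from sets.sigma_sets_subset[OF this] show ?thesis by simp
  qed
  show ?thesis
    unfolding indep_var_eq
  proof (intro conjI measurable_compose[OF X f] measurable_compose[OF Y g])
    show "indep_set (sigma_sets (space M) {(\<lambda>\<omega>. f (X \<omega>)) -` A \<inter> space M |A. A \<in> sets S})
      (sigma_sets (space M) {(\<lambda>\<omega>. g (Y \<omega>)) -` A \<inter> space M |A. A \<in> sets S'})"
      using ind unfolding indep_set_def
      by (rule indep_sets_mono_sets) (use sub[OF X f] sub[OF Y g] in \<open>auto split: bool.splits\<close>)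
  qed
qed

section \<open>The Gibbs measure tilted by the Gaussian process\<close>

context perturbed_spin_glass
begin

abbreviation "gibbs N \<equiv> \<lambda>\<omega>. gibbs_measure N (H N \<omega>)"
abbreviation "neg_G N p \<equiv> \<lambda>\<omega> \<sigma>. - G N p \<sigma> \<omega>"
abbreviation "site_spins C \<kappa> \<equiv> \<lambda>l (\<omega> :: 'a) \<sigma>. \<Prod>i\<in>C l. \<sigma> (\<kappa> i) :: real"

lemma G_measurable:
  "1 \<le> N \<Longrightarrow> 1 \<le> p \<Longrightarrow> \<sigma> \<in> configs N \<Longrightarrow> G N p \<sigma> \<in> borel_measurable M"
  using G_gaussian[of N p] by (auto simp: centered_gaussian_process_def)

text \<open>The Gibbs weights are functions of the disorder alone and hence independent of the
  process. The map \<open>f\<close> lets the same fact serve complex and extended nonnegative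
  integrands.\<close>

lemma tuple_weight_G_indep:
  fixes S S' :: "'c measure"
  assumes N: "1 \<le> N" "1 \<le> p" and \<Phi>: "\<Phi> \<in> PiM (configs N) (\<lambda>_. borel) \<rightarrow>\<^sub>M S" and f: "f \<in> borel \<rightarrow>\<^sub>M S'"
  shows "indep_var S' (\<lambda>\<omega>. f (\<Prod>l\<in>J. gibbs_weight N (H N \<omega>) (\<tau> l)) ) S (\<lambda>\<omega>. \<Phi> (\<lambda>\<sigma>\<in>configs N. G N p \<sigma> \<omega>))"
proof -
  let ?\<Psi> = "\<lambda>y. f (\<Prod>l\<in>J. gibbs_weight N (disorder_hamiltonian N y) (\<tau> l))"
  have \<Psi>: "?\<Psi> \<in> disorder_space \<rightarrow>\<^sub>M S'"
    by (intro measurable_compose[OF _ f] borel_measurable_prod gibbs_weight_measurable disorder_hamiltonian_measurable)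
  have G: "(\<lambda>\<omega>. \<lambda>\<sigma>\<in>configs N. G N p \<sigma> \<omega>) \<in> M \<rightarrow>\<^sub>M PiM (configs N) (\<lambda>_. borel)"
    by (rule measurable_restrict) (rule G_measurable[OF N])
  have "indep_set
      (sets (vimage_algebra (space M) disorder disorder_space))
      (sets (vimage_algebra (space M) (\<lambda>\<omega>. \<lambda>\<sigma>\<in>configs N. G N p \<sigma> \<omega>) (PiM (configs N) (\<lambda>_. borel))))"
    unfolding disorder_def[abs_def] by (rule indep_set_commute[OF G_indep[OF N]])
  from indep_var_vimage_algebra[OF this disorder_measurable G \<Psi> \<Phi>]
  show ?thesis by (simp add: H_eq_disorder_hamiltonian)
qed

lemma expectation_tuple_weight_G:
  fixes \<Phi> :: "(config \<Rightarrow> real) \<Rightarrow> complex"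
  assumes "1 \<le> N" "1 \<le> p" and \<Phi>: "\<Phi> \<in> borel_measurable (PiM (configs N) (\<lambda>_. borel))" "\<And>y. norm (\<Phi> y) \<le> 1"
    and \<tau>: "\<tau> \<in> J \<rightarrow>\<^sub>E configs N"
  shows "(\<integral>\<omega>. of_real (\<Prod>l\<in>J. gibbs_weight N (H N \<omega>) (\<tau> l)) * \<Phi> (\<lambda>\<sigma>\<in>configs N. G N p \<sigma> \<omega>) \<partial>M) =
      of_real (replica_weight M N (H N) J \<tau>) * (\<integral>\<omega>. \<Phi> (\<lambda>\<sigma>\<in>configs N. G N p \<sigma> \<omega>) \<partial>M)"
    and "integrable M (\<lambda>\<omega>. of_real (\<Prod>l\<in>J. gibbs_weight N (H N \<omega>) (\<tau> l)) * \<Phi> (\<lambda>\<sigma>\<in>configs N. G N p \<sigma> \<omega>))"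
proof -
  have ind: "indep_var borel (\<lambda>\<omega>. complex_of_real (\<Prod>l\<in>J. gibbs_weight N (H N \<omega>) (\<tau> l))) borel (\<lambda>\<omega>. \<Phi> (\<lambda>\<sigma>\<in>configs N. G N p \<sigma> \<omega>))"
    by (rule tuple_weight_G_indep[OF assms(1,2) \<Phi>(1), where f=complex_of_real]) simp
  have i1: "integrable M (\<lambda>\<omega>. complex_of_real (\<Prod>l\<in>J. gibbs_weight N (H N \<omega>) (\<tau> l)))"
    by (intro integrable_of_real tuple_weight_integrable H_measurable \<tau>)
  have i2: "integrable M (\<lambda>\<omega>. \<Phi> (\<lambda>\<sigma>\<in>configs N. G N p \<sigma> \<omega>))"
    by (rule integrable_const_bound[where B=1])
      (use \<Phi> indep_var_rv2[OF ind] in auto)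
  show "integrable M (\<lambda>\<omega>. of_real (\<Prod>l\<in>J. gibbs_weight N (H N \<omega>) (\<tau> l)) * \<Phi> (\<lambda>\<sigma>\<in>configs N. G N p \<sigma> \<omega>))"
    by (rule indep_var_integrable[OF ind i1 i2])
  show "(\<integral>\<omega>. of_real (\<Prod>l\<in>J. gibbs_weight N (H N \<omega>) (\<tau> l)) * \<Phi> (\<lambda>\<sigma>\<in>configs N. G N p \<sigma> \<omega>) \<partial>M) =
      of_real (replica_weight M N (H N) J \<tau>) * (\<integral>\<omega>. \<Phi> (\<lambda>\<sigma>\<in>configs N. G N p \<sigma> \<omega>) \<partial>M)"
    unfolding indep_var_lebesgue_integral[OF ind i1 i2] replica_weight_def integral_complex_of_real ..
qed

lemma overlap_self: "1 \<le> N \<Longrightarrow> \<sigma> \<in> configs N \<Longrightarrow> overlap N \<sigma> \<sigma> = 1"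
proof -
  assume "1 \<le> N" "\<sigma> \<in> configs N"
  then have "(\<Sum>i=1..N. \<sigma> i * \<sigma> i) = (\<Sum>i=1..N. 1)"
    by (intro sum.cong refl) (auto simp: configs_def dest!: PiE_mem)
  then show ?thesis unfolding overlap_def using \<open>1 \<le> N\<close> by simp
qed

text \<open>The weight of \<open>\<sigma>\<close> is independent of \<open>G N p \<sigma>\<close>,
  whose variance is a power of the self-overlap \<open>1\<close>; so the expectation factors and the
  second factor is a standard Gaussian integral.\<close>

lemma nn_expectation_weight_G:
  assumes N: "1 \<le> N" "1 \<le> p" and \<sigma>: "\<sigma> \<in> configs N" and h[measurable]: "h \<in> borel_measurable borel" "\<And>x. 0 \<le> h x"
  shows "(\<integral>\<^sup>+\<omega>. ennreal (gibbs_weight N (H N \<omega>) \<sigma>) * ennreal (h (- G N p \<sigma> \<omega>)) \<partial>M) =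
    ennreal (\<integral>\<omega>. gibbs_weight N (H N \<omega>) \<sigma> \<partial>M) * (\<integral>\<^sup>+x. ennreal (h x) \<partial>std_normal_distribution)"
proof -
  note [measurable] = G_measurable[OF N \<sigma>]
  let ?\<Phi> = "\<lambda>y. ennreal (h (- y \<sigma>))"
  have \<Phi>: "?\<Phi> \<in> borel_measurable (PiM (configs N) (\<lambda>_. borel))"
    using \<sigma> by (intro measurable_component_compose[where g="\<lambda>x. ennreal (h (- x))"]) auto
  \<comment> \<open>A product over one replica puts the single weight into the form required by
    \<open>tuple_weight_G_indep\<close>.\<close>
  have "indep_var borel (\<lambda>\<omega>. ennreal (\<Prod>l\<in>{0::nat}. gibbs_weight N (H N \<omega>) \<sigma>)) borel (\<lambda>\<omega>. ?\<Phi> (\<lambda>\<sigma>\<in>configs N. G N p \<sigma> \<omega>))"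
    by (rule tuple_weight_G_indep[OF N \<Phi>, where f=ennreal]) simp
  then have ind: "indep_vars (\<lambda>_. borel) (case_bool (\<lambda>\<omega>. ennreal (gibbs_weight N (H N \<omega>) \<sigma>)) (\<lambda>\<omega>. ennreal (h (- G N p \<sigma> \<omega>)))) UNIV"
  proof -
    have "(\<lambda>_. borel :: ennreal measure) = case_bool borel borel" by (auto split: bool.split)
    moreover assume "indep_var borel (\<lambda>\<omega>. ennreal (\<Prod>l\<in>{0::nat}. gibbs_weight N (H N \<omega>) \<sigma>)) borel (\<lambda>\<omega>. ?\<Phi> (\<lambda>\<sigma>\<in>configs N. G N p \<sigma> \<omega>))"
    ultimately show ?thesis unfolding indep_var_def using \<sigma> by simp
  qed
  have law: "distr M borel (\<lambda>\<omega>. - G N p \<sigma> \<omega>) = std_normal_distribution"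
  proof -
    have "distr std_normal_distribution borel (\<lambda>x. x) = std_normal_distribution"
      by (rule distr_id2) simp
    then show ?thesis
      using centered_gaussian_process_marginal(2)[OF centered_gaussian_process_uminus[OF G_gaussian[OF N]] \<sigma>]
      by (simp add: overlap_self[OF N(1) \<sigma>])
  qed
  have "(\<integral>\<^sup>+\<omega>. ennreal (gibbs_weight N (H N \<omega>) \<sigma>) * ennreal (h (- G N p \<sigma> \<omega>)) \<partial>M) =
    (\<integral>\<^sup>+\<omega>. ennreal (gibbs_weight N (H N \<omega>) \<sigma>) \<partial>M) * (\<integral>\<^sup>+\<omega>. ennreal (h (- G N p \<sigma> \<omega>)) \<partial>M)"
    using indep_vars_nn_integral[OF _ ind] by (simp add: UNIV_bool mult.commute)
  also have "(\<integral>\<^sup>+\<omega>. ennreal (h (- G N p \<sigma> \<omega>)) \<partial>M) = (\<integral>\<^sup>+x. ennreal (h x) \<partial>distr M borel (\<lambda>\<omega>. - G N p \<sigma> \<omega>))"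
    by (rule nn_integral_distr[symmetric]) measurable
  also have "(\<integral>\<^sup>+\<omega>. ennreal (gibbs_weight N (H N \<omega>) \<sigma>) \<partial>M) = ennreal (\<integral>\<omega>. gibbs_weight N (H N \<omega>) \<sigma> \<partial>M)"
  proof (rule nn_integral_eq_integral)
    show "integrable M (\<lambda>\<omega>. gibbs_weight N (H N \<omega>) \<sigma>)"
      using tuple_weight_integrable[of "H N" "\<lambda>l\<in>{0}. \<sigma>" "{0}" N] H_measurable \<sigma> by simp
  qed (simp add: gibbs_weight_nonneg)
  finally show ?thesis unfolding law .
qed

text \<open>The base measure is the Gibbs measure of \<open>H\<close> without the tilt, and it is
  independent of \<open>G\<close>. Every \<open>- G N p \<sigma>\<close> is standard Gaussian, so
  the mixture with the Gibbs weights is standard Gaussian too, which is the condition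
  \<open>marginal\<close>.\<close>

lemma gibbs_tilt:
  assumes N: "1 \<le> N" "1 \<le> p" and C: "\<And>l i. i \<in> C l \<Longrightarrow> \<kappa> i \<in> {1..N}" "\<And>l. q < l \<Longrightarrow> C l = {}"
  shows "gaussian_tilt M (gibbs N) (neg_G N p) (site_spins C \<kappa>) q"
proof (rule gaussian_tilt.intro[OF prob_space_axioms gaussian_tilt_axioms.intro], goal_cases)
  case (1 \<omega>)
  show ?case by (rule prob_space_gibbs_measure)
next
  case (4 l \<omega> \<sigma>)
  then have "\<bar>\<sigma> (\<kappa> i)\<bar> = 1" if "i \<in> C l" for i using C(1)[OF that] by (intro config_abs) auto
  then show ?case unfolding abs_prod by simp
next
  case (6 l h)
  note [measurable] = H_measurable[of N] G_measurable[OF N] 6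
  show ?case unfolding integral_gibbs_measure by measurable
next
  case (7 h)
  note [measurable] = H_measurable[of N] G_measurable[OF N] 7
  show ?case unfolding nn_integral_gibbs_measure by measurable
next
  case (8 h)
  note [measurable] = H_measurable[of N] G_measurable[OF N] 8(1)
  have int: "integrable M (\<lambda>\<omega>. gibbs_weight N (H N \<omega>) \<sigma>)" if "\<sigma> \<in> configs N" for \<sigma>
    using tuple_weight_integrable[of "H N" "\<lambda>l\<in>{0}. \<sigma>" "{0}" N] H_measurable that by simp
  have "(\<integral>\<^sup>+\<omega>. \<integral>\<^sup>+\<sigma>. ennreal (h (- G N p \<sigma> \<omega>)) \<partial>gibbs_measure N (H N \<omega>) \<partial>M) =
    (\<Sum>\<sigma>\<in>configs N. \<integral>\<^sup>+\<omega>. ennreal (gibbs_weight N (H N \<omega>) \<sigma>) * ennreal (h (- G N p \<sigma> \<omega>)) \<partial>M)"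
    unfolding nn_integral_gibbs_measure by (rule nn_integral_sum) measurable
  also have "\<dots> = (\<Sum>\<sigma>\<in>configs N. ennreal (\<integral>\<omega>. gibbs_weight N (H N \<omega>) \<sigma> \<partial>M)) * (\<integral>\<^sup>+x. ennreal (h x) \<partial>std_normal_distribution)"
    by (simp add: nn_expectation_weight_G[OF N _ 8] sum_distrib_right)
  also have "(\<Sum>\<sigma>\<in>configs N. ennreal (\<integral>\<omega>. gibbs_weight N (H N \<omega>) \<sigma> \<partial>M)) = ennreal (\<integral>\<omega>. (\<Sum>\<sigma>\<in>configs N. gibbs_weight N (H N \<omega>) \<sigma>) \<partial>M)"
    using int by (simp add: gibbs_weight_nonneg sum_ennreal)
  finally show ?case by (simp add: sum_gibbs_weight prob_space)
qed (use C in auto)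

text \<open>A product of \<open>n\<close> Gibbs averages is a sum over \<open>n\<close>-tuples of
  replicas. By independence the expectation of the weights separates from that of the phase, and the
  latter is the characteristic function of the negated process at the replicas.\<close>

lemma gibbs_char_moment:
  assumes N: "1 \<le> N" "1 \<le> p" and C: "\<And>l i. i \<in> C l \<Longrightarrow> \<kappa> i \<in> {1..N}" "\<And>l. q < l \<Longrightarrow> C l = {}"
  shows "gaussian_tilt.char_moment M (gibbs N) (neg_G N p) (site_spins C \<kappa>) n \<theta> =
    of_real (\<Sum>\<tau>\<in>{1..n} \<rightarrow>\<^sub>E configs N. replica_weight M N (H N) {1..n} \<tau> * ((\<Prod>l=1..n. \<Prod>i\<in>C l. \<tau> l (\<kappa> i)) *
      exp (- (\<Sum>l=1..n. \<Sum>l'=1..n. \<theta> l * \<theta> l' * overlap N (\<tau> l) (\<tau> l') ^ p) / 2)))"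
proof -
  let ?T = "{1..n} \<rightarrow>\<^sub>E configs N"
  let ?\<Phi> = "\<lambda>\<tau> y. iexp (\<Sum>l=1..n. \<theta> l * - y (\<tau> l))"
  have \<Phi>: "?\<Phi> \<tau> \<in> borel_measurable (PiM (configs N) (\<lambda>_. borel))" if "\<tau> \<in> ?T" for \<tau>
  proof -
    have "(\<lambda>y. y (\<tau> l)) \<in> borel_measurable (PiM (configs N) (\<lambda>_. borel :: real measure))" if "l \<in> {1..n}" for l
      using \<open>\<tau> \<in> ?T\<close> that by (intro measurable_component_singleton) auto
    then show ?thesis by measurable
  qed
  have tup: "(\<Prod>l=1..n. \<integral>\<sigma>. of_real (\<Prod>i\<in>C l. \<sigma> (\<kappa> i)) * iexp (\<theta> l * - G N p \<sigma> \<omega>) \<partial>gibbs_measure N (H N \<omega>)) =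
    (\<Sum>\<tau>\<in>?T. of_real (\<Prod>l=1..n. \<Prod>i\<in>C l. \<tau> l (\<kappa> i)) *
      (of_real (\<Prod>l\<in>{1..n}. gibbs_weight N (H N \<omega>) (\<tau> l)) * ?\<Phi> \<tau> (\<lambda>\<sigma>\<in>configs N. G N p \<sigma> \<omega>)))" for \<omega>
  proof -
    have "(\<Prod>l=1..n. \<integral>\<sigma>. of_real (\<Prod>i\<in>C l. \<sigma> (\<kappa> i)) * iexp (\<theta> l * - G N p \<sigma> \<omega>) \<partial>gibbs_measure N (H N \<omega>)) =
      (\<Prod>l=1..n. \<Sum>\<sigma>\<in>configs N. of_real (\<Prod>i\<in>C l. \<sigma> (\<kappa> i)) * (of_real (gibbs_weight N (H N \<omega>) \<sigma>) * iexp (\<theta> l * - G N p \<sigma> \<omega>)))"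
      unfolding integral_gibbs_measure scaleR_conv_of_real by (simp only: mult_ac)
    also have "\<dots> = (\<Sum>\<tau>\<in>?T. \<Prod>l=1..n. of_real (\<Prod>i\<in>C l. \<tau> l (\<kappa> i)) * (of_real (gibbs_weight N (H N \<omega>) (\<tau> l)) * iexp (\<theta> l * - G N p (\<tau> l) \<omega>)))"
      by (rule prod_sum_PiE) (auto simp: finite_configs)
    also have "\<dots> = (\<Sum>\<tau>\<in>?T. of_real (\<Prod>l=1..n. \<Prod>i\<in>C l. \<tau> l (\<kappa> i)) *
      (of_real (\<Prod>l\<in>{1..n}. gibbs_weight N (H N \<omega>) (\<tau> l)) * ?\<Phi> \<tau> (\<lambda>\<sigma>\<in>configs N. G N p \<sigma> \<omega>)))"
    proof (rule sum.cong[OF refl])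
      fix \<tau> assume \<tau>: "\<tau> \<in> ?T"
      have "?\<Phi> \<tau> (\<lambda>\<sigma>\<in>configs N. G N p \<sigma> \<omega>) = iexp (\<Sum>l=1..n. \<theta> l * - G N p (\<tau> l) \<omega>)"
        by (intro arg_cong[where f="\<lambda>x. iexp x"] sum.cong refl) (use \<tau> PiE_mem[OF \<tau>] in simp)
      also have "\<dots> = (\<Prod>l=1..n. iexp (\<theta> l * - G N p (\<tau> l) \<omega>))"
        by (simp add: exp_sum[symmetric] sum_distrib_left)
      finally show "(\<Prod>l=1..n. of_real (\<Prod>i\<in>C l. \<tau> l (\<kappa> i)) * (of_real (gibbs_weight N (H N \<omega>) (\<tau> l)) * iexp (\<theta> l * - G N p (\<tau> l) \<omega>))) =
        of_real (\<Prod>l=1..n. \<Prod>i\<in>C l. \<tau> l (\<kappa> i)) *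
        (of_real (\<Prod>l\<in>{1..n}. gibbs_weight N (H N \<omega>) (\<tau> l)) * ?\<Phi> \<tau> (\<lambda>\<sigma>\<in>configs N. G N p \<sigma> \<omega>))"
        by (simp only: prod.distrib of_real_prod)
    qed
    finally show ?thesis .
  qed
  have int\<Phi>: "(\<integral>\<omega>. ?\<Phi> \<tau> (\<lambda>\<sigma>\<in>configs N. G N p \<sigma> \<omega>) \<partial>M) =
    of_real (exp (- (\<Sum>l=1..n. \<Sum>l'=1..n. \<theta> l * \<theta> l' * overlap N (\<tau> l) (\<tau> l') ^ p) / 2))" if \<tau>: "\<tau> \<in> ?T" for \<tau>
  proof -
    have "(\<integral>\<omega>. ?\<Phi> \<tau> (\<lambda>\<sigma>\<in>configs N. G N p \<sigma> \<omega>) \<partial>M) = (\<integral>\<omega>. iexp (\<Sum>l=1..n. \<theta> l * - G N p (\<tau> l) \<omega>) \<partial>M)"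
      by (intro Bochner_Integration.integral_cong refl arg_cong[where f="\<lambda>x. iexp x"] sum.cong) (use PiE_mem[OF \<tau>] in simp)
    also have "\<dots> = of_real (exp (- (\<Sum>l=1..n. \<Sum>l'=1..n. \<theta> l * \<theta> l' * overlap N (\<tau> l) (\<tau> l') ^ p) / 2))"
      by (rule centered_gaussian_process_char[OF centered_gaussian_process_uminus[OF G_gaussian[OF N]]])
        (use PiE_mem[OF \<tau>] in auto)
    finally show ?thesis .
  qed
  have \<Phi>1: "norm (?\<Phi> \<tau> y) \<le> 1" for y and \<tau> :: "nat \<Rightarrow> config" by (simp only: norm_exp_i_times order_refl)
  have T: "gaussian_tilt M (gibbs N) (neg_G N p) (site_spins C \<kappa>) q"
    by (rule gibbs_tilt[OF N C])
  have "gaussian_tilt.char_moment M (gibbs N) (neg_G N p) (site_spins C \<kappa>) n \<theta> =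
    (\<Sum>\<tau>\<in>?T. \<integral>\<omega>. of_real (\<Prod>l=1..n. \<Prod>i\<in>C l. \<tau> l (\<kappa> i)) *
      (of_real (\<Prod>l\<in>{1..n}. gibbs_weight N (H N \<omega>) (\<tau> l)) * ?\<Phi> \<tau> (\<lambda>\<sigma>\<in>configs N. G N p \<sigma> \<omega>)) \<partial>M)"
    unfolding gaussian_tilt.char_moment_def[OF T] tup
    by (intro Bochner_Integration.integral_sum integrable_mult_right expectation_tuple_weight_G(2) N \<Phi> \<Phi>1)
  also have "\<dots> = (\<Sum>\<tau>\<in>?T. of_real (replica_weight M N (H N) {1..n} \<tau> * ((\<Prod>l=1..n. \<Prod>i\<in>C l. \<tau> l (\<kappa> i)) *
      exp (- (\<Sum>l=1..n. \<Sum>l'=1..n. \<theta> l * \<theta> l' * overlap N (\<tau> l) (\<tau> l') ^ p) / 2))))"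
  proof (rule sum.cong[OF refl])
    fix \<tau> assume \<tau>: "\<tau> \<in> ?T"
    show "(\<integral>\<omega>. of_real (\<Prod>l=1..n. \<Prod>i\<in>C l. \<tau> l (\<kappa> i)) *
      (of_real (\<Prod>l\<in>{1..n}. gibbs_weight N (H N \<omega>) (\<tau> l)) * ?\<Phi> \<tau> (\<lambda>\<sigma>\<in>configs N. G N p \<sigma> \<omega>)) \<partial>M) =
      of_real (replica_weight M N (H N) {1..n} \<tau> * ((\<Prod>l=1..n. \<Prod>i\<in>C l. \<tau> l (\<kappa> i)) *
      exp (- (\<Sum>l=1..n. \<Sum>l'=1..n. \<theta> l * \<theta> l' * overlap N (\<tau> l) (\<tau> l') ^ p) / 2)))"
      unfolding integral_mult_right_zero expectation_tuple_weight_G(1)[where \<Phi>="?\<Phi> \<tau>", OF N \<Phi>[OF \<tau>] \<Phi>1[of _ \<tau>] \<tau>] int\<Phi>[OF \<tau>] of_real_mult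
      by (simp only: mult_ac)
  qed
  finally show ?thesis by (simp only: of_real_sum)
qed

text \<open>At fixed sites the moment involves individual spins. Averaging over all
  \<open>\<kappa>\<close> turns the spin product into the product of overlaps, while the Gaussian
  factor does not depend on \<open>\<kappa>\<close>.\<close>

lemma gibbs_char_moment_average:
  assumes N: "1 \<le> N" "1 \<le> p" and I: "finite I" "\<And>l. C l \<subseteq> I" and C: "\<And>l. q < l \<Longrightarrow> C l = {}"
  shows "(\<Sum>\<kappa>\<in>I \<rightarrow>\<^sub>E {1..N}. gaussian_tilt.char_moment M (gibbs N) (neg_G N p)
      (site_spins C \<kappa>) n \<theta>) / of_nat (card (I \<rightarrow>\<^sub>E {1..N})) =
    of_real (\<integral>\<tau>. overlap_exponential p n \<theta> I (\<lambda>i. {l \<in> {1..n}. i \<in> C l}) (\<lambda>L. set_overlap N L \<tau>) \<partial>replica_space N (H N) {1..n})"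
proof -
  let ?K = "I \<rightarrow>\<^sub>E {1..N}" and ?T = "{1..n} \<rightarrow>\<^sub>E configs N" and ?L = "\<lambda>i. {l \<in> {1..n}. i \<in> C l}"
  let ?W = "replica_weight M N (H N) {1..n}"
  let ?E = "\<lambda>\<tau>. exp (- (\<Sum>l=1..n. \<Sum>l'=1..n. \<theta> l * \<theta> l' * overlap N (\<tau> l) (\<tau> l') ^ p) / 2)"
  let ?c = "\<lambda>\<kappa>. gaussian_tilt.char_moment M (gibbs N) (neg_G N p) (site_spins C \<kappa>) n \<theta>"
  have c: "?c \<kappa> = of_real (\<Sum>\<tau>\<in>?T. ?W \<tau> * ((\<Prod>l=1..n. \<Prod>i\<in>C l. \<tau> l (\<kappa> i)) * ?E \<tau>))" if "\<kappa> \<in> ?K" for \<kappa>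
    by (rule gibbs_char_moment[OF N _ C]) (use PiE_mem[OF that] I in auto)
  have exp_eq: "overlap_exponential p n \<theta> I ?L (\<lambda>L. set_overlap N L \<tau>) = (\<Prod>i\<in>I. set_overlap N (?L i) \<tau>) * ?E \<tau>"
    if "\<tau> \<in> ?T" for \<tau>
  proof (rule overlap_exponential_eq)
    fix l assume "l \<in> {1..n}"
    then show "overlap N (\<tau> l) (\<tau> l) ^ p = 1" using PiE_mem[OF that] N by (simp add: overlap_self)
  next
    fix l l' :: nat assume "l \<noteq> l'"
    then show "overlap N (\<tau> l) (\<tau> l') ^ p = set_overlap N {l, l'} \<tau> ^ p"
      by (simp add: overlap_def set_overlap_def)
  qed
  have "(\<Sum>\<kappa>\<in>?K. ?c \<kappa>) / of_nat (card ?K) =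
    of_real ((\<Sum>\<kappa>\<in>?K. \<Sum>\<tau>\<in>?T. ?W \<tau> * ((\<Prod>l=1..n. \<Prod>i\<in>C l. \<tau> l (\<kappa> i)) * ?E \<tau>)) / real (card ?K))"
    by (simp add: c)
  also have "(\<Sum>\<kappa>\<in>?K. \<Sum>\<tau>\<in>?T. ?W \<tau> * ((\<Prod>l=1..n. \<Prod>i\<in>C l. \<tau> l (\<kappa> i)) * ?E \<tau>)) / real (card ?K) =
    (\<Sum>\<tau>\<in>?T. ?W \<tau> * (((\<Sum>\<kappa>\<in>?K. \<Prod>i\<in>I. \<Prod>l\<in>?L i. \<tau> l (\<kappa> i)) / real (card ?K)) * ?E \<tau>))"
    unfolding prod_swap_sites[OF I] by (subst sum.swap) (simp add: sum_divide_distrib sum_distrib_left sum_distrib_right)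
  also have "\<dots> = (\<Sum>\<tau>\<in>?T. ?W \<tau> *\<^sub>R overlap_exponential p n \<theta> I ?L (\<lambda>L. set_overlap N L \<tau>))"
    by (intro sum.cong refl) (simp only: exp_eq prod_set_overlap_eq_average[OF I(1)] real_scaleR_def)
  finally show ?thesis by (simp only: integral_replica_space[OF finite_atLeastAtMost])
qed

text \<open>The Gibbs measure of \<open>H + t * G\<close> is that of \<open>H\<close> reweighted by
  \<open>exp (- t * G)\<close>; the partition function of \<open>H\<close> cancels. For fixed
  \<open>\<omega>\<close> the \<open>q\<close> replicas are independent, so their average splits
  into the \<open>q\<close> quotients that form a tilt.\<close>

lemma annealed_average_tilt:
  assumes N: "1 \<le> N" "1 \<le> p" and I: "finite I" "\<And>l. C l \<subseteq> I" and C: "\<And>l. q < l \<Longrightarrow> C l = {}"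
  shows "annealed_average M N (\<lambda>\<omega> \<sigma>. H N \<omega> \<sigma> + t * G N p \<sigma> \<omega>) (\<lambda>s. \<Prod>i\<in>I. set_overlap N {l \<in> {1..q}. i \<in> C l} s) =
    (\<Sum>\<kappa>\<in>I \<rightarrow>\<^sub>E {1..N}. gaussian_tilt.tilt M (gibbs N) (neg_G N p)
      (site_spins C \<kappa>) q (\<lambda>x. exp (t * x))) / real (card (I \<rightarrow>\<^sub>E {1..N}))"
proof -
  let ?K = "I \<rightarrow>\<^sub>E {1..N}" and ?T = "{1..q} \<rightarrow>\<^sub>E configs N" and ?L = "\<lambda>i. {l \<in> {1..q}. i \<in> C l}"
  let ?e = "\<lambda>x. exp (t * x)"
  let ?f = "\<lambda>s. \<Prod>i\<in>I. set_overlap N (?L i) s"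
  let ?avg = "\<lambda>\<kappa> l. gaussian_tilt.avg (gibbs N) (neg_G N p) (site_spins C \<kappa>) l ?e"
  let ?mass = "gaussian_tilt.mass (gibbs N) (neg_G N p) ?e"
  let ?w = "\<lambda>\<omega>. gibbs_weight N (\<lambda>\<sigma>. H N \<omega> \<sigma> + t * G N p \<sigma> \<omega>)"
  have T: "gaussian_tilt M (gibbs N) (neg_G N p) (site_spins C \<kappa>) q"
    if "\<kappa> \<in> ?K" for \<kappa>
    by (rule gibbs_tilt[OF N _ C]) (use PiE_mem[OF that] I in auto)
  have w: "?w \<omega> \<sigma> = gibbs_weight N (H N \<omega>) \<sigma> * exp (t * - G N p \<sigma> \<omega>) /
      (\<Sum>\<tau>\<in>configs N. gibbs_weight N (H N \<omega>) \<tau> * exp (t * - G N p \<tau> \<omega>))" for \<omega> \<sigma>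
  proof -
    define Z where "Z = (\<Sum>\<tau>\<in>configs N. exp (- H N \<omega> \<tau>))"
    have Z: "0 < Z" unfolding Z_def by (rule partition_pos)
    have e: "gibbs_weight N (H N \<omega>) \<tau> * exp (t * - G N p \<tau> \<omega>) = exp (- (H N \<omega> \<tau> + t * G N p \<tau> \<omega>)) / Z" for \<tau>
      unfolding gibbs_weight_def Z_def[symmetric] by (simp add: exp_diff exp_minus divide_inverse exp_add mult_ac)
    show ?thesis
      unfolding e sum_divide_distrib[symmetric] using Z by (simp add: gibbs_weight_def)
  qed
  have ratio: "(\<Sum>\<sigma>\<in>configs N. ?w \<omega> \<sigma> * (\<Prod>i\<in>C l. \<sigma> (\<kappa> i))) = ?avg \<kappa> l \<omega> / ?mass \<omega>" if "\<kappa> \<in> ?K" for \<kappa> l \<omega>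
    unfolding gaussian_tilt.avg_def[OF T[OF that]] gaussian_tilt.mass_def[OF T[OF that]] integral_gibbs_measure w
    by (simp add: sum_divide_distrib mult_ac)
  have ga: "gibbs_average N (\<lambda>\<sigma>. H N \<omega> \<sigma> + t * G N p \<sigma> \<omega>) ?f = (\<Sum>\<kappa>\<in>?K. \<Prod>l=1..q. ?avg \<kappa> l \<omega> / ?mass \<omega>) / real (card ?K)" for \<omega>
  proof -
    have "gibbs_average N (\<lambda>\<sigma>. H N \<omega> \<sigma> + t * G N p \<sigma> \<omega>) ?f = (\<Sum>\<tau>\<in>?T. (\<Prod>l\<in>{1..q}. ?w \<omega> (\<tau> l)) * ?f \<tau>)"
      by (rule gibbs_average_finite) (auto simp: set_overlap_def intro!: prod.cong sum.cong)
    also have "\<dots> = (\<Sum>\<kappa>\<in>?K. \<Sum>\<tau>\<in>?T. (\<Prod>l=1..q. ?w \<omega> (\<tau> l) * (\<Prod>i\<in>C l. \<tau> l (\<kappa> i)))) / real (card ?K)"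
      unfolding prod_set_overlap_eq_average[OF I(1)] prod.distrib prod_swap_sites[OF I]
      by (subst sum.swap) (simp add: sum_divide_distrib sum_distrib_left)
    also have "(\<Sum>\<kappa>\<in>?K. \<Sum>\<tau>\<in>?T. (\<Prod>l=1..q. ?w \<omega> (\<tau> l) * (\<Prod>i\<in>C l. \<tau> l (\<kappa> i)))) = (\<Sum>\<kappa>\<in>?K. \<Prod>l=1..q. ?avg \<kappa> l \<omega> / ?mass \<omega>)"
    proof (rule sum.cong[OF refl])
      fix \<kappa> assume \<kappa>: "\<kappa> \<in> ?K"
      have "(\<Sum>\<tau>\<in>?T. (\<Prod>l=1..q. ?w \<omega> (\<tau> l) * (\<Prod>i\<in>C l. \<tau> l (\<kappa> i)))) = (\<Prod>l=1..q. \<Sum>\<sigma>\<in>configs N. ?w \<omega> \<sigma> * (\<Prod>i\<in>C l. \<sigma> (\<kappa> i)))"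
        by (rule prod_sum_PiE[symmetric]) (auto simp: finite_configs)
      then show "(\<Sum>\<tau>\<in>?T. (\<Prod>l=1..q. ?w \<omega> (\<tau> l) * (\<Prod>i\<in>C l. \<tau> l (\<kappa> i)))) = (\<Prod>l=1..q. ?avg \<kappa> l \<omega> / ?mass \<omega>)"
        by (simp only: ratio[OF \<kappa>])
    qed
    finally show ?thesis .
  qed
  have int: "integrable M (\<lambda>\<omega>. \<Prod>l=1..q. ?avg \<kappa> l \<omega> / ?mass \<omega>)" if "\<kappa> \<in> ?K" for \<kappa>
    using gaussian_tilt.tilt_integrable[OF T[OF that], of ?e] by simp
  have "annealed_average M N (\<lambda>\<omega> \<sigma>. H N \<omega> \<sigma> + t * G N p \<sigma> \<omega>) ?f =
    (\<Sum>\<kappa>\<in>?K. \<integral>\<omega>. (\<Prod>l=1..q. ?avg \<kappa> l \<omega> / ?mass \<omega>) \<partial>M) / real (card ?K)"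
  proof -
    have "(\<integral>\<omega>. (\<Sum>\<kappa>\<in>?K. \<Prod>l=1..q. ?avg \<kappa> l \<omega> / ?mass \<omega>) \<partial>M) = (\<Sum>\<kappa>\<in>?K. \<integral>\<omega>. (\<Prod>l=1..q. ?avg \<kappa> l \<omega> / ?mass \<omega>) \<partial>M)"
      by (rule Bochner_Integration.integral_sum) (rule int)
    then show ?thesis unfolding annealed_average_def ga by (simp only: integral_divide_zero)
  qed
  then show ?thesis by (simp add: gaussian_tilt.tilt_def[OF T])
qed

end

section \<open>The limiting model\<close>

lemma space_unit_uniform[simp]: "space unit_uniform = {0..1}"
  unfolding unit_uniform_def by (simp add: space_restrict_space)

lemma prob_space_unit_uniform: "prob_space unit_uniform"
  by (rule prob_spaceI) (simp add: unit_uniform_def emeasure_restrict_space space_restrict_space)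

abbreviation uniform_sequence :: "(nat \<Rightarrow> real) measure" where
  "uniform_sequence \<equiv> PiM {1..} (\<lambda>_. unit_uniform)"

lemma prob_space_uniform_sequence: "prob_space uniform_sequence"
  by (intro prob_space_PiM prob_space_unit_uniform)

lemma measurable_sequence_component:
  "f \<in> Q \<rightarrow>\<^sub>M uniform_sequence \<Longrightarrow> 1 \<le> i \<Longrightarrow> (\<lambda>x. f x i) \<in> Q \<rightarrow>\<^sub>M unit_uniform"
  by (rule measurable_compose[OF _ measurable_component_singleton]) auto

lemma space_PiM_uniform_component:
  "f \<in> space (PiM I (\<lambda>_. unit_uniform)) \<Longrightarrow> i \<in> I \<Longrightarrow> f i \<in> {0..1}"
  unfolding space_PiM space_unit_uniform by (rule PiE_mem)

lemma sequence_component_mem: "f \<in> space uniform_sequence \<Longrightarrow> 1 \<le> i \<Longrightarrow> f i \<in> {0..1}"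
  by (rule space_PiM_uniform_component[where I="{1..}"]) (assumption, simp)

text \<open>Spins, phases and overlaps of the limiting model are bounded by \<open>1\<close>, so
  Fubini's theorem applies to them in this form.\<close>

lemma
  fixes F :: "'a \<times> 'b \<Rightarrow> 'c::{banach, second_countable_topology}"
  assumes "prob_space A" "prob_space B" "F \<in> borel_measurable (A \<Otimes>\<^sub>M B)"
    and bound: "\<And>a b. a \<in> space A \<Longrightarrow> b \<in> space B \<Longrightarrow> norm (F (a, b)) \<le> 1"
  shows integral_pair_bounded: "(\<integral>x. F x \<partial>(A \<Otimes>\<^sub>M B)) = (\<integral>a. \<integral>b. F (a, b) \<partial>B \<partial>A)"
    and integral_pair_bounded_swap: "(\<integral>a. \<integral>b. F (a, b) \<partial>B \<partial>A) = (\<integral>b. \<integral>a. F (a, b) \<partial>A \<partial>B)"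
proof -
  interpret A: prob_space A by fact
  interpret B: prob_space B by fact
  interpret pair_prob_space A B ..
  have int: "integrable (A \<Otimes>\<^sub>M B) F"
    by (rule integrable_const_bound[where B=1]) (use assms in \<open>auto simp: space_pair_measure\<close>)
  then show "(\<integral>x. F x \<partial>(A \<Otimes>\<^sub>M B)) = (\<integral>a. \<integral>b. F (a, b) \<partial>B \<partial>A)" by (rule integral_fst'[symmetric])
  show "(\<integral>a. \<integral>b. F (a, b) \<partial>B \<partial>A) = (\<integral>b. \<integral>a. F (a, b) \<partial>A \<partial>B)"
    using int by (intro Fubini_integral[symmetric, where f="\<lambda>a b. F (a, b)"]) simp
qed

lemma integral_PiM_prod:
  fixes f :: "'i \<Rightarrow> 'a \<Rightarrow> 'c::{real_normed_field, banach, second_countable_topology}"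
  assumes "\<And>i. prob_space (A i)" and J: "finite J" "J \<subseteq> I" and f: "\<And>j. j \<in> J \<Longrightarrow> integrable (A j) (f j)"
  shows "(\<integral>x. (\<Prod>j\<in>J. f j (x j)) \<partial>PiM I A) = (\<Prod>j\<in>J. \<integral>y. f j y \<partial>A j)"
proof -
  interpret product_prob_space A I by (rule product_prob_spaceI) fact
  have "(\<integral>x. (\<Prod>j\<in>J. f j (x j)) \<partial>PiM I A) = (\<integral>x. (\<Prod>j\<in>J. f j (restrict x J j)) \<partial>PiM I A)"
    by simp
  also have "\<dots> = (\<integral>x. (\<Prod>j\<in>J. f j (x j)) \<partial>distr (PiM I A) (PiM J A) (\<lambda>x. restrict x J))"
  proof (rule integral_distr[symmetric])
    show "(\<lambda>x. restrict x J) \<in> PiM I A \<rightarrow>\<^sub>M PiM J A" by (rule measurable_restrict_subset[OF J(2)])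
    show "(\<lambda>x. \<Prod>j\<in>J. f j (x j)) \<in> borel_measurable (PiM J A)"
      by (intro borel_measurable_integrable product_integrable_prod J f)
  qed
  also have "\<dots> = (\<Prod>j\<in>J. \<integral>y. f j y \<partial>A j)"
    unfolding distr_PiM_restrict_finite[OF J] by (rule product_integral_prod[OF J(1) f])
  finally show ?thesis .
qed

text \<open>The counterpart of \<open>set_overlap\<close>: the mean over sites becomes the integral
  over \<open>v\<close>. Distinct replicas at one site have independent variables \<open>x\<close>,
  which is why spins enter through their means.\<close>

definition limit_overlap :: "(real \<Rightarrow> real \<Rightarrow> real \<Rightarrow> real) \<Rightarrow> nat set \<Rightarrow> real \<times> (nat \<Rightarrow> real) \<Rightarrow> real" where
  "limit_overlap sb L = (\<lambda>(w, u). \<integral>v. (\<Prod>l\<in>L. sb w (u l) v) \<partial>unit_uniform)"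

locale spin_function =
  fixes \<sigma> :: "real \<Rightarrow> real \<Rightarrow> real \<Rightarrow> real \<Rightarrow> real"
  assumes spin_measurable: "(\<lambda>(w, u, v, x). \<sigma> w u v x)
    \<in> unit_uniform \<Otimes>\<^sub>M unit_uniform \<Otimes>\<^sub>M unit_uniform \<Otimes>\<^sub>M unit_uniform \<rightarrow>\<^sub>M count_space {-1, 1}"
begin

abbreviation "sb \<equiv> spin_mean \<sigma>"

sublocale U: prob_space unit_uniform by (rule prob_space_unit_uniform)

lemma measurable_spin:
  assumes "f1 \<in> Q \<rightarrow>\<^sub>M unit_uniform" "f2 \<in> Q \<rightarrow>\<^sub>M unit_uniform" "f3 \<in> Q \<rightarrow>\<^sub>M unit_uniform" "f4 \<in> Q \<rightarrow>\<^sub>M unit_uniform"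
  shows "(\<lambda>q. \<sigma> (f1 q) (f2 q) (f3 q) (f4 q)) \<in> Q \<rightarrow>\<^sub>M count_space {-1, 1}"
  using measurable_compose[OF measurable_Pair[OF assms(1) measurable_Pair[OF assms(2) measurable_Pair[OF assms(3,4)]]] spin_measurable]
  by simp

lemma borel_measurable_spin:
  assumes "f1 \<in> Q \<rightarrow>\<^sub>M unit_uniform" "f2 \<in> Q \<rightarrow>\<^sub>M unit_uniform" "f3 \<in> Q \<rightarrow>\<^sub>M unit_uniform" "f4 \<in> Q \<rightarrow>\<^sub>M unit_uniform"
  shows "(\<lambda>q. \<sigma> (f1 q) (f2 q) (f3 q) (f4 q)) \<in> borel_measurable Q"
  by (rule measurable_compose[OF measurable_spin[OF assms]]) simp

lemma abs_spin:
  assumes "w \<in> {0..1}" "u \<in> {0..1}" "v \<in> {0..1}" "x \<in> {0..1}"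
  shows "\<bar>\<sigma> w u v x\<bar> = 1"
  using measurable_space[OF spin_measurable, of "(w, u, v, x)"] assms by (auto simp: space_pair_measure)

lemma borel_measurable_sb:
  assumes "f1 \<in> Q \<rightarrow>\<^sub>M unit_uniform" "f2 \<in> Q \<rightarrow>\<^sub>M unit_uniform" "f3 \<in> Q \<rightarrow>\<^sub>M unit_uniform"
  shows "(\<lambda>q. sb (f1 q) (f2 q) (f3 q)) \<in> borel_measurable Q"
  unfolding spin_mean_def
  by (rule U.borel_measurable_lebesgue_integral)
    (simp add: split_def, intro borel_measurable_spin measurable_compose[OF measurable_fst] assms measurable_snd)

lemma abs_sb_le_1:
  assumes "w \<in> {0..1}" "u \<in> {0..1}" "v \<in> {0..1}"
  shows "\<bar>sb w u v\<bar> \<le> 1"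
  unfolding spin_mean_def by (rule U.integral_abs_le_const) (use assms abs_spin in auto)

lemma abs_prod_sb_le_1:
  assumes "w \<in> {0..1}" "\<And>l. l \<in> L \<Longrightarrow> u l \<in> {0..1}" "\<And>l. l \<in> L \<Longrightarrow> v l \<in> {0..1}"
  shows "\<bar>\<Prod>l\<in>L. sb w (u l) (v l)\<bar> \<le> 1"
  unfolding abs_prod by (intro prod_le_1) (use abs_sb_le_1 assms in auto)

abbreviation "limit_space \<equiv> unit_uniform \<Otimes>\<^sub>M uniform_sequence"

lemma prob_space_limit_space: "prob_space limit_space"
  by (rule prob_space_pair[OF prob_space_unit_uniform prob_space_uniform_sequence])

lemma limit_overlap_measurable:
  assumes "L \<subseteq> {1..}"
  shows "limit_overlap sb L \<in> borel_measurable limit_space"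
  unfolding limit_overlap_def split_def
proof (rule U.borel_measurable_lebesgue_integral, simp only: split_def, rule borel_measurable_prod)
  fix l assume "l \<in> L"
  then have "1 \<le> l" using assms by auto
  then show "(\<lambda>x. sb (fst (fst x)) (snd (fst x) l) (snd x)) \<in> borel_measurable (limit_space \<Otimes>\<^sub>M unit_uniform)"
    by (intro borel_measurable_sb measurable_sequence_component measurable_snd
        measurable_compose[OF measurable_fst measurable_fst] measurable_compose[OF measurable_fst measurable_snd])
qed

lemma limit_overlap_le_1:
  assumes "L \<subseteq> {1..}" "x \<in> space limit_space"
  shows "\<bar>limit_overlap sb L x\<bar> \<le> 1"
proof -
  obtain w u where x: "x = (w, u)" by (cases x)
  have "w \<in> {0..1}" "u \<in> space uniform_sequence" using assms(2) unfolding x by (auto simp: space_pair_measure)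
  then show ?thesis
    unfolding x limit_overlap_def prod.case
    using assms(1) sequence_component_mem
    by (intro U.integral_abs_le_const abs_prod_sb_le_1) auto
qed

text \<open>The sites \<open>Suc j\<close> are distinct, so every entry in the product has its own
  variable \<open>x\<close> and every site its own \<open>v\<close>. Integrating \<open>x\<close>
  replaces the spins by their means, and integrating \<open>v\<close> gives one overlap per
  site.\<close>

lemma array_moment:
  fixes n :: nat and L :: "nat \<Rightarrow> nat set"
  assumes \<mu>: "\<mu> = distr
       (unit_uniform \<Otimes>\<^sub>M uniform_sequence \<Otimes>\<^sub>M uniform_sequence \<Otimes>\<^sub>M (\<Pi>\<^sub>M j\<in>array_indices. unit_uniform))
       array_space
       (\<lambda>(w, u, v, x). \<lambda>(i, l)\<in>array_indices. \<sigma> w (u l) (v i) (x (i, l)))"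
    and L: "\<And>j. j < n \<Longrightarrow> finite (L j) \<and> L j \<subseteq> {1..}"
  shows "(\<integral>x. (\<Prod>j<n. \<Prod>l\<in>L j. x (Suc j, l)) \<partial>\<mu>) = (\<integral>y. (\<Prod>j<n. limit_overlap sb (L j) y) \<partial>limit_space)"
proof -
  let ?X = "PiM array_indices (\<lambda>_. unit_uniform)"
  let ?S = "Sigma {..<n} L"
  have finS: "finite ?S" using L by auto
  have pX: "prob_space ?X" by (intro prob_space_PiM prob_space_unit_uniform)
  have p2: "prob_space (uniform_sequence \<Otimes>\<^sub>M ?X)" by (rule prob_space_pair[OF prob_space_uniform_sequence pX])
  have p3: "prob_space (uniform_sequence \<Otimes>\<^sub>M uniform_sequence \<Otimes>\<^sub>M ?X)"
    by (rule prob_space_pair[OF prob_space_uniform_sequence p2])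
  let ?\<Phi> = "\<lambda>(w, u, v, x). \<lambda>(i, l)\<in>array_indices. \<sigma> w (u l) (v i) (x (i, l))"
  let ?P = "unit_uniform \<Otimes>\<^sub>M uniform_sequence \<Otimes>\<^sub>M uniform_sequence \<Otimes>\<^sub>M ?X"
  let ?T = "\<lambda>w u v x. \<Prod>(j, l)\<in>?S. \<sigma> w (u l) (v (Suc j)) (x (Suc j, l))"
  have coord: "(\<lambda>q. q j) \<in> ?X \<rightarrow>\<^sub>M unit_uniform" if "j \<in> array_indices" for j
    using that by (rule measurable_component_singleton)
  have entry: "(\<lambda>q. \<sigma> (fst q) (fst (snd q) l) (fst (snd (snd q)) i) (snd (snd (snd q)) (i, l))) \<in> ?P \<rightarrow>\<^sub>M count_space {-1, 1}"
    if "1 \<le> i" "1 \<le> l" for i l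
    using that
    by (intro measurable_spin measurable_sequence_component measurable_fst
        measurable_compose[OF measurable_snd measurable_fst]
        measurable_compose[OF measurable_compose[OF measurable_snd measurable_snd] measurable_fst]
        measurable_compose[OF measurable_compose[OF measurable_compose[OF measurable_snd measurable_snd] measurable_snd] coord]) auto
  \<comment> \<open>The array space admits the padding value \<open>0\<close> besides the two spin
    values.\<close>
  have cnt: "id \<in> count_space {-1, 1::real} \<rightarrow>\<^sub>M count_space {-1, 0, 1}" by auto
  have \<Phi>: "?\<Phi> \<in> ?P \<rightarrow>\<^sub>M array_space"
    unfolding array_space_def split_def
  proof (rule measurable_restrict)
    fix j :: "nat \<times> nat" assume "j \<in> array_indices"
    then have "1 \<le> fst j" "1 \<le> snd j" by auto
    from measurable_compose[OF entry[OF this] cnt]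
    show "(\<lambda>q. \<sigma> (fst q) (fst (snd q) (snd j)) (fst (snd (snd q)) (fst j)) (snd (snd (snd q)) (fst j, snd j))) \<in> ?P \<rightarrow>\<^sub>M count_space {-1, 0, 1}"
      by simp
  qed
  have fm: "(\<lambda>x. \<Prod>j<n. \<Prod>l\<in>L j. x (Suc j, l)) \<in> borel_measurable array_space"
  proof (intro borel_measurable_prod)
    fix j l assume "j \<in> {..<n}" "l \<in> L j"
    then have "(Suc j, l) \<in> array_indices" using L[of j] by auto
    from measurable_component_singleton[OF this, of "\<lambda>_. count_space {-1, 0, 1::real}"]
    have "(\<lambda>x. x (Suc j, l)) \<in> array_space \<rightarrow>\<^sub>M count_space {-1, 0, 1}" unfolding array_space_def .
    from measurable_compose[OF this, of "\<lambda>x. x" borel] show "(\<lambda>x. x (Suc j, l)) \<in> borel_measurable array_space" by simp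
  qed
  have Sig: "(\<Prod>j<n. \<Prod>l\<in>L j. F j l) = (\<Prod>(j, l)\<in>?S. F j l)" for F :: "nat \<Rightarrow> nat \<Rightarrow> real"
    by (rule prod.Sigma) (use L in auto)
  have val: "(\<Prod>j<n. \<Prod>l\<in>L j. ?\<Phi> q (Suc j, l)) = ?T (fst q) (fst (snd q)) (fst (snd (snd q))) (snd (snd (snd q)))" for q
    unfolding Sig 
  proof (intro prod.cong refl)
    fix s assume "s \<in> ?S"
    then have "(Suc (fst s), snd s) \<in> array_indices" using L[of "fst s"] by auto
    then show "(case s of (j, l) \<Rightarrow> ?\<Phi> q (Suc j, l)) = (case s of (j, l) \<Rightarrow>
      \<sigma> (fst q) (fst (snd q) l) (fst (snd (snd q)) (Suc j)) (snd (snd (snd q)) (Suc j, l)))"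
      by (simp add: split_def)
  qed
  have Tm: "(\<lambda>q. ?T (fst q) (fst (snd q)) (fst (snd (snd q))) (snd (snd (snd q)))) \<in> borel_measurable ?P"
    using measurable_compose[OF \<Phi> fm] unfolding val .
  have T1: "\<bar>?T w u v x\<bar> \<le> 1"
    if "w \<in> {0..1}" "u \<in> space uniform_sequence" "v \<in> space uniform_sequence" "x \<in> space ?X" for w u v x
  proof -
    have "\<bar>\<sigma> w (u l) (v (Suc j)) (x (Suc j, l))\<bar> = 1" if "(j, l) \<in> ?S" for j l
    proof -
      have "(Suc j, l) \<in> array_indices" using that L[of j] by auto
      then have "x (Suc j, l) \<in> {0..1}" by (rule space_PiM_uniform_component[OF \<open>x \<in> space ?X\<close>])
      then show ?thesis using \<open>(Suc j, l) \<in> array_indices\<close> that L \<open>w \<in> {0..1}\<close>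
          sequence_component_mem[OF \<open>u \<in> space uniform_sequence\<close>, of l] sequence_component_mem[OF \<open>v \<in> space uniform_sequence\<close>, of "Suc j"]
        by (intro abs_spin) auto
    qed
    then show ?thesis unfolding abs_prod by (intro prod_le_1) auto
  qed
  have "(\<integral>x. (\<Prod>j<n. \<Prod>l\<in>L j. x (Suc j, l)) \<partial>\<mu>) = (\<integral>q. ?T (fst q) (fst (snd q)) (fst (snd (snd q))) (snd (snd (snd q))) \<partial>?P)"
    unfolding \<mu> integral_distr[OF \<Phi> fm] val ..
  also have "\<dots> = (\<integral>w. \<integral>q. ?T w (fst q) (fst (snd q)) (snd (snd q)) \<partial>(uniform_sequence \<Otimes>\<^sub>M uniform_sequence \<Otimes>\<^sub>M ?X) \<partial>unit_uniform)"
    by (subst integral_pair_bounded[OF prob_space_unit_uniform p3 Tm])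
      (simp_all only: fst_conv snd_conv real_norm_def, rule T1, simp_all add: space_pair_measure mem_Times_iff del: One_nat_def)
  also have "\<dots> = (\<integral>w. \<integral>u. (\<Prod>j<n. limit_overlap sb (L j) (w, u)) \<partial>uniform_sequence \<partial>unit_uniform)"
  proof (rule Bochner_Integration.integral_cong[OF refl])
    fix w assume "w \<in> space unit_uniform"
    then have w: "w \<in> {0..1}" by simp
    have Tm1: "(\<lambda>q. ?T w (fst q) (fst (snd q)) (snd (snd q))) \<in> borel_measurable (uniform_sequence \<Otimes>\<^sub>M uniform_sequence \<Otimes>\<^sub>M ?X)"
      using measurable_compose[OF measurable_Pair1' Tm, of w] w by simp
    have "(\<integral>q. ?T w (fst q) (fst (snd q)) (snd (snd q)) \<partial>(uniform_sequence \<Otimes>\<^sub>M uniform_sequence \<Otimes>\<^sub>M ?X)) =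
      (\<integral>u. \<integral>q. ?T w u (fst q) (snd q) \<partial>(uniform_sequence \<Otimes>\<^sub>M ?X) \<partial>uniform_sequence)"
      by (subst integral_pair_bounded[OF prob_space_uniform_sequence p2 Tm1])
        (simp_all only: fst_conv snd_conv real_norm_def, rule T1[OF w], simp_all add: space_pair_measure mem_Times_iff del: One_nat_def)
    also have "\<dots> = (\<integral>u. (\<Prod>j<n. limit_overlap sb (L j) (w, u)) \<partial>uniform_sequence)"
    proof (rule Bochner_Integration.integral_cong[OF refl])
      fix u assume u: "u \<in> space uniform_sequence"
      have Tm2: "(\<lambda>q. ?T w u (fst q) (snd q)) \<in> borel_measurable (uniform_sequence \<Otimes>\<^sub>M ?X)"
        using measurable_compose[OF measurable_Pair1' Tm1, of u] u by simp
      have "(\<integral>q. ?T w u (fst q) (snd q) \<partial>(uniform_sequence \<Otimes>\<^sub>M ?X)) = (\<integral>v. \<integral>x. ?T w u v x \<partial>?X \<partial>uniform_sequence)"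
        by (subst integral_pair_bounded[OF prob_space_uniform_sequence pX Tm2])
          (simp_all only: fst_conv snd_conv real_norm_def, rule T1[OF w u])
      also have "\<dots> = (\<integral>v. (\<Prod>j<n. \<Prod>l\<in>L j. sb w (u l) (v (Suc j))) \<partial>uniform_sequence)"
      proof (rule Bochner_Integration.integral_cong[OF refl])
        fix v assume v: "v \<in> space uniform_sequence"
        \<comment> \<open>Each \<open>L j\<close> is a set, so no entry is repeated and the integral
          over the array factors entry by entry.\<close>
        let ?D = "(\<lambda>(j, l). (Suc j, l)) ` ?S"
        have inj: "inj_on (\<lambda>(j, l). (Suc j, l)) ?S" by (auto simp: inj_on_def)
        have "(\<integral>x. ?T w u v x \<partial>?X) = (\<integral>x. (\<Prod>d\<in>?D. \<sigma> w (u (snd d)) (v (fst d)) (x d)) \<partial>?X)"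
          by (subst prod.reindex[OF inj]) (simp add: split_def)
        also have "\<dots> = (\<Prod>d\<in>?D. sb w (u (snd d)) (v (fst d)))"
          unfolding spin_mean_def
        proof (rule integral_PiM_prod[OF prob_space_unit_uniform])
          show "finite ?D" using finS by simp
          show "?D \<subseteq> array_indices" using L by auto
          fix d assume "d \<in> ?D"
          then have d: "1 \<le> fst d" "1 \<le> snd d" using L by fastforce+
          have c: "u (snd d) \<in> {0..1}" "v (fst d) \<in> {0..1}"
            using sequence_component_mem u v d by auto
          show "integrable unit_uniform (\<lambda>x. \<sigma> w (u (snd d)) (v (fst d)) x)"
          proof (rule U.integrable_const_bound[where B=1])
            show "AE x in unit_uniform. norm (\<sigma> w (u (snd d)) (v (fst d)) x) \<le> 1"
              using abs_spin[OF w c] by (intro AE_I2) auto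
            show "(\<lambda>x. \<sigma> w (u (snd d)) (v (fst d)) x) \<in> borel_measurable unit_uniform"
              using w c by (intro borel_measurable_spin measurable_const measurable_ident) auto
          qed
        qed
        also have "\<dots> = (\<Prod>j<n. \<Prod>l\<in>L j. sb w (u l) (v (Suc j)))"
          unfolding Sig by (subst prod.reindex[OF inj]) (simp add: split_def)
        finally show "(\<integral>x. ?T w u v x \<partial>?X) = (\<Prod>j<n. \<Prod>l\<in>L j. sb w (u l) (v (Suc j)))" .
      qed
      also have "\<dots> = (\<integral>v. (\<Prod>i\<in>Suc ` {..<n}. (\<lambda>y. \<Prod>l\<in>L (i - 1). sb w (u l) y) (v i)) \<partial>uniform_sequence)"
        by (simp add: prod.reindex)
      also have "\<dots> = (\<Prod>i\<in>Suc ` {..<n}. \<integral>y. (\<Prod>l\<in>L (i - 1). sb w (u l) y) \<partial>unit_uniform)"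
      proof (rule integral_PiM_prod[OF prob_space_unit_uniform])
        fix i assume "i \<in> Suc ` {..<n}"
        then obtain j where "i = Suc j" "j < n" by auto
        then have Li: "L (i - 1) \<subseteq> {1..}" using L[of j] by simp
        have c: "u l \<in> {0..1}" if "l \<in> L (i - 1)" for l
          using sequence_component_mem[OF u, of l] Li that by auto
        show "integrable unit_uniform (\<lambda>y. \<Prod>l\<in>L (i - 1). sb w (u l) y)"
        proof (rule U.integrable_const_bound[where B=1])
          show "AE y in unit_uniform. norm (\<Prod>l\<in>L (i - 1). sb w (u l) y) \<le> 1"
            unfolding real_norm_def using w c by (intro AE_I2 abs_prod_sb_le_1) auto
          show "(\<lambda>y. \<Prod>l\<in>L (i - 1). sb w (u l) y) \<in> borel_measurable unit_uniform"
            using w c by (intro borel_measurable_prod borel_measurable_sb measurable_const measurable_ident) auto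
        qed
      qed auto
      also have "\<dots> = (\<Prod>j<n. limit_overlap sb (L j) (w, u))"
        by (simp add: prod.reindex limit_overlap_def)
      finally show "(\<integral>q. ?T w u (fst q) (snd q) \<partial>(uniform_sequence \<Otimes>\<^sub>M ?X)) = (\<Prod>j<n. limit_overlap sb (L j) (w, u))" .
    qed
    finally show "(\<integral>q. ?T w (fst q) (fst (snd q)) (snd (snd q)) \<partial>(uniform_sequence \<Otimes>\<^sub>M uniform_sequence \<Otimes>\<^sub>M ?X)) =
      (\<integral>u. (\<Prod>j<n. limit_overlap sb (L j) (w, u)) \<partial>uniform_sequence)" .
  qed
  also have "\<dots> = (\<integral>y. (\<Prod>j<n. limit_overlap sb (L j) y) \<partial>limit_space)"
  proof (rule integral_pair_bounded[OF prob_space_unit_uniform prob_space_uniform_sequence, symmetric])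
    show "(\<lambda>y. \<Prod>j<n. limit_overlap sb (L j) y) \<in> borel_measurable limit_space"
      using L by (intro borel_measurable_prod limit_overlap_measurable) auto
    show "norm (\<Prod>j<n. limit_overlap sb (L j) (a, b)) \<le> 1" if "a \<in> space unit_uniform" "b \<in> space uniform_sequence" for a b
      unfolding real_norm_def abs_prod
      by (intro prod_le_1 conjI limit_overlap_le_1 abs_ge_zero) (use that L in \<open>auto simp: space_pair_measure\<close>)
  qed
  finally show ?thesis .
qed

end

section \<open>The limiting field as a Gaussian tilt\<close>

locale limit_model = spin_function \<sigma> + G: prob_space M'
  for \<sigma> :: "real \<Rightarrow> real \<Rightarrow> real \<Rightarrow> real \<Rightarrow> real" and M' :: "'b measure" +
  fixes \<gamma> :: "real \<Rightarrow> real \<Rightarrow> 'b \<Rightarrow> real" and p :: nat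
  assumes p_ge_1: "1 \<le> p" and \<gamma>: "limit_gaussian_process M' p (spin_mean \<sigma>) \<gamma>"
begin

lemma measurable_process:
  assumes "f1 \<in> Q \<rightarrow>\<^sub>M unit_uniform" "f2 \<in> Q \<rightarrow>\<^sub>M unit_uniform" "f3 \<in> Q \<rightarrow>\<^sub>M M'"
  shows "(\<lambda>x. \<gamma> (f1 x) (f2 x) (f3 x)) \<in> borel_measurable Q"
proof -
  have "(\<lambda>(w, u, \<omega>). \<gamma> w u \<omega>) \<in> borel_measurable (unit_uniform \<Otimes>\<^sub>M unit_uniform \<Otimes>\<^sub>M M')"
    using \<gamma> by (simp add: limit_gaussian_process_def)
  from measurable_compose[OF measurable_Pair[OF assms(1) measurable_Pair[OF assms(2,3)]] this] show ?thesis by simp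
qed

lemma gaussian_process: "w \<in> {0..1} \<Longrightarrow> centered_gaussian_process M' {0..1} (\<gamma> w) (\<lambda>u u'. mean_overlap sb w u u' ^ p)"
  using \<gamma> by (simp add: limit_gaussian_process_def)

lemma measurable_mean_overlap:
  assumes "f1 \<in> Q \<rightarrow>\<^sub>M unit_uniform" "f2 \<in> Q \<rightarrow>\<^sub>M unit_uniform" "f3 \<in> Q \<rightarrow>\<^sub>M unit_uniform"
  shows "(\<lambda>x. mean_overlap sb (f1 x) (f2 x) (f3 x)) \<in> borel_measurable Q"
  unfolding mean_overlap_def
proof (rule U.borel_measurable_lebesgue_integral, simp only: split_def, rule borel_measurable_times)
  show "(\<lambda>x. sb (f1 (fst x)) (f2 (fst x)) (snd x)) \<in> borel_measurable (Q \<Otimes>\<^sub>M unit_uniform)"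
    "(\<lambda>x. sb (f1 (fst x)) (f3 (fst x)) (snd x)) \<in> borel_measurable (Q \<Otimes>\<^sub>M unit_uniform)"
    using assms by (auto intro!: borel_measurable_sb measurable_compose[OF measurable_fst])
qed

text \<open>Gives the square root in \<open>augmented_process\<close> a nonnegative argument and
  provides the variance range for \<open>gaussian_completion\<close>.\<close>

lemma mean_overlap_self_power:
  assumes "w \<in> {0..1}" "u \<in> {0..1}"
  shows "0 \<le> mean_overlap sb w u u ^ p" "mean_overlap sb w u u ^ p \<le> 1"
proof -
  have 0: "0 \<le> mean_overlap sb w u u" unfolding mean_overlap_def by simp
  have "\<bar>mean_overlap sb w u u\<bar> \<le> 1"
    unfolding mean_overlap_def
  proof (rule U.integral_abs_le_const)
    fix v assume "v \<in> space unit_uniform"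
    then show "\<bar>sb w u v * sb w u v\<bar> \<le> 1"
      unfolding abs_mult using abs_sb_le_1[OF assms, of v] by (intro mult_le_one) auto
  qed simp
  then have "mean_overlap sb w u u \<le> 1" by simp
  with 0 show "0 \<le> mean_overlap sb w u u ^ p" "mean_overlap sb w u u ^ p \<le> 1" by (auto intro: power_le_one)
qed

lemma measurable_augmented:
  assumes "f1 \<in> Q \<rightarrow>\<^sub>M unit_uniform" "f2 \<in> Q \<rightarrow>\<^sub>M unit_uniform" "f3 \<in> Q \<rightarrow>\<^sub>M M'" "f4 \<in> borel_measurable Q"
  shows "(\<lambda>x. augmented_process p sb \<gamma> (f1 x) (f2 x) (f3 x) (f4 x)) \<in> borel_measurable Q"
proof -
  note [measurable] = measurable_process[OF assms(1-3)] measurable_mean_overlap[OF assms(1,2,2)] assms(4)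
  show ?thesis unfolding augmented_process_def by measurable
qed

abbreviation "outer_law \<equiv> unit_uniform \<Otimes>\<^sub>M uniform_sequence \<Otimes>\<^sub>M M'"
abbreviation "inner_law \<equiv> unit_uniform \<Otimes>\<^sub>M std_normal_distribution"

text \<open>The outer point is \<open>y = (w, v, \<omega>)\<close> and the inner one
  \<open>x = (u, z)\<close>, matching \<open>expectation_wv\<close> and
  \<open>expectation_uz\<close>.\<close>

definition field :: "real \<times> (nat \<Rightarrow> real) \<times> 'b \<Rightarrow> real \<times> real \<Rightarrow> real" where
  "field y x = augmented_process p sb \<gamma> (fst y) (fst x) (snd (snd y)) (snd x)"

definition spins :: "(nat \<Rightarrow> nat set) \<Rightarrow> nat \<Rightarrow> real \<times> (nat \<Rightarrow> real) \<times> 'b \<Rightarrow> real \<times> real \<Rightarrow> real" where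
  "spins C l y x = (\<Prod>i\<in>C l. sb (fst y) (fst x) (fst (snd y) i))"

sublocale Z: real_distribution std_normal_distribution by (rule real_dist_normal_dist)

lemma prob_space_inner: "prob_space inner_law"
  by (rule prob_space_pair[OF prob_space_unit_uniform Z.prob_space_axioms])

lemma prob_space_outer': "prob_space (uniform_sequence \<Otimes>\<^sub>M M')"
  by (rule prob_space_pair[OF prob_space_uniform_sequence G.prob_space_axioms])

lemma prob_space_outer: "prob_space outer_law"
  by (rule prob_space_pair[OF prob_space_unit_uniform prob_space_outer'])

lemma measurable_snd_inner: "snd \<in> borel_measurable (A \<Otimes>\<^sub>M std_normal_distribution)"
  by (rule measurable_compose[OF measurable_snd]) simp

lemma measurable_field: "(\<lambda>q. field (fst q) (snd q)) \<in> borel_measurable (outer_law \<Otimes>\<^sub>M inner_law)"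
  unfolding field_def
  by (intro measurable_augmented measurable_compose[OF measurable_fst measurable_fst]
      measurable_compose[OF measurable_snd measurable_fst]
      measurable_compose[OF measurable_fst measurable_compose[OF measurable_snd measurable_snd]]
      measurable_compose[OF measurable_snd measurable_snd_inner])

lemma measurable_spins:
  assumes "C l \<subseteq> {1..}"
  shows "(\<lambda>q. spins C l (fst q) (snd q)) \<in> borel_measurable (outer_law \<Otimes>\<^sub>M inner_law)"
  unfolding spins_def
proof (rule borel_measurable_prod)
  fix i assume "i \<in> C l"
  then have "1 \<le> i" using assms by auto
  then show "(\<lambda>q. sb (fst (fst q)) (fst (snd q)) (fst (snd (fst q)) i)) \<in> borel_measurable (outer_law \<Otimes>\<^sub>M inner_law)"
    by (intro borel_measurable_sb measurable_sequence_component measurable_compose[OF measurable_fst measurable_fst]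
      measurable_compose[OF measurable_snd measurable_fst]
      measurable_compose[OF measurable_fst measurable_compose[OF measurable_snd measurable_fst]])
qed

lemma abs_spins_le_1:
  assumes "C l \<subseteq> {1..}" "y \<in> space outer_law" "x \<in> space inner_law"
  shows "\<bar>spins C l y x\<bar> \<le> 1"
proof -
  have y: "fst y \<in> {0..1}" "fst (snd y) \<in> space uniform_sequence" "fst x \<in> {0..1}"
    using assms(2,3) by (auto simp: space_pair_measure)
  show ?thesis unfolding spins_def
    using y assms(1) sequence_component_mem[OF y(2)] by (intro abs_prod_sb_le_1) auto
qed

lemma augmented_marginal:
  assumes "w \<in> {0..1}" "u \<in> {0..1}" and [measurable]: "h \<in> borel_measurable borel"
  shows "(\<integral>\<^sup>+\<omega>. \<integral>\<^sup>+z. ennreal (h (augmented_process p sb \<gamma> w u \<omega> z)) \<partial>std_normal_distribution \<partial>M') =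
    (\<integral>\<^sup>+x. ennreal (h x) \<partial>std_normal_distribution)"
proof -
  have \<gamma>m[measurable]: "\<gamma> w u \<in> borel_measurable M'"
    using gaussian_process[OF assms(1)] assms(2) unfolding centered_gaussian_process_def by blast
  have [measurable_cong]: "sets std_normal_distribution = sets borel" by simp
  let ?f = "\<lambda>(\<omega>, z). \<gamma> w u \<omega> + z * sqrt (1 - mean_overlap sb w u u ^ p)"
  have law: "distr (M' \<Otimes>\<^sub>M std_normal_distribution) borel ?f = std_normal_distribution"
    by (rule gaussian_completion[OF G.prob_space_axioms \<gamma>m mean_overlap_self_power[OF assms(1,2)]
        centered_gaussian_process_marginal(2)[OF gaussian_process[OF assms(1)] assms(2)]])
  have "(\<integral>\<^sup>+x. ennreal (h x) \<partial>distr (M' \<Otimes>\<^sub>M std_normal_distribution) borel ?f) =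
    (\<integral>\<^sup>+q. ennreal (h (?f q)) \<partial>(M' \<Otimes>\<^sub>M std_normal_distribution))"
    by (rule nn_integral_distr) measurable
  also have "\<dots> = (\<integral>\<^sup>+\<omega>. \<integral>\<^sup>+z. ennreal (h (?f (\<omega>, z))) \<partial>std_normal_distribution \<partial>M')"
    by (rule Z.nn_integral_fst[symmetric]) measurable
  finally show ?thesis unfolding law by (simp add: augmented_process_def)
qed

text \<open>The standard Gaussian law appears at fixed \<open>w\<close> and \<open>u\<close>, when
  the process and \<open>z\<close> are integrated. A tilt integrates \<open>u\<close> before the
  process, so Tonelli's theorem first exchanges these two.\<close>

lemma limit_tilt:
  assumes C: "\<And>l. C l \<subseteq> {1..}" "\<And>l. q < l \<Longrightarrow> C l = {}"
  shows "gaussian_tilt outer_law (\<lambda>_. inner_law) field (spins C) q"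
proof (rule gaussian_tilt.intro[OF prob_space_outer gaussian_tilt_axioms.intro], goal_cases)
  case (1 y)
  show ?case by (rule prob_space_inner)
next
  case (2 y)
  from measurable_compose[OF measurable_Pair1'[OF 2] measurable_field] show ?case by simp
next
  case (3 l y)
  from measurable_compose[OF measurable_Pair1'[OF 3] measurable_spins[OF C(1)]] show ?case by simp
next
  case (4 l y x)
  then show ?case by (rule abs_spins_le_1[OF C(1)])
next
  case (5 l y x)
  then show ?case by (simp add: spins_def C)
next
  case (6 l h)
  interpret I: prob_space inner_law by (rule prob_space_inner)
  show ?case
    by (rule I.borel_measurable_lebesgue_integral)
      (simp only: split_def, intro borel_measurable_times measurable_spins[OF C(1)] measurable_compose[OF measurable_field 6])
next
  case (7 h)
  interpret I: prob_space inner_law by (rule prob_space_inner)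
  have "(\<lambda>x. ennreal (h x)) \<in> borel_measurable borel" using 7 by measurable
  then show ?case
    by (intro I.borel_measurable_nn_integral) (simp only: split_def, rule measurable_compose[OF measurable_field])
next
  case (8 h)
  interpret I: prob_space inner_law by (rule prob_space_inner)
  interpret O: prob_space "uniform_sequence \<Otimes>\<^sub>M M'" by (rule prob_space_outer')
  interpret W: prob_space uniform_sequence by (rule prob_space_uniform_sequence)
  interpret UM: pair_sigma_finite unit_uniform M' ..
  let ?h = "\<lambda>w u \<omega> z. ennreal (h (augmented_process p sb \<gamma> w u \<omega> z))"
  have hm: "(\<lambda>x. ennreal (h x)) \<in> borel_measurable borel" using 8(1) by measurable
  have Fm: "(\<lambda>y. \<integral>\<^sup>+x. ennreal (h (field y x)) \<partial>inner_law) \<in> borel_measurable outer_law"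
    by (rule I.borel_measurable_nn_integral) (simp only: split_def, rule measurable_compose[OF measurable_field hm])
  have inner_eq: "(\<integral>\<^sup>+x. ennreal (h (field y x)) \<partial>inner_law) =
    (\<integral>\<^sup>+u. \<integral>\<^sup>+z. ?h (fst y) u (snd (snd y)) z \<partial>std_normal_distribution \<partial>unit_uniform)" if "y \<in> space outer_law" for y
  proof -
    have "(\<lambda>x. ennreal (h (field y x))) \<in> borel_measurable inner_law"
      using measurable_compose[OF measurable_Pair1'[OF that] measurable_compose[OF measurable_field hm]] by simp
    from Z.nn_integral_fst[OF this] show ?thesis by (simp add: field_def)
  qed
  have "(\<integral>\<^sup>+y. \<integral>\<^sup>+x. ennreal (h (field y x)) \<partial>inner_law \<partial>outer_law) =
    (\<integral>\<^sup>+w. \<integral>\<^sup>+y. \<integral>\<^sup>+x. ennreal (h (field (w, y) x)) \<partial>inner_law \<partial>(uniform_sequence \<Otimes>\<^sub>M M') \<partial>unit_uniform)"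
    by (rule O.nn_integral_fst[OF Fm, symmetric])
  also have "\<dots> = (\<integral>\<^sup>+w. (\<integral>\<^sup>+x. ennreal (h x) \<partial>std_normal_distribution) \<partial>unit_uniform)"
  proof (rule nn_integral_cong)
    fix w assume "w \<in> space unit_uniform"
    then have w: "w \<in> {0..1}" by simp
    have m1: "(\<lambda>(\<omega>, u). \<integral>\<^sup>+z. ?h w u \<omega> z \<partial>std_normal_distribution) \<in> borel_measurable (M' \<Otimes>\<^sub>M unit_uniform)"
      unfolding split_def
      by (rule Z.borel_measurable_nn_integral, simp only: split_def, rule measurable_compose[OF _ hm],
          intro measurable_augmented measurable_compose[OF measurable_fst measurable_snd]
          measurable_compose[OF measurable_fst measurable_fst] measurable_snd_inner) (use w in simp)
    have m2: "(\<lambda>\<omega>. \<integral>\<^sup>+u. \<integral>\<^sup>+z. ?h w u \<omega> z \<partial>std_normal_distribution \<partial>unit_uniform) \<in> borel_measurable M'"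
      by (rule U.borel_measurable_nn_integral[OF m1])
    have "(\<integral>\<^sup>+y. \<integral>\<^sup>+x. ennreal (h (field (w, y) x)) \<partial>inner_law \<partial>(uniform_sequence \<Otimes>\<^sub>M M')) =
      (\<integral>\<^sup>+y. \<integral>\<^sup>+u. \<integral>\<^sup>+z. ?h w u (snd y) z \<partial>std_normal_distribution \<partial>unit_uniform \<partial>(uniform_sequence \<Otimes>\<^sub>M M'))"
      by (intro nn_integral_cong) (use w inner_eq[of "(w, _)"] in \<open>simp add: space_pair_measure\<close>)
    also have "\<dots> = (\<integral>\<^sup>+v. \<integral>\<^sup>+\<omega>. \<integral>\<^sup>+u. \<integral>\<^sup>+z. ?h w u \<omega> z \<partial>std_normal_distribution \<partial>unit_uniform \<partial>M' \<partial>uniform_sequence)"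
      using G.nn_integral_fst[OF measurable_compose[OF measurable_snd m2], of uniform_sequence] by simp
    also have "\<dots> = (\<integral>\<^sup>+\<omega>. \<integral>\<^sup>+u. \<integral>\<^sup>+z. ?h w u \<omega> z \<partial>std_normal_distribution \<partial>unit_uniform \<partial>M')"
      by (simp only: nn_integral_const W.emeasure_space_1 mult_1_right)
    also have "\<dots> = (\<integral>\<^sup>+u. \<integral>\<^sup>+\<omega>. \<integral>\<^sup>+z. ?h w u \<omega> z \<partial>std_normal_distribution \<partial>M' \<partial>unit_uniform)"
    proof -
      have "(\<lambda>(u, \<omega>). \<integral>\<^sup>+z. ?h w u \<omega> z \<partial>std_normal_distribution) \<in> borel_measurable (unit_uniform \<Otimes>\<^sub>M M')"
        using measurable_compose[OF measurable_Pair[OF measurable_snd measurable_fst] m1] by (simp add: split_def)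
      from UM.Fubini'[OF this] show ?thesis by simp
    qed
    also have "\<dots> = (\<integral>\<^sup>+u. (\<integral>\<^sup>+x. ennreal (h x) \<partial>std_normal_distribution) \<partial>unit_uniform)"
      by (intro nn_integral_cong augmented_marginal w 8(1)) simp
    also have "\<dots> = (\<integral>\<^sup>+x. ennreal (h x) \<partial>std_normal_distribution)"
      by (simp only: nn_integral_const U.emeasure_space_1 mult_1_right)
    finally show "(\<integral>\<^sup>+y. \<integral>\<^sup>+x. ennreal (h (field (w, y) x)) \<partial>inner_law \<partial>(uniform_sequence \<Otimes>\<^sub>M M')) =
      (\<integral>\<^sup>+x. ennreal (h x) \<partial>std_normal_distribution)" .
  qed
  finally show ?case by (simp only: nn_integral_const U.emeasure_space_1 mult_1_right)
qed

text \<open>Integrating \<open>z\<close> leaves a damping factor, which later supplies the missing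
  part of the variance on the diagonal.\<close>

lemma char_augmented:
  assumes "w \<in> {0..1}" "u \<in> {0..1}"
  shows "(\<integral>z. iexp (s * augmented_process p sb \<gamma> w u \<omega> z) \<partial>std_normal_distribution) =
    iexp (s * \<gamma> w u \<omega>) * of_real (exp (- (s\<^sup>2 * (1 - mean_overlap sb w u u ^ p)) / 2))"
proof -
  let ?r = "sqrt (1 - mean_overlap sb w u u ^ p)"
  have "(\<integral>z. iexp (s * augmented_process p sb \<gamma> w u \<omega> z) \<partial>std_normal_distribution) =
    (\<integral>z. iexp (s * \<gamma> w u \<omega>) * iexp ((s * ?r) * z) \<partial>std_normal_distribution)"
    by (simp add: augmented_process_def exp_add[symmetric] algebra_simps)
  also have "\<dots> = iexp (s * \<gamma> w u \<omega>) * char std_normal_distribution (s * ?r)"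
    by (simp add: char_def)
  also have "char std_normal_distribution (s * ?r) = of_real (exp (- (s\<^sup>2 * (1 - mean_overlap sb w u u ^ p)) / 2))"
    using mean_overlap_self_power(2)[OF assms] by (simp add: char_std_normal_distribution power_mult_distrib)
  finally show ?thesis .
qed

lemma integral_site_prod:
  assumes w: "w \<in> {0..1}" and u: "u \<in> space uniform_sequence"
    and I: "finite I" "I \<subseteq> {1..}" "\<And>l. C l \<subseteq> I"
  shows "(\<integral>v. (\<Prod>l=1..n. \<Prod>i\<in>C l. sb w (u l) (v i)) \<partial>uniform_sequence) =
    (\<Prod>i\<in>I. limit_overlap sb {l \<in> {1..n}. i \<in> C l} (w, u))"
proof -
  have "(\<integral>v. (\<Prod>l=1..n. \<Prod>i\<in>C l. sb w (u l) (v i)) \<partial>uniform_sequence) =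
    (\<integral>v. (\<Prod>i\<in>I. (\<lambda>y. \<Prod>l\<in>{l \<in> {1..n}. i \<in> C l}. sb w (u l) y) (v i)) \<partial>uniform_sequence)"
    unfolding prod_swap_sites[OF I(1,3)] ..
  also have "\<dots> = (\<Prod>i\<in>I. \<integral>y. (\<Prod>l\<in>{l \<in> {1..n}. i \<in> C l}. sb w (u l) y) \<partial>unit_uniform)"
  proof (rule integral_PiM_prod[OF prob_space_unit_uniform I(1,2)])
    fix i
    have c: "u l \<in> {0..1}" if "l \<in> {l \<in> {1..n}. i \<in> C l}" for l
      using sequence_component_mem[OF u, of l] that by auto
    show "integrable unit_uniform (\<lambda>y. \<Prod>l\<in>{l \<in> {1..n}. i \<in> C l}. sb w (u l) y)"
    proof (rule U.integrable_const_bound[where B=1])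
      show "AE y in unit_uniform. norm (\<Prod>l\<in>{l \<in> {1..n}. i \<in> C l}. sb w (u l) y) \<le> 1"
        unfolding real_norm_def using w c by (intro AE_I2 abs_prod_sb_le_1) auto
      show "(\<lambda>y. \<Prod>l\<in>{l \<in> {1..n}. i \<in> C l}. sb w (u l) y) \<in> borel_measurable unit_uniform"
        using w c by (intro borel_measurable_prod borel_measurable_sb measurable_const measurable_ident) auto
    qed
  qed
  finally show ?thesis by (simp add: limit_overlap_def)
qed

text \<open>A product of \<open>n\<close> expectations over \<open>u\<close> is one expectation over
  independent copies, the sequence \<open>uu\<close>, with \<open>z\<close> already integrated
  inside each factor. For fixed \<open>w\<close> and \<open>uu\<close>, the sites then give the
  overlaps and the process gives its characteristic function.\<close>

lemma limit_char_moment: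
  assumes C: "\<And>l. q < l \<Longrightarrow> C l = {}" and I: "finite I" "I \<subseteq> {1..}" "\<And>l. C l \<subseteq> I"
  shows "gaussian_tilt.char_moment outer_law (\<lambda>_. inner_law) field (spins C) n \<theta> =
    of_real (\<integral>y. overlap_exponential p n \<theta> I (\<lambda>i. {l \<in> {1..n}. i \<in> C l}) (\<lambda>L. limit_overlap sb L y) \<partial>limit_space)"
proof -
  let ?L = "\<lambda>i. {l \<in> {1..n}. i \<in> C l}"
  have C1: "C l \<subseteq> {1..}" for l using I(2,3) by blast
  \<comment> \<open>\<open>e\<close> is the damping left by the integral over \<open>z\<close>, and
    \<open>b\<close> is the integrand in \<open>u\<close> that then remains.\<close>
  define e where "e l w u = exp (- ((\<theta> l)\<^sup>2 * (1 - mean_overlap sb w u u ^ p)) / 2)" for l w u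
  define b where "b l y u = complex_of_real (\<Prod>i\<in>C l. sb (fst y) u (fst (snd y) i)) *
    (iexp (\<theta> l * \<gamma> (fst y) u (snd (snd y))) * of_real (e l (fst y) u))" for l and y :: "real \<times> (nat \<Rightarrow> real) \<times> 'b" and u
  have bm: "(\<lambda>q. b l (f q) (g q)) \<in> borel_measurable Q" if "f \<in> Q \<rightarrow>\<^sub>M outer_law" "g \<in> Q \<rightarrow>\<^sub>M unit_uniform" for l f g and Q :: "'z measure"
  proof -
    have m: "(\<lambda>q. fst (f q)) \<in> Q \<rightarrow>\<^sub>M unit_uniform" "(\<lambda>q. fst (snd (f q))) \<in> Q \<rightarrow>\<^sub>M uniform_sequence" "(\<lambda>q. snd (snd (f q))) \<in> Q \<rightarrow>\<^sub>M M'"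
      using that(1) by (intro measurable_compose[OF that(1)] measurable_fst measurable_compose[OF measurable_snd] measurable_snd)+
    note [measurable] = measurable_process[OF m(1) that(2) m(3)] measurable_mean_overlap[OF m(1) that(2) that(2)]
    have [measurable]: "(\<lambda>q. \<Prod>i\<in>C l. sb (fst (f q)) (g q) (fst (snd (f q)) i)) \<in> borel_measurable Q"
      by (intro borel_measurable_prod borel_measurable_sb m that measurable_sequence_component) (use C1 in auto)
    show ?thesis unfolding b_def e_def by measurable
  qed
  have e1: "\<bar>e l w u\<bar> \<le> 1" if "w \<in> {0..1}" "u \<in> {0..1}" for l w u
    unfolding e_def using mean_overlap_self_power(2)[OF that] by simp
  have b1: "norm (b l y u) \<le> 1" if "y \<in> space outer_law" "u \<in> {0..1}" for l y u
  proof -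
    have y: "fst y \<in> {0..1}" "fst (snd y) \<in> space uniform_sequence" using that by (auto simp: space_pair_measure)
    have "\<bar>\<Prod>i\<in>C l. sb (fst y) u (fst (snd y) i)\<bar> \<le> 1"
      using y that C1[of l] sequence_component_mem[OF y(2)] by (intro abs_prod_sb_le_1) auto
    then show ?thesis
      unfolding b_def norm_mult norm_exp_i_times norm_of_real using e1[OF y(1) that(2), of l]
      by (intro mult_le_one) (auto simp: abs_mult intro: mult_le_one)
  qed
  have inner_eq: "(\<integral>x. of_real (spins C l y x) * iexp (\<theta> l * field y x) \<partial>inner_law) = (\<integral>u. b l y u \<partial>unit_uniform)"
    if y: "y \<in> space outer_law" for l y
  proof -
    have ym: "fst y \<in> {0..1}" using y by (auto simp: space_pair_measure)
    have sm: "(\<lambda>x. spins C l y x) \<in> borel_measurable inner_law" "(\<lambda>x. field y x) \<in> borel_measurable inner_law"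
      using measurable_compose[OF measurable_Pair1'[OF y] measurable_spins[OF C1]]
        measurable_compose[OF measurable_Pair1'[OF y] measurable_field] by simp_all
    have m: "(\<lambda>x. of_real (spins C l y x) * iexp (\<theta> l * field y x)) \<in> borel_measurable inner_law"
      using sm by measurable
    have "(\<integral>x. of_real (spins C l y x) * iexp (\<theta> l * field y x) \<partial>inner_law) =
      (\<integral>u. \<integral>z. of_real (spins C l y (u, z)) * iexp (\<theta> l * field y (u, z)) \<partial>std_normal_distribution \<partial>unit_uniform)"
    proof (rule integral_pair_bounded[OF prob_space_unit_uniform Z.prob_space_axioms m])
      fix u z assume "u \<in> space unit_uniform" "z \<in> space std_normal_distribution"
      then have "(u, z) \<in> space inner_law" by (simp add: space_pair_measure)
      from abs_spins_le_1[OF C1 y this] show "norm (complex_of_real (spins C l y (u, z)) * iexp (\<theta> l * field y (u, z))) \<le> 1"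
        unfolding norm_mult norm_exp_i_times norm_of_real by simp
    qed
    also have "\<dots> = (\<integral>u. b l y u \<partial>unit_uniform)"
      by (intro Bochner_Integration.integral_cong refl) (simp only: spins_def field_def b_def e_def fst_conv snd_conv
          integral_mult_right_zero char_augmented[OF ym] space_unit_uniform)
    finally show ?thesis .
  qed
  let ?B = "\<lambda>y uu. \<Prod>l\<in>{1..n}. b l y (uu l)"
  have Bm: "(\<lambda>q. ?B (f q) (g q)) \<in> borel_measurable Q" if "f \<in> Q \<rightarrow>\<^sub>M outer_law" "g \<in> Q \<rightarrow>\<^sub>M uniform_sequence" for f g and Q :: "'z measure"
    by (intro borel_measurable_prod bm that measurable_sequence_component) auto
  have B1: "norm (?B y uu) \<le> 1" if "y \<in> space outer_law" "uu \<in> space uniform_sequence" for y uu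
    unfolding prod_norm[symmetric] by (intro prod_le_1 conjI norm_ge_zero b1 that sequence_component_mem[OF that(2)]) auto
  have prod_eq: "(\<Prod>l=1..n. \<integral>x. of_real (spins C l y x) * iexp (\<theta> l * field y x) \<partial>inner_law) = (\<integral>uu. ?B y uu \<partial>uniform_sequence)"
    if y: "y \<in> space outer_law" for y
  proof -
    have "(\<integral>uu. ?B y uu \<partial>uniform_sequence) = (\<Prod>l\<in>{1..n}. \<integral>u. b l y u \<partial>unit_uniform)"
    proof (rule integral_PiM_prod[OF prob_space_unit_uniform])
      show "integrable unit_uniform (b l y)" for l
        by (rule U.integrable_const_bound[where B=1])
          (use b1[OF y] bm[OF measurable_const[OF y] measurable_ident] in auto)
    qed auto
    then show ?thesis by (simp only: inner_eq[OF y])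
  qed
  have site: "(\<integral>y. ?B (w, y) uu \<partial>(uniform_sequence \<Otimes>\<^sub>M M')) =
    of_real (overlap_exponential p n \<theta> I ?L (\<lambda>L. limit_overlap sb L (w, uu)))"
    if w: "w \<in> {0..1}" and uu: "uu \<in> space uniform_sequence" for w uu
  proof -
    have ul: "uu l \<in> {0..1}" if "l \<in> {1..n}" for l using sequence_component_mem[OF uu, of l] that by auto
    let ?S = "\<lambda>v. \<Prod>l=1..n. \<Prod>i\<in>C l. sb w (uu l) (v i)"
    let ?g = "\<lambda>\<omega>. \<Sum>l\<in>{1..n}. \<theta> l * \<gamma> w (uu l) \<omega>"
    let ?E = "\<Prod>l\<in>{1..n}. e l w (uu l)"
    have B: "?B (w, (v, \<omega>)) uu = of_real (?S v) * (iexp (?g \<omega>) * of_real ?E)" for v \<omega>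
    proof -
      have "iexp (?g \<omega>) = (\<Prod>l\<in>{1..n}. iexp (\<theta> l * \<gamma> w (uu l) \<omega>))"
        by (simp add: exp_sum[symmetric] sum_distrib_left)
      then show ?thesis unfolding b_def fst_conv snd_conv by (simp only: prod.distrib of_real_prod)
    qed
    have m: "(\<lambda>y. ?B (w, y) uu) \<in> borel_measurable (uniform_sequence \<Otimes>\<^sub>M M')"
      by (rule Bm[OF measurable_Pair1' measurable_const]) (use w uu in simp_all)
    have "(\<integral>y. ?B (w, y) uu \<partial>(uniform_sequence \<Otimes>\<^sub>M M')) = (\<integral>v. \<integral>\<omega>. ?B (w, (v, \<omega>)) uu \<partial>M' \<partial>uniform_sequence)"
      by (rule integral_pair_bounded[OF prob_space_uniform_sequence G.prob_space_axioms m], rule B1)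
        (use w uu in \<open>simp_all add: space_pair_measure\<close>)
    also have "\<dots> = of_real (\<integral>v. ?S v \<partial>uniform_sequence) * ((\<integral>\<omega>. iexp (?g \<omega>) \<partial>M') * of_real ?E)"
      unfolding B integral_mult_right_zero integral_mult_left_zero integral_complex_of_real ..
    also have "(\<integral>\<omega>. iexp (?g \<omega>) \<partial>M') =
      of_real (exp (- (\<Sum>l\<in>{1..n}. \<Sum>l'\<in>{1..n}. \<theta> l * \<theta> l' * mean_overlap sb w (uu l) (uu l') ^ p) / 2))"
      by (rule centered_gaussian_process_char[OF gaussian_process[OF w]]) (use ul in auto)
    also have "(\<integral>v. ?S v \<partial>uniform_sequence) = (\<Prod>i\<in>I. limit_overlap sb (?L i) (w, uu))"
      by (rule integral_site_prod[OF w uu I])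
    also have "?E = exp (- (\<Sum>l\<in>{1..n}. (\<theta> l)\<^sup>2 * (1 - mean_overlap sb w (uu l) (uu l) ^ p)) / 2)"
      unfolding e_def by (simp add: exp_sum[symmetric] sum_negf sum_divide_distrib)
    also have "of_real (\<Prod>i\<in>I. limit_overlap sb (?L i) (w, uu)) *
        (complex_of_real (exp (- (\<Sum>l\<in>{1..n}. \<Sum>l'\<in>{1..n}. \<theta> l * \<theta> l' * mean_overlap sb w (uu l) (uu l') ^ p) / 2)) *
         complex_of_real (exp (- (\<Sum>l\<in>{1..n}. (\<theta> l)\<^sup>2 * (1 - mean_overlap sb w (uu l) (uu l) ^ p)) / 2))) =
      of_real ((\<Prod>i\<in>I. limit_overlap sb (?L i) (w, uu)) *
        exp (- (\<Sum>l=1..n. \<Sum>l'=1..n. \<theta> l * \<theta> l' * (if l = l' then 1 else mean_overlap sb w (uu l) (uu l') ^ p)) / 2))"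
    proof -
      \<comment> \<open>The damping exponents affect only \<open>l = l'\<close>, where they replace
        the power of the self-overlap by \<open>1\<close>.\<close>
      have "(\<Sum>l=1..n. \<Sum>l'=1..n. \<theta> l * \<theta> l' * (if l = l' then 1 else mean_overlap sb w (uu l) (uu l') ^ p)) =
        (\<Sum>l=1..n. (\<Sum>l'=1..n. \<theta> l * \<theta> l' * mean_overlap sb w (uu l) (uu l') ^ p) +
          (\<theta> l)\<^sup>2 * (1 - mean_overlap sb w (uu l) (uu l) ^ p))"
      proof (rule sum.cong[OF refl])
        fix l assume l: "l \<in> {1..n}"
        have "(\<Sum>l'=1..n. \<theta> l * \<theta> l' * (if l = l' then 1 else mean_overlap sb w (uu l) (uu l') ^ p)) =
          (\<Sum>l'=1..n. \<theta> l * \<theta> l' * mean_overlap sb w (uu l) (uu l') ^ p +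
            (if l' = l then (\<theta> l)\<^sup>2 * (1 - mean_overlap sb w (uu l) (uu l) ^ p) else 0))"
          by (intro sum.cong refl) (auto simp: power2_eq_square algebra_simps)
        also have "\<dots> = (\<Sum>l'=1..n. \<theta> l * \<theta> l' * mean_overlap sb w (uu l) (uu l') ^ p) +
          (\<theta> l)\<^sup>2 * (1 - mean_overlap sb w (uu l) (uu l) ^ p)"
          using l by (simp add: sum.distrib)
        finally show "(\<Sum>l'=1..n. \<theta> l * \<theta> l' * (if l = l' then 1 else mean_overlap sb w (uu l) (uu l') ^ p)) =
          (\<Sum>l'=1..n. \<theta> l * \<theta> l' * mean_overlap sb w (uu l) (uu l') ^ p) +
          (\<theta> l)\<^sup>2 * (1 - mean_overlap sb w (uu l) (uu l) ^ p)" .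
      qed
      then show ?thesis
        unfolding of_real_mult[symmetric] exp_add[symmetric] sum.distrib
        by (simp only: minus_add_distrib add_divide_distrib)
    qed
    also have "(\<Prod>i\<in>I. limit_overlap sb (?L i) (w, uu)) *
        exp (- (\<Sum>l=1..n. \<Sum>l'=1..n. \<theta> l * \<theta> l' * (if l = l' then 1 else mean_overlap sb w (uu l) (uu l') ^ p)) / 2) =
      overlap_exponential p n \<theta> I ?L (\<lambda>L. limit_overlap sb L (w, uu))"
    proof (rule overlap_exponential_eq[symmetric])
      fix l l' :: nat assume "l \<noteq> l'"
      then show "(if l = l' then 1 else mean_overlap sb w (uu l) (uu l') ^ p) = limit_overlap sb {l, l'} (w, uu) ^ p"
        by (simp add: mean_overlap_def limit_overlap_def)
    qed simp
    finally show ?thesis .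
  qed
  let ?OE = "\<lambda>y. overlap_exponential p n \<theta> I ?L (\<lambda>L. limit_overlap sb L y)"
  have T: "gaussian_tilt outer_law (\<lambda>_. inner_law) field (spins C) q" by (rule limit_tilt[OF C1 C])
  have "gaussian_tilt.char_moment outer_law (\<lambda>_. inner_law) field (spins C) n \<theta> = (\<integral>y. \<integral>uu. ?B y uu \<partial>uniform_sequence \<partial>outer_law)"
    unfolding gaussian_tilt.char_moment_def[OF T]
    by (intro Bochner_Integration.integral_cong refl prod_eq)
  also have "\<dots> = (\<integral>w. \<integral>y. \<integral>uu. ?B (w, y) uu \<partial>uniform_sequence \<partial>(uniform_sequence \<Otimes>\<^sub>M M') \<partial>unit_uniform)"
  proof (rule integral_pair_bounded[OF prob_space_unit_uniform prob_space_outer'])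
    interpret W: prob_space uniform_sequence by (rule prob_space_uniform_sequence)
    show "(\<lambda>y. \<integral>uu. ?B y uu \<partial>uniform_sequence) \<in> borel_measurable outer_law"
      by (rule W.borel_measurable_lebesgue_integral) (simp only: split_def, rule Bm[OF measurable_fst measurable_snd])
    fix w y assume "w \<in> space unit_uniform" "y \<in> space (uniform_sequence \<Otimes>\<^sub>M M')"
    then have y: "(w, y) \<in> space outer_law" by (simp add: space_pair_measure)
    have i: "integrable uniform_sequence (?B (w, y))"
      by (rule W.integrable_const_bound[where B=1])
        (use B1[OF y] Bm[OF measurable_const[OF y] measurable_ident] in \<open>auto simp: id_def\<close>)
    have "norm (\<integral>uu. ?B (w, y) uu \<partial>uniform_sequence) \<le> (\<integral>uu. norm (?B (w, y) uu) \<partial>uniform_sequence)"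
      by (rule integral_norm_bound)
    also have "\<dots> \<le> 1"
      by (intro W.integral_le_const integrable_norm i AE_I2 B1 y)
    finally show "norm (\<integral>uu. ?B (w, y) uu \<partial>uniform_sequence) \<le> 1" .
  qed
  \<comment> \<open>For fixed \<open>w\<close> the replicas are moved outside, so that
    \<open>site\<close> can integrate the sites and the process.\<close>
  also have "\<dots> = (\<integral>w. \<integral>uu. of_real (?OE (w, uu)) \<partial>uniform_sequence \<partial>unit_uniform)"
  proof (rule Bochner_Integration.integral_cong[OF refl])
    fix w assume "w \<in> space unit_uniform"
    then have w: "w \<in> {0..1}" by simp
    let ?F = "\<lambda>q. ?B (w, fst q) (snd q)"
    have Fm: "?F \<in> borel_measurable ((uniform_sequence \<Otimes>\<^sub>M M') \<Otimes>\<^sub>M uniform_sequence)"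
      by (rule Bm[OF measurable_compose[OF measurable_fst measurable_Pair1'] measurable_snd]) (use w in simp)
    have "(\<integral>y. \<integral>uu. ?F (y, uu) \<partial>uniform_sequence \<partial>(uniform_sequence \<Otimes>\<^sub>M M')) = (\<integral>uu. \<integral>y. ?F (y, uu) \<partial>(uniform_sequence \<Otimes>\<^sub>M M') \<partial>uniform_sequence)"
      by (rule integral_pair_bounded_swap[OF prob_space_outer' prob_space_uniform_sequence Fm])
        (simp only: fst_conv snd_conv, rule B1, use w in \<open>simp_all add: space_pair_measure\<close>)
    also have "\<dots> = (\<integral>uu. of_real (?OE (w, uu)) \<partial>uniform_sequence)"
      unfolding fst_conv snd_conv by (intro Bochner_Integration.integral_cong refl site[OF w])
    finally show "(\<integral>y. \<integral>uu. ?B (w, y) uu \<partial>uniform_sequence \<partial>(uniform_sequence \<Otimes>\<^sub>M M')) = (\<integral>uu. of_real (?OE (w, uu)) \<partial>uniform_sequence)"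
      unfolding fst_conv snd_conv .
  qed
  also have "\<dots> = (\<integral>y. complex_of_real (?OE y) \<partial>limit_space)"
  proof (rule integral_pair_bounded[OF prob_space_unit_uniform prob_space_uniform_sequence, symmetric])
    have R: "limit_overlap sb L \<in> borel_measurable limit_space" if "L \<subseteq> {1..n}" for L
      by (rule limit_overlap_measurable) (use that in auto)
    show "(\<lambda>y. complex_of_real (?OE y)) \<in> borel_measurable limit_space"
    proof -
      have [measurable]: "(\<lambda>y. \<Prod>i\<in>I. limit_overlap sb (?L i) y) \<in> borel_measurable limit_space"
        by (intro borel_measurable_prod R) auto
      have "(\<lambda>y. exp (- (\<theta> (fst j) * \<theta> (snd j) * limit_overlap sb {fst j, snd j} y ^ p) / 2)) \<in> borel_measurable limit_space"
        if "j \<in> {j \<in> {1..n} \<times> {1..n}. fst j \<noteq> snd j}" for j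
      proof -
        have [measurable]: "limit_overlap sb {fst j, snd j} \<in> borel_measurable limit_space"
          using that by (intro R) auto
        show ?thesis by measurable
      qed
      then have [measurable]: "(\<lambda>y. \<Prod>j\<in>{j \<in> {1..n} \<times> {1..n}. fst j \<noteq> snd j}.
          exp (- (\<theta> (fst j) * \<theta> (snd j) * limit_overlap sb {fst j, snd j} y ^ p) / 2)) \<in> borel_measurable limit_space"
        by (rule borel_measurable_prod)
      show ?thesis unfolding overlap_exponential_def by measurable
    qed
    fix w uu assume wu: "w \<in> space unit_uniform" "uu \<in> space uniform_sequence"
    have w: "w \<in> {0..1}" using wu by simp
    interpret O: prob_space "uniform_sequence \<Otimes>\<^sub>M M'" by (rule prob_space_outer')
    have sp: "(w, y) \<in> space outer_law" if "y \<in> space (uniform_sequence \<Otimes>\<^sub>M M')" for y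
      using that wu by (simp add: space_pair_measure)
    \<comment> \<open>By \<open>site\<close> the overlap exponential is itself an integral of
      \<open>?B\<close>, which supplies the bound \<open>1\<close> that Fubini's theorem asks
      for.\<close>
    have "norm (\<integral>y. ?B (w, y) uu \<partial>(uniform_sequence \<Otimes>\<^sub>M M')) \<le> (\<integral>y. norm (?B (w, y) uu) \<partial>(uniform_sequence \<Otimes>\<^sub>M M'))"
      by (rule integral_norm_bound)
    also have "\<dots> \<le> 1"
    proof (intro O.integral_le_const integrable_norm AE_I2 B1 sp wu(2))
      show "integrable (uniform_sequence \<Otimes>\<^sub>M M') (\<lambda>y. ?B (w, y) uu)"
        by (rule O.integrable_const_bound[where B=1], intro AE_I2 B1 sp wu(2), assumption,
            rule Bm[OF measurable_Pair1' measurable_const]) (use w wu in simp_all)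
    qed
    finally show "norm (complex_of_real (?OE (w, uu))) \<le> 1" unfolding site[OF w wu(2)] .
  qed
  finally show ?thesis by (simp only: integral_complex_of_real)
qed

end

section \<open>Passing to the limit\<close>

text \<open>Moments of overlaps are asymptotically moments of spins at the distinct sites
  \<open>1\<close> to \<open>m\<close>. These are combinations of cylinder probabilities, which
  converge along \<open>N\<close>, and \<open>array_moment\<close> evaluates their limit.\<close>

lemma (in perturbed_spin_glass) moment_convergence_limit:
  assumes \<sigma>: "spin_function \<sigma>" and \<mu>: "prob_space \<mu>" "sets \<mu> = sets array_space"
    and N: "filterlim N at_top sequentially"
    and cyl: "\<And>D a. finite D \<Longrightarrow> D \<subseteq> array_indices \<Longrightarrow>
      (\<lambda>k. measure (spin_law M H (N k)) {x \<in> space array_space. \<forall>j\<in>D. x j = a j})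
        \<longlonglongrightarrow> measure \<mu> {x \<in> space array_space. \<forall>j\<in>D. x j = a j}"
    and rep: "\<mu> = distr
       (unit_uniform \<Otimes>\<^sub>M uniform_sequence \<Otimes>\<^sub>M uniform_sequence \<Otimes>\<^sub>M (\<Pi>\<^sub>M j\<in>array_indices. unit_uniform))
       array_space
       (\<lambda>(w, u, v, x). \<lambda>(i, l)\<in>array_indices. \<sigma> w (u l) (v i) (x (i, l)))"
  shows "moment_convergence (\<lambda>k. replica_space (N k) (H (N k)) {1..n}) (unit_uniform \<Otimes>\<^sub>M uniform_sequence)
    (Pow {1..n}) (\<lambda>k. set_overlap (N k)) (limit_overlap (spin_mean \<sigma>))"
proof -
  interpret S: spin_function \<sigma> by fact
  let ?J = "{1..n}" and ?\<Theta> = "\<lambda>k. replica_space (N k) (H (N k)) {1..n}"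
  have space: "space (?\<Theta> k) = ?J \<rightarrow>\<^sub>E configs (N k)" and sets: "sets (?\<Theta> k) = Pow (?J \<rightarrow>\<^sub>E configs (N k))" for k
    by (simp_all add: replica_space_def space_point_measure sets_point_measure)
  have site: "(\<lambda>k. \<integral>\<tau>. (\<Prod>j<m. \<Prod>l\<in>L j. \<tau> l (Suc j)) \<partial>?\<Theta> k) \<longlonglongrightarrow> (\<integral>y. (\<Prod>j<m. limit_overlap (spin_mean \<sigma>) (L j) y) \<partial>S.limit_space)"
    if L: "\<And>j. j < m \<Longrightarrow> L j \<subseteq> ?J" for m and L :: "nat \<Rightarrow> nat set"
  proof -
    have finL: "finite (L j)" if "j < m" for j using L[OF that] by (rule finite_subset) simp
    have L1: "L j \<subseteq> {1..}" if "j < m" for j using L[OF that] by auto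
    let ?S = "Sigma {..<m} L"
    let ?D = "(\<lambda>(j, l). (Suc j, l)) ` ?S"
    have finD: "finite ?D" using finL by auto
    have inj: "inj_on (\<lambda>(j, l). (Suc j, l)) ?S" by (auto simp: inj_on_def)
    have re: "(\<Prod>j<m. \<Prod>l\<in>L j. F (Suc j, l)) = (\<Prod>d\<in>?D. F d)" for F :: "nat \<times> nat \<Rightarrow> real"
    proof -
      have "(\<Prod>j<m. \<Prod>l\<in>L j. F (Suc j, l)) = (\<Prod>(j, l)\<in>?S. F (Suc j, l))"
        by (rule prod.Sigma) (use finL in auto)
      then show ?thesis by (subst prod.reindex[OF inj]) (simp add: split_def)
    qed
    have D: "?D \<subseteq> {1..m} \<times> ?J" using L by fastforce
    then have DA: "?D \<subseteq> array_indices" by auto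
    let ?cyl = "\<lambda>a. {x \<in> space array_space. \<forall>j\<in>?D. x j = a j}"
    have "(\<lambda>k. \<Sum>a\<in>?D \<rightarrow>\<^sub>E {-1, 0, 1}. (\<Prod>j\<in>?D. a j) * measure (spin_law M H (N k)) (?cyl a))
      \<longlonglongrightarrow> (\<Sum>a\<in>?D \<rightarrow>\<^sub>E {-1, 0, 1}. (\<Prod>j\<in>?D. a j) * measure \<mu> (?cyl a))"
      by (intro tendsto_sum tendsto_mult tendsto_const cyl finD DA)
    also have "(\<Sum>a\<in>?D \<rightarrow>\<^sub>E {-1, 0, 1}. (\<Prod>j\<in>?D. a j) * measure \<mu> (?cyl a)) = (\<integral>x. (\<Prod>j\<in>?D. x j) \<partial>\<mu>)"
      by (rule array_coordinate_prod[OF \<mu> finD DA, symmetric])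
    also have "\<dots> = (\<integral>y. (\<Prod>j<m. limit_overlap (spin_mean \<sigma>) (L j) y) \<partial>S.limit_space)"
      unfolding re[symmetric] by (rule S.array_moment[OF rep]) (use finL L1 in auto)
    finally have lim: "(\<lambda>k. \<Sum>a\<in>?D \<rightarrow>\<^sub>E {-1, 0, 1}. (\<Prod>j\<in>?D. a j) * measure (spin_law M H (N k)) (?cyl a))
      \<longlonglongrightarrow> (\<integral>y. (\<Prod>j<m. limit_overlap (spin_mean \<sigma>) (L j) y) \<partial>S.limit_space)" .
    have "eventually (\<lambda>k. (\<Sum>a\<in>?D \<rightarrow>\<^sub>E {-1, 0, 1}. (\<Prod>j\<in>?D. a j) * measure (spin_law M H (N k)) (?cyl a)) =
      (\<integral>\<tau>. (\<Prod>j<m. \<Prod>l\<in>L j. \<tau> l (Suc j)) \<partial>?\<Theta> k)) sequentially"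
      \<comment> \<open>Once \<open>N k \<ge> m\<close>, the sites in question exist and no padding
        zero enters.\<close>
      using eventually_compose_filterlim[OF eventually_ge_at_top[of m] N]
    proof eventually_elim
      case (elim k)
      then have D': "?D \<subseteq> {1..N k} \<times> ?J" using D by fastforce
      have J: "?J \<subseteq> {1..}" by auto
      note sl = spin_law_coordinate_prod[where H=H, OF H_measurable finD D' finite_atLeastAtMost J]
      have "(\<Sum>a\<in>?D \<rightarrow>\<^sub>E {-1, 0, 1}. (\<Prod>j\<in>?D. a j) * measure (spin_law M H (N k)) (?cyl a)) =
        (\<integral>\<tau>. (\<Prod>(i, l)\<in>?D. \<tau> l i) \<partial>?\<Theta> k)"
        unfolding array_coordinate_prod[OF sl(1,2) finD DA, symmetric] by (rule sl(3))
      also have "\<dots> = (\<integral>\<tau>. (\<Prod>j<m. \<Prod>l\<in>L j. \<tau> l (Suc j)) \<partial>?\<Theta> k)"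
        using re[of "\<lambda>d. _ (snd d) (fst d)"] by (simp add: split_def)
      finally show ?case .
    qed
    from Lim_transform_eventually[OF lim this] show ?thesis .
  qed
  show ?thesis
  proof (rule moment_convergence.intro)
    show "prob_space (?\<Theta> k)" for k by (rule prob_space_replica_space[OF H_measurable]) simp
    show "prob_space S.limit_space" by (rule S.prob_space_limit_space)
    show "set_overlap (N k) L \<in> borel_measurable (?\<Theta> k)" for k L
      by (rule measurableI) (auto simp only: sets space space_borel)
    show "limit_overlap (spin_mean \<sigma>) L \<in> borel_measurable S.limit_space" if "L \<in> Pow ?J" for L
      by (rule S.limit_overlap_measurable) (use that in auto)
    show "\<bar>set_overlap (N k) L x\<bar> \<le> 1" if "L \<in> Pow ?J" "x \<in> space (?\<Theta> k)" for k L x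
      by (rule abs_set_overlap_le_1) (use that space in auto)
    show "\<bar>limit_overlap (spin_mean \<sigma>) L x\<bar> \<le> 1" if "L \<in> Pow ?J" "x \<in> space S.limit_space" for L x
      by (rule S.limit_overlap_le_1[OF _ that(2)]) (use that(1) in auto)
    fix Ls assume Ls: "Ls \<in> lists (Pow ?J)"
    have nth: "Ls ! j \<subseteq> ?J" if "j < length Ls" for j
      using Ls that by (auto simp: in_lists_conv_set subset_iff)
    have list: "(\<Prod>L\<leftarrow>Ls. f L) = (\<Prod>j<length Ls. f (Ls ! j))" for f :: "nat set \<Rightarrow> real"
      by (simp add: prod.list_conv_set_nth lessThan_atLeast0)
    from tendsto_add[OF site_average_tendsto[where n="length Ls" and L="(!) Ls", OF finite_atLeastAtMost N nth]
        site[of "length Ls" "(!) Ls", OF nth]]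
    show "(\<lambda>k. \<integral>x. (\<Prod>L\<leftarrow>Ls. set_overlap (N k) L x) \<partial>?\<Theta> k) \<longlonglongrightarrow> (\<integral>x. (\<Prod>L\<leftarrow>Ls. limit_overlap (spin_mean \<sigma>) L x) \<partial>S.limit_space)"
      unfolding list by simp
  qed
qed

theorem theorem6:
  fixes M :: "'a measure" and M' :: "'b measure"
    and \<beta> \<delta> :: "nat \<Rightarrow> real" and \<beta>' :: "nat \<Rightarrow> nat \<Rightarrow> real"
    and g g' :: "nat list \<Rightarrow> 'a \<Rightarrow> real"
    and G :: "nat \<Rightarrow> nat \<Rightarrow> config \<Rightarrow> 'a \<Rightarrow> real"
    and \<mu> :: "(nat \<times> nat \<Rightarrow> real) measure"
    and \<sigma> :: "real \<Rightarrow> real \<Rightarrow> real \<Rightarrow> real \<Rightarrow> real"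
    and \<gamma> :: "real \<Rightarrow> real \<Rightarrow> 'b \<Rightarrow> real"
    and p q :: nat and t :: real and C :: "nat \<Rightarrow> nat set"
  defines "H \<equiv> perturbed_hamiltonian \<beta> \<delta> \<beta>' g g'"
    and "sb \<equiv> spin_mean \<sigma>"
  assumes "perturbed_spin_glass M \<beta> \<delta> \<beta>' g g' G"
    and "ghirlanda_guerra M H"
    and "stochastically_stable M H G"
    and "\<mu> \<in> limit_laws M H"
    and "aldous_hoover_representation \<mu> \<sigma>"
    and "1 \<le> p" and "0 < t" and "1 \<le> q"
    and "\<And>l. l \<in> {1..q} \<Longrightarrow> finite (C l) \<and> C l \<subseteq> {1..}"
    and "prob_space M'"
    and "limit_gaussian_process M' p sb \<gamma>"
  shows
    "expectation_wv M' (\<lambda>w v \<omega>. \<Prod>l=1..q. expectation_uz (\<lambda>u z. \<Prod>i\<in>C l. sb w u (v i))) =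
     expectation_wv M' (\<lambda>w v \<omega>.
       (\<Prod>l=1..q. expectation_uz (\<lambda>u z.
          (\<Prod>i\<in>C l. sb w u (v i)) * exp (t * augmented_process p sb \<gamma> w u \<omega> z))) /
       expectation_uz (\<lambda>u z. exp (t * augmented_process p sb \<gamma> w u \<omega> z)) ^ q)"
proof -
  interpret perturbed_spin_glass M \<beta> \<delta> \<beta>' g g' G by fact
  interpret S: spin_function \<sigma>
    using \<open>aldous_hoover_representation \<mu> \<sigma>\<close> by unfold_locales (simp add: aldous_hoover_representation_def)
  interpret L: limit_model \<sigma> M' \<gamma> p
    by (intro limit_model.intro limit_model_axioms.intro S.spin_function_axioms)
      (use assms in \<open>simp_all add: sb_def\<close>)
  have rep: "\<mu> = distr
       (unit_uniform \<Otimes>\<^sub>M uniform_sequence \<Otimes>\<^sub>M uniform_sequence \<Otimes>\<^sub>M (\<Pi>\<^sub>M j\<in>array_indices. unit_uniform))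
       array_space
       (\<lambda>(w, u, v, x). \<lambda>(i, l)\<in>array_indices. \<sigma> w (u l) (v i) (x (i, l)))"
    using \<open>aldous_hoover_representation \<mu> \<sigma>\<close> unfolding aldous_hoover_representation_def by (rule conjunct2)
  obtain r where \<mu>: "prob_space \<mu>" "sets \<mu> = sets array_space" and r: "strict_mono (r :: nat \<Rightarrow> nat)"
    and cyl: "\<And>J a. finite J \<Longrightarrow> J \<subseteq> array_indices \<Longrightarrow>
      (\<lambda>k. measure (spin_law M H (r k)) {x \<in> space array_space. \<forall>j\<in>J. x j = a j})
        \<longlonglongrightarrow> measure \<mu> {x \<in> space array_space. \<forall>j\<in>J. x j = a j}"
    using \<open>\<mu> \<in> limit_laws M H\<close> unfolding limit_laws_def by blast
  \<comment> \<open>The shift excludes \<open>r 0 = 0\<close>, since overlaps need at least one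
    site.\<close>
  define N where "N k = r (Suc k)" for k
  have N1: "1 \<le> N k" for k using seq_suble[OF r, of "Suc k"] by (simp add: N_def)
  have N: "filterlim N at_top sequentially"
    unfolding N_def using filterlim_subseq[OF r] by (rule filterlim_compose) (rule filterlim_Suc)
  have mc: "moment_convergence (\<lambda>k. replica_space (N k) (H (N k)) {1..n}) S.limit_space
    (Pow {1..n}) (\<lambda>k. set_overlap (N k)) (limit_overlap (spin_mean \<sigma>))" for n
    unfolding H_def
    by (rule moment_convergence_limit[OF S.spin_function_axioms \<mu> N _ rep])
      (use cyl[THEN LIMSEQ_Suc] in \<open>simp add: N_def H_def\<close>)
  \<comment> \<open>Extending by empty sets outside \<open>{1..q}\<close> makes the spin product the
    constant \<open>1\<close> there, as the tilt requires.\<close>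
  define C' where "C' l = (if l \<in> {1..q} then C l else {})" for l
  define I where "I = (\<Union>l\<in>{1..q}. C l)"
  have C': "\<And>l. q < l \<Longrightarrow> C' l = {}" by (simp add: C'_def)
  have I: "finite I" "I \<subseteq> {1..}" "\<And>l. C' l \<subseteq> I"
  proof -
    show "finite I" "I \<subseteq> {1..}" using assms(11) unfolding I_def by blast+
    show "C' l \<subseteq> I" for l unfolding I_def C'_def by auto
  qed
  let ?L = "\<lambda>n i. {l \<in> {1..n}. i \<in> C' l}"
  let ?e = "\<lambda>x. exp (t * x)"
  let ?f = "\<lambda>k s. \<Prod>i\<in>I. set_overlap (N k) (?L q i) s"
  let ?OE = "\<lambda>n \<theta> y. overlap_exponential p n \<theta> I (?L n) (\<lambda>L. limit_overlap sb L y)"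
  \<comment> \<open>Used twice: with arbitrary frequencies for the tilted average and with zero
    frequencies for the plain one.\<close>
  have oe: "(\<lambda>k. \<integral>\<tau>. overlap_exponential p n \<theta> I (?L n) (\<lambda>L. set_overlap (N k) L \<tau>) \<partial>replica_space (N k) (H (N k)) {1..n})
      \<longlonglongrightarrow> (\<integral>y. ?OE n \<theta> y \<partial>S.limit_space)" for n \<theta>
    unfolding sb_def by (rule overlap_exponential_tendsto[OF mc I(1)]) auto

  have average_tilt: "annealed_average M (N k) (\<lambda>\<omega> \<sigma>. H (N k) \<omega> \<sigma> + t * G (N k) p \<sigma> \<omega>) (?f k) =
    (\<Sum>\<kappa>\<in>I \<rightarrow>\<^sub>E {1..N k}. gaussian_tilt.tilt M (\<lambda>\<omega>. gibbs_measure (N k) (H (N k) \<omega>)) (neg_G (N k) p)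
      (site_spins C' \<kappa>) q ?e) / real (card (I \<rightarrow>\<^sub>E {1..N k}))" for k
    unfolding H_def by (rule annealed_average_tilt[OF N1 \<open>1 \<le> p\<close> I(1,3) C'])
  have "(\<lambda>k. annealed_average M (N k) (\<lambda>\<omega> \<sigma>. H (N k) \<omega> \<sigma> + t * G (N k) p \<sigma> \<omega>) (?f k))
    \<longlonglongrightarrow> gaussian_tilt.tilt L.outer_law (\<lambda>_. L.inner_law) L.field (L.spins C') q ?e"
    unfolding average_tilt
  proof (rule tilt_limit[where K="\<lambda>k. I \<rightarrow>\<^sub>E {1..N k}" and \<nu>="\<lambda>k \<omega>. gibbs_measure (N k) (H (N k) \<omega>)"
        and X="\<lambda>k \<omega> \<sigma>. - G (N k) p \<sigma> \<omega>" and a="\<lambda>k \<kappa> l \<omega> \<sigma>. \<Prod>i\<in>C' l. \<sigma> (\<kappa> i)"])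
    fix k
    show "finite (I \<rightarrow>\<^sub>E {1..N k})" by (intro finite_PiE I) simp
    show "I \<rightarrow>\<^sub>E {1..N k} \<noteq> {}" using N1[of k] by (simp add: PiE_eq_empty_iff)
    show "gaussian_tilt M (\<lambda>\<omega>. gibbs_measure (N k) (H (N k) \<omega>)) (neg_G (N k) p)
        (site_spins C' \<kappa>) q" if "\<kappa> \<in> I \<rightarrow>\<^sub>E {1..N k}" for \<kappa>
      unfolding H_def by (rule gibbs_tilt[OF N1 \<open>1 \<le> p\<close> _ C']) (use PiE_mem[OF that] I(3) in auto)
  next
    show "gaussian_tilt L.outer_law (\<lambda>_. L.inner_law) L.field (L.spins C') q"
      by (rule L.limit_tilt) (use I C' in blast)+
  next
    fix n \<theta>
    show "(\<lambda>k. (\<Sum>\<kappa>\<in>I \<rightarrow>\<^sub>E {1..N k}. gaussian_tilt.char_moment M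
        (\<lambda>\<omega>. gibbs_measure (N k) (H (N k) \<omega>)) (neg_G (N k) p)
        (site_spins C' \<kappa>) n \<theta>) / of_nat (card (I \<rightarrow>\<^sub>E {1..N k})))
      \<longlonglongrightarrow> gaussian_tilt.char_moment L.outer_law (\<lambda>_. L.inner_law) L.field (L.spins C') n \<theta>"
    proof -
      have average: "(\<Sum>\<kappa>\<in>I \<rightarrow>\<^sub>E {1..N k}. gaussian_tilt.char_moment M
          (\<lambda>\<omega>. gibbs_measure (N k) (H (N k) \<omega>)) (neg_G (N k) p)
          (site_spins C' \<kappa>) n \<theta>) / of_nat (card (I \<rightarrow>\<^sub>E {1..N k})) =
        of_real (\<integral>\<tau>. overlap_exponential p n \<theta> I (?L n) (\<lambda>L. set_overlap (N k) L \<tau>) \<partial>replica_space (N k) (H (N k)) {1..n})" for k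
        unfolding H_def by (rule gibbs_char_moment_average[OF N1 \<open>1 \<le> p\<close> I(1,3) C'])
      have limit: "gaussian_tilt.char_moment L.outer_law (\<lambda>_. L.inner_law) L.field (L.spins C') n \<theta> =
        of_real (\<integral>y. ?OE n \<theta> y \<partial>S.limit_space)"
        unfolding sb_def by (rule L.limit_char_moment[OF C' I])
      show ?thesis unfolding average limit by (rule tendsto_of_real[OF oe])
    qed
  qed
  also have "gaussian_tilt.tilt L.outer_law (\<lambda>_. L.inner_law) L.field (L.spins C') q ?e =
    expectation_wv M' (\<lambda>w v \<omega>.
       (\<Prod>l=1..q. expectation_uz (\<lambda>u z.
          (\<Prod>i\<in>C l. sb w u (v i)) * exp (t * augmented_process p sb \<gamma> w u \<omega> z))) /
       expectation_uz (\<lambda>u z. exp (t * augmented_process p sb \<gamma> w u \<omega> z)) ^ q)"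
  proof -
    have T: "gaussian_tilt L.outer_law (\<lambda>_. L.inner_law) L.field (L.spins C') q"
      by (rule L.limit_tilt) (use I C' in blast)+
    show ?thesis
      unfolding gaussian_tilt.tilt_def[OF T] gaussian_tilt.avg_def[OF T] gaussian_tilt.mass_def[OF T]
        expectation_wv_def expectation_uz_def L.field_def L.spins_def split_def sb_def
      by (intro Bochner_Integration.integral_cong refl) (simp add: prod_dividef C'_def)
  qed
  finally have tilted: "(\<lambda>k. annealed_average M (N k) (\<lambda>\<omega> \<sigma>. H (N k) \<omega> \<sigma> + t * G (N k) p \<sigma> \<omega>) (?f k)) \<longlonglongrightarrow> \<dots>" .

  \<comment> \<open>At zero frequencies the exponential factors are \<open>1\<close>, so the plain
    average becomes a case of \<open>oe\<close>.\<close>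
  have "annealed_average M (N k) (H (N k)) (?f k) =
    (\<integral>\<tau>. overlap_exponential p q (\<lambda>_. 0) I (?L q) (\<lambda>L. set_overlap (N k) L \<tau>) \<partial>replica_space (N k) (H (N k)) {1..q})" for k
  proof -
    have "annealed_average M (N k) (H (N k)) (?f k) = (\<integral>\<tau>. ?f k \<tau> \<partial>replica_space (N k) (H (N k)) {1..q})"
      unfolding H_def by (rule annealed_average_finite[OF H_measurable]) (auto simp: set_overlap_def intro!: prod.cong sum.cong)
    then show ?thesis by (simp add: overlap_exponential_def)
  qed
  with oe[of q "\<lambda>_. 0"] have "(\<lambda>k. annealed_average M (N k) (H (N k)) (?f k)) \<longlonglongrightarrow> (\<integral>y. ?OE q (\<lambda>_. 0) y \<partial>S.limit_space)"
    by simp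
  also have "(\<integral>y. ?OE q (\<lambda>_. 0) y \<partial>S.limit_space) =
    expectation_wv M' (\<lambda>w v \<omega>. \<Prod>l=1..q. expectation_uz (\<lambda>u z. \<Prod>i\<in>C l. sb w u (v i)))"
  proof -
    have T: "gaussian_tilt L.outer_law (\<lambda>_. L.inner_law) L.field (L.spins C') q"
      by (rule L.limit_tilt) (use I C' in blast)+
    \<comment> \<open>At zero frequencies the characteristic moment of the limit is the left-hand
      side of the theorem, read as a complex number.\<close>
    have "complex_of_real (\<integral>y. ?OE q (\<lambda>_. 0) y \<partial>S.limit_space) =
      gaussian_tilt.char_moment L.outer_law (\<lambda>_. L.inner_law) L.field (L.spins C') q (\<lambda>_. 0)"
      unfolding sb_def by (rule L.limit_char_moment[OF C' I, symmetric])
    also have "\<dots> = (\<integral>y. complex_of_real (\<Prod>l=1..q. \<integral>x. L.spins C' l y x \<partial>L.inner_law) \<partial>L.outer_law)"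
      unfolding gaussian_tilt.char_moment_def[OF T] by simp
    also have "\<dots> = complex_of_real (\<integral>y. (\<Prod>l=1..q. \<integral>x. L.spins C' l y x \<partial>L.inner_law) \<partial>L.outer_law)"
      by (rule integral_complex_of_real)
    finally have "(\<integral>y. ?OE q (\<lambda>_. 0) y \<partial>S.limit_space) = (\<integral>y. (\<Prod>l=1..q. \<integral>x. L.spins C' l y x \<partial>L.inner_law) \<partial>L.outer_law)"
      by (simp only: of_real_eq_iff)
    also have "\<dots> = expectation_wv M' (\<lambda>w v \<omega>. \<Prod>l=1..q. expectation_uz (\<lambda>u z. \<Prod>i\<in>C l. sb w u (v i)))"
      unfolding expectation_wv_def expectation_uz_def L.spins_def split_def sb_def
      by (intro Bochner_Integration.integral_cong refl) (simp add: C'_def)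
    finally show ?thesis .
  qed
  finally have untilted: "(\<lambda>k. annealed_average M (N k) (H (N k)) (?f k)) \<longlonglongrightarrow> \<dots>" .

  have "(\<lambda>k. annealed_average M (N k) (\<lambda>\<omega> \<sigma>. H (N k) \<omega> \<sigma> + t * G (N k) p \<sigma> \<omega>) (?f k) -
    annealed_average M (N k) (H (N k)) (?f k)) \<longlonglongrightarrow> 0"
  proof -
    \<comment> \<open>Stability is stated for overlaps indexed by lists; sorting a set gives a list
      without repetitions and hence the same product.\<close>
    define ls where "ls i = sorted_list_of_set (?L q i)" for i
    \<comment> \<open>Several \<open>i\<close> may share one list; each contributes its own factor,
      so powers of an overlap are covered.\<close>
    define \<phi> where "\<phi> x = (\<Prod>i\<in>I. x (ls i))" for x :: "nat list \<Rightarrow> real"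
    have F: "overlap_function \<phi> (ls ` I) n = (\<lambda>s. \<Prod>i\<in>I. set_overlap n (?L q i) s)" for n
    proof
      fix s
      have "multi_overlap n (ls i) s = set_overlap n (?L q i) s" for i
        unfolding multi_overlap_def set_overlap_def ls_def
        by (simp add: prod.distinct_set_conv_list[symmetric])
      then show "overlap_function \<phi> (ls ` I) n s = (\<Prod>i\<in>I. set_overlap n (?L q i) s)"
        unfolding overlap_function_def \<phi>_def by (intro prod.cong refl) simp
    qed
    have "continuous_on UNIV \<phi>"
      unfolding \<phi>_def by (intro continuous_on_prod continuous_on_product_coordinates)
    moreover have "finite (ls ` I)" using I by simp
    moreover have "ls ` I \<subseteq> lists {1..q}" by (auto simp: ls_def)
    ultimately have "(\<lambda>n. \<bar>annealed_average M n (\<lambda>\<omega> \<sigma>. H n \<omega> \<sigma> + t * G n p \<sigma> \<omega>) (overlap_function \<phi> (ls ` I) n)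
               - annealed_average M n (H n) (overlap_function \<phi> (ls ` I) n)\<bar>) \<longlonglongrightarrow> 0"
      using \<open>stochastically_stable M H G\<close> \<open>1 \<le> q\<close> \<open>1 \<le> p\<close> \<open>0 < t\<close> unfolding stochastically_stable_def by blast
    \<comment> \<open>Stability concerns the whole sequence of sizes and is restricted here to the
      subsequence \<open>N\<close>.\<close>
    from filterlim_compose[OF this N] show ?thesis unfolding F by (rule tendsto_rabs_zero_cancel)
  qed
  \<comment> \<open>Along \<open>N\<close> the same difference tends to \<open>0\<close> and to the
    difference of the two sides.\<close>
  from LIMSEQ_unique[OF this tendsto_diff[OF tilted untilted]] show ?thesis by simp
qed

end
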